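(* Let $Q=\{(a,b,c)\in\mathbb R^3: a>0,\ b>c>0\}$. For an initial condition in $Q$, let $(A(t),B(t),C(t))$, $t\in(-T_b,T_f)$, denote the maximal solution with $(A(0),B(0),C(0))$ equal to that initial condition of the system (the cross curvature flow for left-invariant metrics on $\mathrm{SL}(2,\mathbb R)$) $$\frac{dA}{dt}=-\frac{2AF_2F_3}{(ABC)^2},\qquad \frac{dB}{dt}=-\frac{2BF_3F_1}{(ABC)^2},\qquad \frac{dC}{dt}=-\frac{2CF_1F_2}{(ABC)^2},$$ where $$F_1=-3A^2+B^2+C^2-2BC-2AC-2AB,$$ $$F_2=-3B^2+A^2+C^2+2BC+2AC-2AB,$$ $$F_3=-3C^2+A^2+B^2+2BC-2AC+2AB.$$ There is an open dense subset $Q_0$ of $Q$ such that, for any maximal solution with $(A(0),B(0),C(0))\in Q_0$, as $t$ tends to $-T_b$, (1) either $A(t)\sim\eta_1(t+T_b)^{-1/14}$, $B(t)\sim\eta_2(t+T_b)^{3/14}$, $C(t)\sim\eta_3(t+T_b)^{3/14}$ for some constants $\eta_1,\eta_2,\eta_3\in(0,\infty)$; (2) or $A(t)\sim\eta_1(t+T_b)^{3/14}$, $B(t)\sim\eta_2(t+T_b)^{-1/14}$, $C(t)\sim\eta_3(t+T_b)^{3/14}$ for some constants $\eta_1,\eta_2,\eta_3\in(0,\infty)$. In fact, let $Q_1$ (resp. $Q_2$) be the set of initial conditions in $Q$ such that case (1) (resp. case (2)) occurs. Then there exists a smooth embedded hypersurface $S_0\subset Q$ such that $Q_1,Q_2$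 are the two connected components of $Q\setminus S_0$. Moreover, for initial conditions on $S_0$, as $t$ tends to $-T_b$, $$A(t)\sim 64\,\eta^{-1}(t+T_b),\qquad B(t)\sim\eta+4\sqrt{2(t+T_b)},\qquad C(t)\sim\eta-4\sqrt{2(t+T_b)}$$ for some $\eta\in(0,\infty)$.
   Context: Given a left-invariant metric $g_0$ on $\mathrm{SL}(2,\mathbb R)$ there is a left-invariant frame $(f_1,f_2,f_3)$ (Milnor frame) with $[f_2,f_3]=-2f_1$, $[f_3,f_1]=2f_2$, $[f_1,f_2]=2f_3$ in which $g_0=A_0f^1\otimes f^1+B_0f^2\otimes f^2+C_0f^3\otimes f^3$, where $(f^i)$ is the dual frame. The cross curvature flow is $\partial_t g=-2h$, $g(0)=g_0$, where the cross curvature tensor $h$ is, in an orthonormal frame $(e_i)$ diagonalizing the Ricci tensor with principal sectional curvatures $k_i=K(e_j\wedge e_l)$, the diagonal tensor with $h(e_i,e_i)=k_jk_l$ ($\{i,j,l\}=\{1,2,3\}$). Its solution has the form $g(t)=A(t)f^1\otimes f^1+B(t)f^2\otimes f^2+C(t)f^3\otimes f^3$ with $(A,B,C)$ solving exactly the displayed ODE system with initial condition $(A_0,B_0,C_0)$. By the symmetry exchanging $B$ and $C$, one considers $B_0\ge C_0$. $(-T_b,T_f)$ is the maximal interval of existence containing $0$; it is known that $T_b\in(0,\infty)$. The notation $f(t)\sim k(t)$ as $t\to -T_b$ means $f(t)/k(t)\to1$. *)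

theory Defs
  imports "HOL-Analysis.Analysis" "HOL-Library.Landau_Symbols"
begin

definition F1 :: "real \<Rightarrow> real \<Rightarrow> real \<Rightarrow> real" where
  "F1 a b c = - 3 * a\<^sup>2 + b\<^sup>2 + c\<^sup>2 - 2 * b * c - 2 * a * c - 2 * a * b"

definition F2 :: "real \<Rightarrow> real \<Rightarrow> real \<Rightarrow> real" where
  "F2 a b c = - 3 * b\<^sup>2 + a\<^sup>2 + c\<^sup>2 + 2 * b * c + 2 * a * c - 2 * a * b"

definition F3 :: "real \<Rightarrow> real \<Rightarrow> real \<Rightarrow> real" where
  "F3 a b c = - 3 * c\<^sup>2 + a\<^sup>2 + b\<^sup>2 + 2 * b * c - 2 * a * c + 2 * a * b"

text \<open>
  The functions \<open>A\<close>, \<open>B\<close>, \<open>C\<close> are the coefficients of a Riemannian metric, so the phase space of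
  the system is the open positive octant. A solution that stays in \<open>ABC \<noteq> 0\<close> and starts in the
  octant remains there, so requiring positivity does not shorten any interval of existence; it only
  keeps the (totalised) division away from zero denominators.
\<close>

definition xcf_solution_on ::
    "real set \<Rightarrow> (real \<Rightarrow> real) \<Rightarrow> (real \<Rightarrow> real) \<Rightarrow> (real \<Rightarrow> real) \<Rightarrow> bool" where
  "xcf_solution_on J A B C \<longleftrightarrow> (\<forall>t\<in>J.
     A t > 0 \<and> B t > 0 \<and> C t > 0 \<and>
     (A has_real_derivative
        - (2 * A t * F2 (A t) (B t) (C t) * F3 (A t) (B t) (C t)) / (A t * B t * C t)\<^sup>2) (at t) \<and>
     (B has_real_derivative
        - (2 * B t * F3 (A t) (B t) (C t) * F1 (A t) (B t) (C t)) / (A t * B t * C t)\<^sup>2) (at t) \<and>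
     (C has_real_derivative
        - (2 * C t * F1 (A t) (B t) (C t) * F2 (A t) (B t) (C t)) / (A t * B t * C t)\<^sup>2) (at t))"

text \<open>
  A maximal solution lives on the open interval from \<open>-Tb\<close> to \<open>Tf\<close>, whose end points may be
  infinite; the values of \<open>A\<close>, \<open>B\<close>, \<open>C\<close> outside this interval are irrelevant.
\<close>

definition xcf_maximal_solution ::
    "ereal \<Rightarrow> ereal \<Rightarrow> (real \<Rightarrow> real) \<Rightarrow> (real \<Rightarrow> real) \<Rightarrow> (real \<Rightarrow> real) \<Rightarrow> bool" where
  "xcf_maximal_solution Tb Tf A B C \<longleftrightarrow>
     0 < Tb \<and> 0 < Tf \<and> xcf_solution_on (einterval (- Tb) Tf) A B C \<and>
     (\<forall>Tb' Tf' A' B' C'.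
        Tb \<le> Tb' \<and> Tf \<le> Tf' \<and> xcf_solution_on (einterval (- Tb') Tf') A' B' C' \<and>
        (\<forall>t \<in> einterval (- Tb) Tf. A' t = A t \<and> B' t = B t \<and> C' t = C t)
        \<longrightarrow> Tb' = Tb \<and> Tf' = Tf)"

text \<open>
  Each asymptotic case below includes the finiteness of the backward existence time \<open>Tb\<close>.
\<close>

definition case1 ::
    "ereal \<Rightarrow> (real \<Rightarrow> real) \<Rightarrow> (real \<Rightarrow> real) \<Rightarrow> (real \<Rightarrow> real) \<Rightarrow> bool" where
  "case1 Tb A B C \<longleftrightarrow> (\<exists>T::real. Tb = ereal T \<and>
     (\<exists>\<eta>1>0. \<exists>\<eta>2>0. \<exists>\<eta>3>0.
        A \<sim>[at_right (- T)] (\<lambda>t. \<eta>1 * (t + T) powr (- 1 / 14)) \<and>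
        B \<sim>[at_right (- T)] (\<lambda>t. \<eta>2 * (t + T) powr (3 / 14)) \<and>
        C \<sim>[at_right (- T)] (\<lambda>t. \<eta>3 * (t + T) powr (3 / 14))))"

definition case2 ::
    "ereal \<Rightarrow> (real \<Rightarrow> real) \<Rightarrow> (real \<Rightarrow> real) \<Rightarrow> (real \<Rightarrow> real) \<Rightarrow> bool" where
  "case2 Tb A B C \<longleftrightarrow> (\<exists>T::real. Tb = ereal T \<and>
     (\<exists>\<eta>1>0. \<exists>\<eta>2>0. \<exists>\<eta>3>0.
        A \<sim>[at_right (- T)] (\<lambda>t. \<eta>1 * (t + T) powr (3 / 14)) \<and>
        B \<sim>[at_right (- T)] (\<lambda>t. \<eta>2 * (t + T) powr (- 1 / 14)) \<and>
        C \<sim>[at_right (- T)] (\<lambda>t. \<eta>3 * (t + T) powr (3 / 14))))"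

definition case_exceptional ::
    "ereal \<Rightarrow> (real \<Rightarrow> real) \<Rightarrow> (real \<Rightarrow> real) \<Rightarrow> (real \<Rightarrow> real) \<Rightarrow> bool" where
  "case_exceptional Tb A B C \<longleftrightarrow> (\<exists>T::real. Tb = ereal T \<and>
     (\<exists>\<eta>>0.
        A \<sim>[at_right (- T)] (\<lambda>t. 64 * inverse \<eta> * (t + T)) \<and>
        B \<sim>[at_right (- T)] (\<lambda>t. \<eta> + 4 * sqrt (2 * (t + T))) \<and>
        C \<sim>[at_right (- T)] (\<lambda>t. \<eta> - 4 * sqrt (2 * (t + T)))))"

definition Q :: "(real \<times> real \<times> real) set" where
  "Q = {(a, b, c). a > 0 \<and> b > c \<and> c > 0}"

definition Q1 :: "(real \<times> real \<times> real) set" where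
  "Q1 = {q \<in> Q. \<exists>Tb Tf A B C.
           xcf_maximal_solution Tb Tf A B C \<and> (A 0, B 0, C 0) = q \<and> case1 Tb A B C}"

definition Q2 :: "(real \<times> real \<times> real) set" where
  "Q2 = {q \<in> Q. \<exists>Tb Tf A B C.
           xcf_maximal_solution Tb Tf A B C \<and> (A 0, B 0, C 0) = q \<and> case2 Tb A B C}"

text \<open>
  \<open>Ck_on n U f\<close>: on the open set \<open>U\<close>, the map \<open>f\<close> is \<open>n\<close> times continuously differentiable,
  expressed through iterated directional derivatives (finite-dimensional domain).
\<close>

fun Ck_on :: "nat \<Rightarrow> 'a::euclidean_space set \<Rightarrow> ('a \<Rightarrow> 'b::euclidean_space) \<Rightarrow> bool" where
  "Ck_on 0 U f \<longleftrightarrow> continuous_on U f"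
| "Ck_on (Suc n) U f \<longleftrightarrow>
     (\<forall>x\<in>U. f differentiable (at x)) \<and>
     (\<forall>v. Ck_on n U (\<lambda>x. frechet_derivative f (at x) v))"

definition smooth_on :: "'a::euclidean_space set \<Rightarrow> ('a \<Rightarrow> 'b::euclidean_space) \<Rightarrow> bool" where
  "smooth_on U f \<longleftrightarrow> (\<forall>n. Ck_on n U f)"

text \<open>
  A smooth embedded submanifold of codimension one: around each of its points some diffeomorphism
  between open sets of the ambient space flattens \<open>S\<close> to a coordinate hyperplane.
\<close>

definition smooth_embedded_hypersurface :: "'a::euclidean_space set \<Rightarrow> bool" where
  "smooth_embedded_hypersurface S \<longleftrightarrow>
     (\<forall>p\<in>S. \<exists>U V (\<phi>::'a \<Rightarrow> 'a) \<psi>. \<exists>e\<in>Basis.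
        p \<in> U \<and> open U \<and> open V \<and>
        homeomorphism U V \<phi> \<psi> \<and> smooth_on U \<phi> \<and> smooth_on V \<psi> \<and>
        \<phi> ` (U \<inter> S) = {y \<in> V. y \<bullet> e = 0})"

end

theory Submission
  imports Defs
begin

text \<open>
  The system is invariant under scaling, so its orbits project to the plane of
  \<open>u = A / C\<close>, \<open>w = (B - C) / C\<close>, where they solve a scalar equation \<open>dw / du = G u w\<close> with \<open>G\<close>
  rational. On \<open>w \<ge> u > 0\<close> the slope \<open>G u\<close> is strictly decreasing, so two solutions of the scalar
  equation approach each other as \<open>u\<close> grows. Starting solutions ever closer to \<open>u = 0\<close> therefore
  gives a limit \<open>f\<close>, the separatrix, and \<open>S\<^sub>0\<close> is the cone \<open>w = f u\<close>. It is smooth because \<open>f\<close>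
  solves an equation with smooth right-hand side.

  Along the flow, \<open>z = w - f u\<close> satisfies a linear equation, so its sign is preserved.
  If \<open>F\<^sub>1\<close> and \<open>F\<^sub>2\<close> stay negative for all earlier times, then \<open>u\<close> and \<open>w\<close> tend to \<open>0\<close> backward in
  time whereas, for \<open>w \<ge> u\<close>, \<open>\<bar>z\<bar>\<close> does not decrease, which forces \<open>z = 0\<close>; for \<open>w < u\<close> the monotone
  quantity \<open>w - u - ln u\<close> gives a contradiction. Hence backward in time a solution with
  \<open>z > 0\<close> reaches \<open>F\<^sub>1 \<ge> 0\<close>, after which \<open>B\<close> dominates, and one with \<open>z < 0\<close> reaches \<open>F\<^sub>2 \<ge> 0\<close>, after
  which \<open>A\<close> dominates. If \<open>D\<close> is the dominating coefficient and \<open>X\<close> another one, then \<open>X D\<^sup>3\<close> converges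
  and \<open>D\<close> to the power \<open>-14\<close> vanishes linearly in time. For \<open>z = 0\<close> the asymptotics follow from
  \<open>(f u)\<^sup>2 / u \<longlongrightarrow> 2\<close> as \<open>u\<close> tends to \<open>0\<close>.
\<close>

section \<open>Scalar comparison and existence for ordinary differential equations\<close>

text \<open>The scalar equation is singular at the origin, where \<open>DD\<close> vanishes, so no
  initial value problem can be posed there and the separatrix has to be a limit. Its constant 2 is a
  balance: along \<open>w^2 = y * u\<close> the logarithmic slope \<open>u * GG u w / w\<close>
  tends to \<open>(4 - y) / (2 * y)\<close>, while a parabola has logarithmic slope 1/2; these agree
  only for \<open>y = 2\<close>.

  The exponents come from the model in which \<open>D\<close> dominates. The factor \<open>F\<close>
  belonging to \<open>D\<close> is then about \<open>- 3 * D^2\<close> and the other two are about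
  \<open>D^2\<close>, so \<open>ln X\<close> and \<open>ln D\<close> change at rates in the ratio 3
  to -1, and \<open>X * D^3\<close> converges. Consequently
  \<open>D' / D = - 2 * D^2 / (X * Y)^2\<close> is asymptotically a multiple of \<open>D^14\<close>,
  which gives the power -14.

  Finiteness of the backward existence time is a conclusion in each regime. Limits are therefore
  taken along a filter that makes sense for unbounded intervals, and maximality is used in the form
  that no solution stays in a compact box of the octant back to a finite left end.\<close>

lemma barrier_nonneg:
  fixes g g' :: "real \<Rightarrow> real"
  assumes "a \<le> b"
    and der: "\<And>t. t \<in> {a..b} \<Longrightarrow> (g has_real_derivative g' t) (at t within {a..b})"
    and pos: "\<And>t. t \<in> {a..b} \<Longrightarrow> g t = 0 \<Longrightarrow> g' t > 0"
    and "g a \<ge> 0"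
  shows "g b \<ge> 0"
proof (rule ccontr)
  assume neg: "\<not> g b \<ge> 0"
  define S where "S = {t \<in> {a..b}. g t \<ge> 0}"
  have cont: "continuous_on {a..b} g"
    using der by (meson DERIV_continuous continuous_on_eq_continuous_within)
  have S_ne: "a \<in> S" using assms by (simp add: S_def)
  have "S = {a..b} \<inter> g -` {0..}" by (auto simp: S_def)
  then have "closed S" using continuous_closed_preimage[OF cont, of "{0..}"] by simp
  moreover have "bounded S" by (rule bounded_subset[of "{a..b}"]) (auto simp: S_def)
  ultimately have "compact S" by (simp add: compact_eq_bounded_closed)
  \<comment> \<open>\<open>c\<close> is the last point with \<open>g \<ge> 0\<close>. There
    \<open>g\<close> vanishes, and its positive derivative contradicts negativity just after
    \<open>c\<close>.\<close>
  then obtain c where c: "c \<in> S" and max: "\<And>t. t \<in> S \<Longrightarrow> t \<le> c"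
    using compact_attains_sup[of S] S_ne by blast
  have cb: "c \<in> {a..b}" "g c \<ge> 0" using c by (auto simp: S_def)
  then have "c < b" using neg by (metis atLeastAtMost_iff less_eq_real_def)
  have after: "g t < 0" if "c < t" "t \<le> b" for t
    using max[of t] that cb by (force simp: S_def)
  have "g c \<le> 0"
  proof (rule ccontr)
    assume "\<not> g c \<le> 0"
    then have "\<exists>t. c \<le> t \<and> t \<le> b \<and> g t = 0"
      using IVT2'[of g b 0 c] neg \<open>c < b\<close> continuous_on_subset[OF cont, of "{c..b}"] cb by auto
    then show False using after \<open>\<not> g c \<le> 0\<close> by (metis less_irrefl order.order_iff_strict)
  qed
  with cb have "g c = 0" by simp
  from pos[OF cb(1) this] der[OF cb(1)] obtain d where d: "d > 0"
    "\<And>h. h > 0 \<Longrightarrow> c + h \<in> {a..b} \<Longrightarrow> h < d \<Longrightarrow> g c < g (c + h)"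
    using has_real_derivative_pos_inc_right by blast
  define h where "h = min (d / 2) (b - c)"
  have "h > 0" "h < d" "c + h \<le> b" using d(1) \<open>c < b\<close> by (auto simp: h_def)
  then have "g c < g (c + h)" using d(2) cb by auto
  moreover have "g (c + h) < 0" using after \<open>h > 0\<close> \<open>c + h \<le> b\<close> by auto
  ultimately show False using cb by simp
qed

text \<open>The sign of the derivative is required only at zeros of \<open>g\<close>, which matches
  the applications: two curves are compared only where they meet. A zero at \<open>b\<close> would
  make \<open>g\<close> negative just before \<open>b\<close>, against \<open>barrier_nonneg\<close>
  on a shorter interval.\<close>

lemma barrier_pos:
  fixes g g' :: "real \<Rightarrow> real"
  assumes "a < b"
    and der: "\<And>t. t \<in> {a..b} \<Longrightarrow> (g has_real_derivative g' t) (at t within {a..b})"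
    and pos: "\<And>t. t \<in> {a..b} \<Longrightarrow> g t = 0 \<Longrightarrow> g' t > 0"
    and "g a \<ge> 0"
  shows "g b > 0"
proof (rule ccontr)
  assume "\<not> g b > 0"
  with barrier_nonneg[of a b g g'] assms have "g b = 0" by force
  have "b \<in> {a..b}" using \<open>a < b\<close> by simp
  from pos[OF this \<open>g b = 0\<close>] der[OF this] obtain d where d: "d > 0"
    "\<And>h. h > 0 \<Longrightarrow> b - h \<in> {a..b} \<Longrightarrow> h < d \<Longrightarrow> g (b - h) < g b"
    using has_real_derivative_pos_inc_left by blast
  define h where "h = min (d / 2) (b - a)"
  have h: "h > 0" "h < d" "a \<le> b - h" using d(1) \<open>a < b\<close> by (auto simp: h_def)
  then have "g (b - h) < 0" using d(2)[of h] \<open>g b = 0\<close> by auto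
  moreover have "g (b - h) \<ge> 0"
  proof (rule barrier_nonneg[of a "b - h" g g'])
    fix t assume t: "t \<in> {a..b - h}"
    then show "(g has_real_derivative g' t) (at t within {a..b - h})"
      using der[of t] h by (auto intro: DERIV_subset)
    show "g t = 0 \<Longrightarrow> g' t > 0" using pos[of t] t h by auto
  qed (use h assms in auto)
  ultimately show False by simp
qed

text \<open>Integrating factor. Differences of solutions are treated as solutions of a homogeneous
  linear equation; the formula then gives preservation of sign, and decrease of the absolute value
  when \<open>k \<le> 0\<close>.\<close>

lemma linear_ode_solution:
  fixes z k :: "real \<Rightarrow> real"
  assumes "a \<le> b" and k: "continuous_on {a..b} k"
    and der: "\<And>t. t \<in> {a..b} \<Longrightarrow> (z has_real_derivative k t * z t) (at t within {a..b})"
  shows "z b = z a * exp (integral {a..b} k)"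
proof -
  define I where "I t = integral {a..t} k" for t
  define y where "y t = z t * exp (- I t)" for t
  have I: "(I has_real_derivative k t) (at t within {a..b})" if "t \<in> {a..b}" for t
    unfolding I_def has_real_derivative_iff_has_vector_derivative
    by (rule integral_has_vector_derivative[OF k that])
  have "(y has_real_derivative 0) (at t within {a..b})" if "t \<in> {a..b}" for t
    unfolding y_def by (auto intro!: derivative_eq_intros der[OF that] I[OF that])
  then have "\<exists>c. \<forall>t\<in>{a..b}. y t = c"
    using has_field_derivative_zero_constant[of "{a..b}" y] by auto
  then have "y b = y a" using \<open>a \<le> b\<close> by auto
  then show ?thesis
    by (simp add: y_def I_def exp_minus field_simps)
qed

text \<open>The Lipschitz bound holds for all states, so the solution exists on the whole given
  interval. Applications truncate their right-hand side to reach this situation and later show that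
  the solution stays where the truncation is the identity.\<close>

lemma picard_lindelof:
  fixes H :: "real \<Rightarrow> 'a::euclidean_space \<Rightarrow> 'a"
  assumes "a \<le> b"
    and cont: "continuous_on ({a..b} \<times> UNIV) (\<lambda>(t, x). H t x)"
    and lip: "\<And>t x y. t \<in> {a..b} \<Longrightarrow> dist (H t x) (H t y) \<le> L * dist x y"
  obtains x where "x a = x0"
    "\<And>t. t \<in> {a..b} \<Longrightarrow> (x has_vector_derivative H t (x t)) (at t within {a..b})"
proof -
  define K where "K = 2 * (\<bar>L\<bar> + 1)"
  define E where "E t = exp (K * (t - a))" for t
  have K: "K > 0" by (simp add: K_def)
  have E: "E t > 0" for t by (simp add: E_def)
  define V where "V y r = H r (E r *\<^sub>R y r)" for y :: "real \<Rightarrow> 'a" and r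
  txt \<open>With the weight \<open>E\<close> the Picard operator contracts on the whole interval, whatever its length.\<close>
  define \<Phi> where "\<Phi> y t = inverse (E t) *\<^sub>R (x0 + integral {a..t} (V y))" for y t
  have Vcont: "continuous_on {a..b} (V (apply_bcontfun y))" for y :: "real \<Rightarrow>\<^sub>C 'a"
  proof -
    have "continuous_on {a..b} (\<lambda>r. (r, E r *\<^sub>R apply_bcontfun y r))"
      unfolding E_def by (intro continuous_intros) auto
    then have "continuous_on {a..b} ((\<lambda>(t, x). H t x) \<circ> (\<lambda>r. (r, E r *\<^sub>R apply_bcontfun y r)))"
      by (rule continuous_on_compose) (rule continuous_on_subset[OF cont], auto)
    then show ?thesis by (simp add: o_def V_def)
  qed
  have \<Phi>cont: "continuous_on (cbox a b) (\<Phi> (apply_bcontfun y))" for y :: "real \<Rightarrow>\<^sub>C 'a"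
    unfolding \<Phi>_def E_def cbox_interval
    by (intro continuous_intros indefinite_integral_continuous_1 integrable_continuous_interval Vcont) auto
  \<comment> \<open>Bounded continuous functions live on the whole real line. Freezing
    \<open>\<Phi>\<close> outside \<open>{a..b}\<close> by \<open>clamp\<close> makes it an operator
    on that complete space.\<close>
  have "\<exists>g :: real \<Rightarrow>\<^sub>C 'a. (\<forall>t\<in>{a..b}. g t = \<Phi> (apply_bcontfun y) t) \<and>
      (\<forall>t. g t = \<Phi> (apply_bcontfun y) (clamp a b t))" for y :: "real \<Rightarrow>\<^sub>C 'a"
    using continuous_on_cbox_bcontfunE[OF \<Phi>cont[of y]] by (metis cbox_interval)
  then obtain T :: "(real \<Rightarrow>\<^sub>C 'a) \<Rightarrow> (real \<Rightarrow>\<^sub>C 'a)"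
    where T: "\<And>y t. t \<in> {a..b} \<Longrightarrow> T y t = \<Phi> (apply_bcontfun y) t"
      and Tc: "\<And>y t. T y t = \<Phi> (apply_bcontfun y) (clamp a b t)"
    by metis
  \<comment> \<open>\<open>K\<close> is at least twice \<open>L\<close>, and
    \<open>E' = K * E\<close>. So the unweighted difference at \<open>s\<close> is at most
    \<open>dist y z / 2\<close> times \<open>E s - E a\<close>, and division by \<open>E s\<close>
    leaves the factor 1/2.\<close>
  have contr: "dist (T y) (T z) \<le> 1 / 2 * dist y z" for y z
  proof (rule dist_bound, goal_cases)
    case (1 t)
    define s where "s = clamp a b t"
    have s: "s \<in> {a..b}"
      using clamp_in_interval[of a b t] \<open>a \<le> b\<close> by (simp add: s_def)
    have Ei: "((\<lambda>r. K * E r) has_integral (E s - E a)) {a..s}"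
      using s unfolding E_def
      by (intro fundamental_theorem_of_calculus)
        (auto intro!: derivative_eq_intros simp: has_real_derivative_iff_has_vector_derivative[symmetric])
    have Ei2: "((\<lambda>r. (dist y z / 2) * (K * E r)) has_integral (dist y z / 2) * (E s - E a)) {a..s}"
      by (rule has_integral_mult_right[OF Ei])
    have int: "V (apply_bcontfun y) integrable_on {a..s}" for y :: "real \<Rightarrow>\<^sub>C 'a"
      using s by (intro integrable_continuous_interval continuous_on_subset[OF Vcont]) auto
    have bd: "norm (V (apply_bcontfun y) r - V (apply_bcontfun z) r) \<le> (dist y z / 2) * (K * E r)"
      if "r \<in> {a..s}" for r
    proof -
      have "norm (V (apply_bcontfun y) r - V (apply_bcontfun z) r)
          \<le> L * dist (E r *\<^sub>R apply_bcontfun y r) (E r *\<^sub>R apply_bcontfun z r)"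
        unfolding V_def dist_norm[symmetric] using that s by (intro lip) auto
      also have "\<dots> = L * (E r * dist (apply_bcontfun y r) (apply_bcontfun z r))"
        using E[of r] by (simp add: dist_norm flip: scaleR_diff_right)
      also have "\<dots> \<le> (K / 2) * (E r * dist y z)"
        using E[of r] dist_bounded[of y r z]
        by (intro mult_mono) (auto simp: K_def)
      finally show ?thesis by (simp add: algebra_simps)
    qed
    have "norm (integral {a..s} (V (apply_bcontfun y)) - integral {a..s} (V (apply_bcontfun z)))
        = norm (integral {a..s} (\<lambda>r. V (apply_bcontfun y) r - V (apply_bcontfun z) r))"
      using int by (simp add: integral_diff)
    also have "\<dots> \<le> integral {a..s} (\<lambda>r. (dist y z / 2) * (K * E r))"
      using bd int has_integral_integrable[OF Ei2] by (intro integral_norm_bound_integral integrable_diff) auto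
    also have "\<dots> = (dist y z / 2) * (E s - E a)"
      by (rule integral_unique[OF Ei2])
    also have "\<dots> \<le> (dist y z / 2) * E s"
      using E[of a] by (intro mult_left_mono) auto
    finally have "inverse (E s) * norm (integral {a..s} (V (apply_bcontfun y)) - integral {a..s} (V (apply_bcontfun z)))
        \<le> inverse (E s) * ((dist y z / 2) * E s)"
      using E[of s] by (intro mult_left_mono) auto
    also have "\<dots> = 1 / 2 * dist y z" using E[of s] by simp
    finally show ?case
      using E[of s]
      by (simp add: Tc s_def[symmetric] \<Phi>_def dist_norm[of "_ *\<^sub>R _"] flip: scaleR_diff_right)
  qed
  have "\<exists>!y. T y = y"
    by (rule banach_fix_type[of "1/2"]) (use contr in auto)
  then obtain y where y: "T y = y" by blast
  define x where "x t = x0 + integral {a..t} (V (apply_bcontfun y))" for t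
  have xy: "E t *\<^sub>R apply_bcontfun y t = x t" if "t \<in> {a..b}" for t
    using T[OF that, of y] E[of t] unfolding y by (simp add: x_def \<Phi>_def)
  show thesis
  proof
    show "x a = x0" by (simp add: x_def)
    fix t assume t: "t \<in> {a..b}"
    have "((\<lambda>u. integral {a..u} (V (apply_bcontfun y))) has_vector_derivative V (apply_bcontfun y) t)
        (at t within {a..b})"
      by (rule integral_has_vector_derivative[OF Vcont t])
    then have "(x has_vector_derivative V (apply_bcontfun y) t) (at t within {a..b})"
      unfolding x_def by (auto intro!: derivative_eq_intros)
    then show "(x has_vector_derivative H t (x t)) (at t within {a..b})"
      using xy[OF t] by (simp add: V_def)
  qed
qed

section \<open>The reduced scalar equation and its separatrix\<close>

text \<open>In the coordinates \<open>u = A / C\<close> and \<open>w = (B - C) / C\<close> one has \<open>F1 = - C\<^sup>2 PP u w\<close>,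
  \<open>F2 = - C\<^sup>2 MM u w\<close>, and orbits satisfy \<open>dw / du = GG u w\<close>.\<close>

definition PP :: "real \<Rightarrow> real \<Rightarrow> real" where
  "PP u w = 3 * u\<^sup>2 + 4 * u + 2 * u * w - w\<^sup>2"

definition MM :: "real \<Rightarrow> real \<Rightarrow> real" where
  "MM u w = 3 * w\<^sup>2 + 4 * w + 2 * u * w - u\<^sup>2"

definition NN :: "real \<Rightarrow> real \<Rightarrow> real" where
  "NN u w = (1 + w) * w * (2 + u + w) * PP u w"

definition DD :: "real \<Rightarrow> real \<Rightarrow> real" where
  "DD u w = (u + w) * MM u w"

text \<open>\<open>KK u\<close> is the divided difference of \<open>NN u / DD u\<close>, up to the denominators. After the shifts
  \<open>x = u + p\<close>, \<open>y = u + q\<close> all its coefficients are negative.\<close>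

definition KK :: "real \<Rightarrow> real \<Rightarrow> real \<Rightarrow> real" where
  "KK u x y = - 3 * u^6 * x - 3 * u^6 * y - 3 * u^6 - 5 * u^5 * x^2 - 2 * u^5 * x * y - 15 * u^5 * x - 5
    * u^5 * y^2 - 15 * u^5 * y - 10 * u^5 - u^4 * x^3 + 4 * u^4 * x^2 * y - 9 * u^4 * x^2 + 4
    * u^4 * x * y^2 + 3 * u^4 * x * y - 16 * u^4 * x - u^4 * y^3 - 9 * u^4 * y^2 - 16 * u^4 *
    y - 8 * u^4 + u^3 * x^4 + 2 * u^3 * x^3 * y + 3 * u^3 * x^3 + 18 * u^3 * x^2 * y^2 + 23 *
    u^3 * x^2 * y + 2 * u^3 * x^2 + 2 * u^3 * x * y^3 + 23 * u^3 * x * y^2 + 16 * u^3 * x * y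
    + u^3 * y^4 + 3 * u^3 * y^3 + 2 * u^3 * y^2 - u^2 * x^4 * y + 4 * u^2 * x^3 * y^2 + u^2 *
    x^3 * y + 4 * u^2 * x^2 * y^3 + 21 * u^2 * x^2 * y^2 + 4 * u^2 * x^2 * y - u^2 * x * y^4 +
    u^2 * x * y^3 + 4 * u^2 * x * y^2 - 16 * u^2 * x * y - 5 * u * x^4 * y^2 - 4 * u * x^4 * y
    - 2 * u * x^3 * y^3 - 15 * u * x^3 * y^2 - 12 * u * x^3 * y - 5 * u * x^2 * y^4 - 15 * u *
    x^2 * y^3 - 34 * u * x^2 * y^2 - 32 * u * x^2 * y - 4 * u * x * y^4 - 12 * u * x * y^3 -
    32 * u * x * y^2 - 32 * u * x * y - 3 * x^4 * y^3 - 4 * x^4 * y^2 - 3 * x^3 * y^4 - 13 *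
    x^3 * y^3 - 12 * x^3 * y^2 - 4 * x^2 * y^4 - 12 * x^2 * y^3 - 8 * x^2 * y^2"

definition GG :: "real \<Rightarrow> real \<Rightarrow> real" where
  "GG u w = NN u w / (u * (u + 1) * DD u w)"

section \<open>Strict monotonicity of the slope in \<open>w\<close>\<close>

lemma KK_divided_difference: "NN u x * DD u y - NN u y * DD u x = (x - y) * KK u x y"
  unfolding NN_def DD_def PP_def MM_def KK_def
  by (simp add: algebra_simps eval_nat_numeral)

lemma KK_neg:
  assumes "u > 0" "x \<ge> u" "y \<ge> u"
  shows "KK u x y < 0"
proof -
  have "KK u (u + p) (u + q) < 0" if p: "p \<ge> 0" "q \<ge> 0" for p q
  proof -
    have eq: "KK u (u + p) (u + q) = - (32 * u^6 + 32 * u^5 * p^2 + 32 * u^5 * p * q + 64 * u^5 * p + 32 * u^5 * q^2 + 64 * u^5 *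
    q + 96 * u^5 + 32 * u^4 * p^3 + 112 * u^4 * p^2 * q + 104 * u^4 * p^2 + 112 * u^4 * p *
    q^2 + 208 * u^4 * p * q + 160 * u^4 * p + 32 * u^4 * q^3 + 104 * u^4 * q^2 + 160 * u^4 * q
    + 96 * u^4 + 8 * u^3 * p^4 + 88 * u^3 * p^3 * q + 56 * u^3 * p^3 + 144 * u^3 * p^2 * q^2 +
    272 * u^3 * p^2 * q + 112 * u^3 * p^2 + 88 * u^3 * p * q^3 + 272 * u^3 * p * q^2 + 320 *
    u^3 * p * q + 128 * u^3 * p + 8 * u^3 * q^4 + 56 * u^3 * q^3 + 112 * u^3 * q^2 + 128 * u^3
    * q + 32 * u^3 + 20 * u^2 * p^4 * q + 8 * u^2 * p^4 + 76 * u^2 * p^3 * q^2 + 116 * u^2 *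
    p^3 * q + 24 * u^2 * p^3 + 76 * u^2 * p^2 * q^3 + 234 * u^2 * p^2 * q^2 + 208 * u^2 * p^2
    * q + 40 * u^2 * p^2 + 20 * u^2 * p * q^4 + 116 * u^2 * p * q^3 + 208 * u^2 * p * q^2 +
    176 * u^2 * p * q + 32 * u^2 * p + 8 * u^2 * q^4 + 24 * u^2 * q^3 + 40 * u^2 * q^2 + 32 *
    u^2 * q + 14 * u * p^4 * q^2 + 12 * u * p^4 * q + 26 * u * p^3 * q^3 + 70 * u * p^3 * q^2
    + 36 * u * p^3 * q + 14 * u * p^2 * q^4 + 70 * u * p^2 * q^3 + 106 * u * p^2 * q^2 + 48 *
    u * p^2 * q + 12 * u * p * q^4 + 36 * u * p * q^3 + 48 * u * p * q^2 + 32 * u * p * q + 3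
    * p^4 * q^3 + 4 * p^4 * q^2 + 3 * p^3 * q^4 + 13 * p^3 * q^3 + 12 * p^3 * q^2 + 4 * p^2 *
    q^4 + 12 * p^2 * q^3 + 8 * p^2 * q^2)"
      unfolding KK_def by (simp add: algebra_simps eval_nat_numeral)
    \<comment> \<open>All monomials carry positive coefficients, and \<open>32 * u^6\<close> keeps
      the sum positive at \<open>p = q = 0\<close>.\<close>
    have "0 < 32 * u^6 + 32 * u^5 * p^2 + 32 * u^5 * p * q + 64 * u^5 * p + 32 * u^5 * q^2 + 64 * u^5 *
    q + 96 * u^5 + 32 * u^4 * p^3 + 112 * u^4 * p^2 * q + 104 * u^4 * p^2 + 112 * u^4 * p *
    q^2 + 208 * u^4 * p * q + 160 * u^4 * p + 32 * u^4 * q^3 + 104 * u^4 * q^2 + 160 * u^4 * q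
    + 96 * u^4 + 8 * u^3 * p^4 + 88 * u^3 * p^3 * q + 56 * u^3 * p^3 + 144 * u^3 * p^2 * q^2 +
    272 * u^3 * p^2 * q + 112 * u^3 * p^2 + 88 * u^3 * p * q^3 + 272 * u^3 * p * q^2 + 320 *
    u^3 * p * q + 128 * u^3 * p + 8 * u^3 * q^4 + 56 * u^3 * q^3 + 112 * u^3 * q^2 + 128 * u^3
    * q + 32 * u^3 + 20 * u^2 * p^4 * q + 8 * u^2 * p^4 + 76 * u^2 * p^3 * q^2 + 116 * u^2 *
    p^3 * q + 24 * u^2 * p^3 + 76 * u^2 * p^2 * q^3 + 234 * u^2 * p^2 * q^2 + 208 * u^2 * p^2
    * q + 40 * u^2 * p^2 + 20 * u^2 * p * q^4 + 116 * u^2 * p * q^3 + 208 * u^2 * p * q^2 +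
    176 * u^2 * p * q + 32 * u^2 * p + 8 * u^2 * q^4 + 24 * u^2 * q^3 + 40 * u^2 * q^2 + 32 *
    u^2 * q + 14 * u * p^4 * q^2 + 12 * u * p^4 * q + 26 * u * p^3 * q^3 + 70 * u * p^3 * q^2
    + 36 * u * p^3 * q + 14 * u * p^2 * q^4 + 70 * u * p^2 * q^3 + 106 * u * p^2 * q^2 + 48 *
    u * p^2 * q + 12 * u * p * q^4 + 36 * u * p * q^3 + 48 * u * p * q^2 + 32 * u * p * q + 3
    * p^4 * q^3 + 4 * p^4 * q^2 + 3 * p^3 * q^4 + 13 * p^3 * q^3 + 12 * p^3 * q^2 + 4 * p^2 *
    q^4 + 12 * p^2 * q^3 + 8 * p^2 * q^2"
      using p \<open>u > 0\<close> by (intro add_pos_nonneg) simp_all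
    then show ?thesis unfolding eq by linarith
  qed
  from this[of "x - u" "y - u"] assms show ?thesis by simp
qed

text \<open>Counterpart of \<open>KK_neg\<close> below the diagonal. The comparison point is the
  diagonal one, \<open>y = u\<close>, and the substitution \<open>u = q + x\<close> again makes
  every coefficient negative.\<close>

lemma KK_low:
  assumes "0 < x" "x \<le> u"
  shows "KK u x u < 0"
proof -
  have "KK (q + x) x (q + x) < 0" if q: "q \<ge> 0" for q
  proof -
    have eq: "KK (q + x) x (q + x) = - (32 * x^6 + 32 * x^5 * q^2 + 128 * x^5 * q + 96 * x^5 + 128 * x^4 * q^3 + 264 * x^4 * q^2 +
    320 * x^4 * q + 96 * x^4 + 200 * x^3 * q^4 + 360 * x^3 * q^3 + 432 * x^3 * q^2 + 256 * x^3
    * q + 32 * x^3 + 152 * x^2 * q^5 + 304 * x^2 * q^4 + 312 * x^2 * q^3 + 232 * x^2 * q^2 +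
    64 * x^2 * q + 56 * x * q^6 + 136 * x * q^5 + 128 * x * q^4 + 80 * x * q^3 + 32 * x * q^2
    + 8 * q^7 + 24 * q^6 + 24 * q^5 + 8 * q^4)"
      unfolding KK_def by (simp add: algebra_simps eval_nat_numeral)
    have "0 < 32 * x^6 + 32 * x^5 * q^2 + 128 * x^5 * q + 96 * x^5 + 128 * x^4 * q^3 + 264 * x^4 * q^2 +
    320 * x^4 * q + 96 * x^4 + 200 * x^3 * q^4 + 360 * x^3 * q^3 + 432 * x^3 * q^2 + 256 * x^3
    * q + 32 * x^3 + 152 * x^2 * q^5 + 304 * x^2 * q^4 + 312 * x^2 * q^3 + 232 * x^2 * q^2 +
    64 * x^2 * q + 56 * x * q^6 + 136 * x * q^5 + 128 * x * q^4 + 80 * x * q^3 + 32 * x * q^2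
    + 8 * q^7 + 24 * q^6 + 24 * q^5 + 8 * q^4"
      using q \<open>x > 0\<close> by (intro add_pos_nonneg) simp_all
    then show ?thesis unfolding eq by linarith
  qed
  from this[of "u - x"] assms show ?thesis by simp
qed

lemma DD_pos:
  assumes "u > 0" "w \<ge> u"
  shows "DD u w > 0"
proof -
  have "u\<^sup>2 \<le> w\<^sup>2" using assms by (intro power_mono) auto
  moreover have "u * w > 0" "w\<^sup>2 > 0" using assms by simp_all
  ultimately have "MM u w > 0" unfolding MM_def using assms by linarith
  then show ?thesis unfolding DD_def using assms by simp
qed

lemma GG_diff:
  assumes "u > 0" "DD u x \<noteq> 0" "DD u y \<noteq> 0"
  shows "GG u x - GG u y = KK u x y / (u * (u + 1) * DD u x * DD u y) * (x - y)"
proof -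
  have frac: "a / (v * p) - b / (v * q) = (a * q - b * p) / (v * p * q)"
    if "v \<noteq> 0" "p \<noteq> 0" "q \<noteq> 0" for a b v p q :: real
    using that by (simp add: field_simps)
  have "u * (u + 1) \<noteq> 0" using assms by simp
  then have "GG u x - GG u y = (NN u x * DD u y - NN u y * DD u x) / (u * (u + 1) * DD u x * DD u y)"
    unfolding GG_def using assms by (intro frac)
  then show ?thesis by (simp add: KK_divided_difference)
qed

lemma GG_antimono:
  assumes "u > 0" "u \<le> x" "x \<le> y"
  shows "GG u y \<le> GG u x"
proof -
  have "KK u y x < 0" "DD u x > 0" "DD u y > 0" using assms by (auto intro!: KK_neg DD_pos)
  then have "KK u y x / (u * (u + 1) * DD u y * DD u x) < 0"
    using assms by (intro divide_neg_pos mult_pos_pos) auto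
  then have "GG u y - GG u x \<le> 0"
    using GG_diff[of u y x] assms \<open>DD u x > 0\<close> \<open>DD u y > 0\<close>
      mult_nonpos_nonneg[of "KK u y x / (u * (u + 1) * DD u y * DD u x)" "y - x"]
    by linarith
  then show ?thesis by simp
qed

text \<open>The slope on the diagonal exceeds 1, so solutions can cross \<open>w = u\<close> only
  upwards: the diagonal is a lower barrier. The primitive \<open>u + ln u\<close> of this slope
  returns in \<open>below_diagonal\<close>.\<close>

lemma GG_diag:
  assumes "u > 0"
  shows "GG u u = 1 + 1 / u"
proof -
  have 1: "NN u u = 8 * u\<^sup>2 * (1 + u) ^ 3" "DD u u = 8 * u\<^sup>2 * (1 + u)"
    by (simp_all add: NN_def DD_def PP_def MM_def algebra_simps eval_nat_numeral)
  have "1 + u \<noteq> 0" using assms by simp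
  then show ?thesis
    unfolding GG_def 1 using assms by (simp add: divide_simps) (simp add: algebra_simps eval_nat_numeral)
qed

lemma GG_nonpos:
  assumes "u > 0" "u \<le> w" "PP u w \<le> 0"
  shows "GG u w \<le> 0"
  unfolding GG_def NN_def using assms DD_pos[of u w]
  by (intro divide_nonpos_pos mult_nonneg_nonpos mult_pos_pos) auto

text \<open>Completing the square shows that \<open>PP u w \<ge> 0\<close> is a strip of half-width
  \<open>2 * sqrt (u^2 + u)\<close> around the diagonal, which closes up as \<open>u\<close> tends
  to 0.\<close>

lemma PP_shift: "PP u w = 4 * u\<^sup>2 + 4 * u - (w - u)\<^sup>2"
  by (simp add: PP_def power2_eq_square algebra_simps)

text \<open>The offset \<open>w - u\<close> turns the region above the diagonal into a box. On it
  the difference quotient of \<open>GG\<close> is the explicit continuous function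
  \<open>\<kappa>\<close>, bounded by compactness.\<close>

lemma GG_lipschitz:
  assumes "a > 0"
  obtains L where "L \<ge> 0"
    "\<And>u x y. u \<in> {a..b} \<Longrightarrow> x \<in> {0..M} \<Longrightarrow> y \<in> {0..M} \<Longrightarrow>
       \<bar>GG u (u + x) - GG u (u + y)\<bar> \<le> L * \<bar>x - y\<bar>"
proof -
  define S where "S = {a..b} \<times> {0..M} \<times> {0..M}"
  define \<kappa> where "\<kappa> = (\<lambda>(u, x, y). KK u (u + x) (u + y) / (u * (u + 1) * DD u (u + x) * DD u (u + y)))"
  have pos: "u > 0" "DD u (u + x) > 0" "DD u (u + y) > 0" if "(u, x, y) \<in> S" for u x y
    using that assms by (auto simp: S_def intro!: DD_pos)
  have "continuous_on S \<kappa>"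
    unfolding \<kappa>_def KK_def DD_def MM_def case_prod_unfold
    by (intro continuous_intros) (use pos in \<open>fastforce simp: DD_def MM_def\<close>)
  moreover have "compact S" unfolding S_def by (intro compact_Times) auto
  ultimately have "bounded (\<kappa> ` S)" by (intro compact_imp_bounded compact_continuous_image)
  then obtain L where L: "\<And>s. s \<in> S \<Longrightarrow> norm (\<kappa> s) \<le> L"
    unfolding bounded_iff by blast
  show thesis
  proof
    show "max L 0 \<ge> 0" by simp
    fix u x y assume "u \<in> {a..b}" "x \<in> {0..M}" "y \<in> {0..M}"
    then have s: "(u, x, y) \<in> S" by (simp add: S_def)
    have "GG u (u + x) - GG u (u + y) = \<kappa> (u, x, y) * (x - y)"
      using GG_diff[of u "u + x" "u + y"] pos[OF s] by (simp add: \<kappa>_def)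
    then have "\<bar>GG u (u + x) - GG u (u + y)\<bar> = \<bar>\<kappa> (u, x, y)\<bar> * \<bar>x - y\<bar>"
      by (simp add: abs_mult)
    also have "\<dots> \<le> max L 0 * \<bar>x - y\<bar>"
      using L[OF s] by (intro mult_right_mono) auto
    finally show "\<bar>GG u (u + x) - GG u (u + y)\<bar> \<le> max L 0 * \<bar>x - y\<bar>" .
  qed
qed

section \<open>Invariant region, solvability and contraction for the scalar equation\<close>

lemma PP_solution_derivative:
  assumes "(g has_real_derivative GG u (g u)) (at u within S)"
  shows "((\<lambda>u. PP u (g u)) has_real_derivative 6 * u + 4 + 2 * g u + (2 * u - 2 * g u) * GG u (g u))
    (at u within S)"
  unfolding PP_def
  by (auto intro!: derivative_eq_intros assms simp: algebra_simps)

text \<open>\<open>NN\<close> contains the factor \<open>PP\<close>, so the slope vanishes where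
  \<open>PP\<close> does and only \<open>6 * u + 4 + 2 * g u\<close> remains. Hence
  \<open>PP \<ge> 0\<close> is preserved along solutions as \<open>u\<close> grows.\<close>

lemma PP_zero_slope:
  assumes "u > 0" "g u \<ge> u" "PP u (g u) = 0"
  shows "6 * u + 4 + 2 * g u + (2 * u - 2 * g u) * GG u (g u) > (0::real)"
  using assms by (simp add: GG_def NN_def)

text \<open>The solution starts on the diagonal at \<open>u = a\<close>. Truncating the offset
  \<open>x = w - u\<close> to \<open>{0..M}\<close> makes the equation globally Lipschitz; the
  diagonal below and the region \<open>PP \<le> 0\<close> above act as barriers, so the offset never
  leaves \<open>{0..M}\<close> and the truncation has no effect on the solution.\<close>

lemma scalar_solution:
  assumes "0 < a" "a \<le> b"
  obtains g where
    "\<And>u. u \<in> {a..b} \<Longrightarrow> (g has_real_derivative GG u (g u)) (at u within {a..b})"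
    "\<And>u. u \<in> {a..b} \<Longrightarrow> u \<le> g u"
    "\<And>u. u \<in> {a..b} \<Longrightarrow> PP u (g u) \<ge> 0"
proof -
  \<comment> \<open>With \<open>M = 2 * (b + 1)\<close> the line \<open>w = u + M\<close> satisfies
    \<open>PP \<le> 0\<close> for all \<open>u \<le> b\<close>. The slope is nonpositive there, so
    the offset \<open>x\<close> decreases.\<close>
  define M where "M = 2 * b + 2"
  define cl where "cl x = max 0 (min M x)" for x
  define H where "H u x = GG u (u + cl x) - 1" for u x
  have M: "M > 0" using assms by (simp add: M_def)
  have cl: "cl x \<in> {0..M}" for x using M by (auto simp: cl_def)
  have u0: "u > 0" if "u \<in> {a..b}" for u using that assms by auto
  obtain L where L: "L \<ge> 0" "\<And>u x y. u \<in> {a..b} \<Longrightarrow> x \<in> {0..M} \<Longrightarrow> y \<in> {0..M} \<Longrightarrow>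
       \<bar>GG u (u + x) - GG u (u + y)\<bar> \<le> L * \<bar>x - y\<bar>"
    using GG_lipschitz[OF \<open>0 < a\<close>] by metis
  have cont: "continuous_on ({a..b} \<times> UNIV) (\<lambda>(u, x). H u x)"
  proof -
    have "DD (fst p) (fst p + cl (snd p)) \<noteq> 0" if "p \<in> {a..b} \<times> UNIV" for p
      using DD_pos[of "fst p" "fst p + cl (snd p)"] that u0 cl[of "snd p"] by force
    then show ?thesis
      unfolding H_def GG_def NN_def PP_def case_prod_unfold cl_def DD_def MM_def
      by (intro continuous_intros) (use u0 in force)
  qed
  have lip: "dist (H u x) (H u y) \<le> L * dist x y" if "u \<in> {a..b}" for u x y
  proof -
    have "\<bar>cl x - cl y\<bar> \<le> \<bar>x - y\<bar>" by (auto simp: cl_def)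
    then have "L * \<bar>cl x - cl y\<bar> \<le> L * \<bar>x - y\<bar>" using L(1) by (rule mult_left_mono)
    with L(2)[OF that cl cl, of x y] show ?thesis by (simp add: H_def dist_real_def)
  qed
  obtain x where x: "x a = 0"
    "\<And>u. u \<in> {a..b} \<Longrightarrow> (x has_vector_derivative H u (x u)) (at u within {a..b})"
    by (rule picard_lindelof[OF \<open>a \<le> b\<close> cont lip, where ?x0.0 = 0]) auto
  have dx: "(x has_real_derivative H u (x u)) (at u within {a..c})" if "u \<in> {a..c}" "c \<le> b" for u c
    using x(2)[of u] that
    by (auto simp: has_real_derivative_iff_has_vector_derivative
        intro: has_vector_derivative_within_subset)
  have x_ge: "x c \<ge> 0" if c: "c \<in> {a..b}" for c
  proof (rule barrier_nonneg[of a c x "\<lambda>u. H u (x u)"])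
    show "H u (x u) > 0" if "u \<in> {a..c}" "x u = 0" for u
      using that c u0[of u] GG_diag[of u] M by (simp add: H_def cl_def)
  qed (use c x dx in auto)
  have x_le: "M - x c \<ge> 0" if c: "c \<in> {a..b}" for c
  proof (rule barrier_nonneg[of a c "\<lambda>u. M - x u" "\<lambda>u. - H u (x u)"])
    show "- H u (x u) > 0" if u: "u \<in> {a..c}" "M - x u = 0" for u
    proof -
      have "u \<le> b" "u > 0" using u c u0 by auto
      then have "(u + 1)\<^sup>2 \<le> (b + 1)\<^sup>2" by (intro power_mono) auto
      moreover have "PP u (u + M) = 4 * ((u + 1)\<^sup>2 - (b + 1)\<^sup>2) - 4 * u - 4"
        by (simp add: PP_shift M_def power2_eq_square algebra_simps)
      moreover have "4 * (p - q) - 4 * u - 4 \<le> 0" if "p \<le> q" for p q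
        using that \<open>u > 0\<close> by simp
      ultimately have "PP u (u + M) \<le> 0" by presburger
      then have "GG u (u + M) \<le> 0" using GG_nonpos \<open>u > 0\<close> M by simp
      then show ?thesis using u M by (simp add: H_def cl_def)
    qed
    show "((\<lambda>u. M - x u) has_real_derivative - H u (x u)) (at u within {a..c})" if "u \<in> {a..c}" for u
      using dx[OF that] c by (auto intro!: derivative_eq_intros)
  qed (use c x M in auto)
  define g where "g u = u + x u" for u
  have cl_x: "cl (x u) = x u" if "u \<in> {a..b}" for u
    using x_ge[OF that] x_le[OF that] by (simp add: cl_def)
  have dg: "(g has_real_derivative GG u (g u)) (at u within {a..c})" if "u \<in> {a..c}" "c \<le> b" for u c
    unfolding g_def using dx[OF that] cl_x[of u] that
    by (auto intro!: derivative_eq_intros simp: H_def)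
  show thesis
  proof
    show "(g has_real_derivative GG u (g u)) (at u within {a..b})" if "u \<in> {a..b}" for u
      using dg[OF that] by simp
    show g_ge: "u \<le> g u" if "u \<in> {a..b}" for u
      using x_ge[OF that] by (simp add: g_def)
    show "PP c (g c) \<ge> 0" if c: "c \<in> {a..b}" for c
    proof (rule barrier_nonneg[OF _ PP_solution_derivative])
      show "(g has_real_derivative GG u (g u)) (at u within {a..c})" if "u \<in> {a..c}" for u
        using dg that c by auto
      show "PP u (g u) = 0 \<Longrightarrow> 6 * u + 4 + 2 * g u + (2 * u - 2 * g u) * GG u (g u) > 0"
        if "u \<in> {a..c}" for u
        using that c u0[of u] g_ge[of u] by (intro PP_zero_slope) auto
      show "PP a (g a) \<ge> 0" using x \<open>0 < a\<close> by (simp add: PP_shift g_def)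
    qed (use c in auto)
  qed
qed

text \<open>The difference satisfies a linear equation whose coefficient \<open>k\<close>, the
  divided difference of \<open>GG\<close> in its second argument, is nonpositive by
  \<open>KK_neg\<close>.\<close>

lemma scalar_contraction:
  assumes ab: "0 < a" "a \<le> b"
    and f: "\<And>u. u \<in> {a..b} \<Longrightarrow> (f has_real_derivative GG u (f u)) (at u within {a..b})"
      "\<And>u. u \<in> {a..b} \<Longrightarrow> u \<le> f u"
    and g: "\<And>u. u \<in> {a..b} \<Longrightarrow> (g has_real_derivative GG u (g u)) (at u within {a..b})"
      "\<And>u. u \<in> {a..b} \<Longrightarrow> u \<le> g u"
  shows "\<bar>f b - g b\<bar> \<le> \<bar>f a - g a\<bar>"
proof -
  define k where "k u = KK u (f u) (g u) / (u * (u + 1) * DD u (f u) * DD u (g u))" for u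
  have pos: "u > 0" "DD u (f u) > 0" "DD u (g u) > 0" if "u \<in> {a..b}" for u
    using that ab f(2)[OF that] g(2)[OF that] by (auto intro!: DD_pos)
  have cf: "continuous_on {a..b} f" "continuous_on {a..b} g"
    using f(1) g(1) by (meson DERIV_continuous continuous_on_eq_continuous_within)+
  have k: "continuous_on {a..b} k"
    unfolding k_def KK_def DD_def MM_def
    by (intro continuous_intros cf) (use pos in \<open>fastforce simp: DD_def MM_def\<close>)
  have kneg: "k u \<le> 0" if "u \<in> {a..b}" for u
    unfolding k_def using pos[OF that] KK_neg[of u "f u" "g u"] f(2)[OF that] g(2)[OF that]
    by (intro divide_nonpos_pos) auto
  have "((\<lambda>u. f u - g u) has_real_derivative k u * (f u - g u)) (at u within {a..b})"
    if u: "u \<in> {a..b}" for u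
    using DERIV_diff[OF f(1)[OF u] g(1)[OF u]] GG_diff[of u "f u" "g u"] pos[OF u]
    by (simp add: k_def)
  then have "f b - g b = (f a - g a) * exp (integral {a..b} k)"
    using linear_ode_solution[OF \<open>a \<le> b\<close> k, of "\<lambda>u. f u - g u"] by blast
  moreover have "integral {a..b} k \<le> integral {a..b} (\<lambda>_. 0)"
    using kneg by (intro integral_le integrable_continuous_interval k) auto
  ultimately show ?thesis
    by (simp add: abs_mult mult_left_le)
qed

section \<open>Construction of the separatrix\<close>

lemma PP_nonneg_upper:
  assumes "0 < u" "PP u w \<ge> 0"
  shows "w \<le> u + 2 * sqrt (u\<^sup>2 + u)"
proof -
  have "(w - u)\<^sup>2 \<le> 4 * (u\<^sup>2 + u)" using assms by (simp add: PP_shift)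
  then have "\<bar>w - u\<bar> \<le> sqrt (4 * (u\<^sup>2 + u))" by (metis real_sqrt_le_mono real_sqrt_abs)
  also have "\<dots> = 2 * sqrt (u\<^sup>2 + u)" by (subst real_sqrt_mult) simp
  finally show ?thesis by simp
qed

text \<open>The contraction transports the error at a starting point to every larger
  \<open>u\<close>, so convergence is uniform on compact intervals in spite of the singularity at 0.
  The bounds \<open>u \<le> w\<close> and \<open>0 \<le> PP u w\<close> survive the limit and
  confine it to the strip that closes at the origin.\<close>

lemma separatrix_exists:
  "\<exists>f :: real \<Rightarrow> real. \<forall>u>0. (f has_real_derivative GG u (f u)) (at u) \<and> u \<le> f u \<and> 0 \<le> PP u (f u)"
proof -
  txt \<open>The approximants start on the diagonal at \<open>u = e n\<close>; two of them differ there by at most \<open>\<beta> n\<close>,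
    hence everywhere to the right.\<close>
  define e where "e n = 1 / (real n + 1)" for n :: nat
  define \<beta> where "\<beta> n = 2 * sqrt ((e n)\<^sup>2 + e n)" for n :: nat
  have e: "e n > 0" "e n \<le> 1" for n by (auto simp: e_def)
  have e_mono: "e m \<le> e n" if "n \<le> m" for m n
    using that by (auto simp: e_def frac_le)
  have e0: "e \<longlonglongrightarrow> 0"
    unfolding e_def using LIMSEQ_inverse_real_of_nat by (simp add: inverse_eq_divide add.commute)
  have \<beta>0: "\<beta> \<longlonglongrightarrow> 0"
    unfolding \<beta>_def by (auto intro!: tendsto_eq_intros e0)
  have "\<exists>g. \<forall>u\<in>{e n..real n + 1}. (g has_real_derivative GG u (g u)) (at u within {e n..real n + 1})
      \<and> u \<le> g u \<and> 0 \<le> PP u (g u)" for n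
  proof -
    have "e n \<le> real n + 1" using e[of n] by simp
    from scalar_solution[OF e(1)[of n] this] show ?thesis by metis
  qed
  then obtain g where g: "\<And>n u. u \<in> {e n..real n + 1} \<Longrightarrow>
      (g n has_real_derivative GG u (g n u)) (at u within {e n..real n + 1})
      \<and> u \<le> g n u \<and> 0 \<le> PP u (g n u)"
    by metis
  have gap: "\<bar>g m u - g n u\<bar> \<le> \<beta> n" if "n \<le> m" "u \<in> {e n..real n + 1}" for n m u
  proof -
    have sub: "{e n..u} \<subseteq> {e n..real n + 1}" "{e n..u} \<subseteq> {e m..real m + 1}"
      using that e_mono[OF that(1)] by auto
    have "\<bar>g m u - g n u\<bar> \<le> \<bar>g m (e n) - g n (e n)\<bar>"
    proof (rule scalar_contraction)
      fix s assume s: "s \<in> {e n..u}"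
      then have sn: "s \<in> {e n..real n + 1}" and sm: "s \<in> {e m..real m + 1}" using sub by blast+
      show "(g m has_real_derivative GG s (g m s)) (at s within {e n..u})"
        using g[OF sm] sub(2) DERIV_subset by blast
      show "(g n has_real_derivative GG s (g n s)) (at s within {e n..u})"
        using g[OF sn] sub(1) DERIV_subset by blast
      show "s \<le> g m s" "s \<le> g n s" using g[OF sm] g[OF sn] by auto
    qed (use e that in auto)
    \<comment> \<open>Both values lie between the diagonal and the upper edge of the strip
      \<open>PP \<ge> 0\<close>, whose distance at \<open>u = e n\<close> is
      \<open>\<beta> n\<close>.\<close>
    also have "\<dots> \<le> \<beta> n"
    proof -
      have "e n \<in> {e n..real n + 1}" "e n \<in> {e m..real m + 1}" using sub that by auto
      then have "e n \<le> g m (e n)" "e n \<le> g n (e n)"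
        "g m (e n) \<le> e n + \<beta> n" "g n (e n) \<le> e n + \<beta> n"
        using g PP_nonneg_upper[OF e(1)[of n]] unfolding \<beta>_def by blast+
      then show ?thesis by linarith
    qed
    finally show ?thesis .
  qed
  have ev: "\<forall>\<^sub>F n in sequentially. {p..q} \<subseteq> {e n..real n + 1}" if "0 < p" for p q
  proof -
    have "\<forall>\<^sub>F n in sequentially. e n < p" using e0 that by (rule order_tendstoD)
    moreover have "\<forall>\<^sub>F n in sequentially. q \<le> real n"
      by (intro eventually_sequentiallyI[of "nat \<lceil>q\<rceil>"]) linarith
    ultimately show ?thesis by eventually_elim auto
  qed
  define f where "f u = lim (\<lambda>n. g n u)" for u
  have lim: "(\<lambda>n. g n u) \<longlonglongrightarrow> f u" if "0 < u" for u
  proof -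
    have "Cauchy (\<lambda>n. g n u)"
    proof (rule metric_CauchyI)
      fix r :: real assume "0 < r"
      have "\<forall>\<^sub>F n in sequentially. \<beta> n < r / 2"
        using \<beta>0 \<open>0 < r\<close> by (intro order_tendstoD) auto
      then have "\<forall>\<^sub>F n in sequentially. \<beta> n < r / 2 \<and> u \<in> {e n..real n + 1}"
        using ev[OF that, of u] by eventually_elim auto
      then obtain N where N: "\<beta> N < r / 2" "u \<in> {e N..real N + 1}"
        unfolding eventually_sequentially by blast
      have "dist (g m u) (g n u) < r" if "N \<le> m" "N \<le> n" for m n
        using gap[OF that(1) N(2)] gap[OF that(2) N(2)] N(1) by (auto simp: dist_real_def)
      then show "\<exists>M. \<forall>m\<ge>M. \<forall>n\<ge>M. dist (g m u) (g n u) < r" by blast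
    qed
    then show ?thesis unfolding f_def by (simp add: Cauchy_convergent_iff convergent_LIMSEQ_iff)
  qed
  have gap_lim: "\<bar>f u - g n u\<bar> \<le> \<beta> n" if "u \<in> {e n..real n + 1}" for n u
  proof -
    have "0 < u" using that e[of n] by auto
    have "(\<lambda>m. \<bar>g m u - g n u\<bar>) \<longlonglongrightarrow> \<bar>f u - g n u\<bar>"
      by (intro tendsto_intros lim \<open>0 < u\<close>)
    moreover have "\<forall>\<^sub>F m in sequentially. \<bar>g m u - g n u\<bar> \<le> \<beta> n"
      using gap that by (intro eventually_sequentiallyI[of n]) auto
    ultimately show ?thesis by (rule tendsto_upperbound) simp
  qed
  have f_ge: "u \<le> f u" and f_PP: "0 \<le> PP u (f u)" if "0 < u" for u
  proof -
    have ev': "\<forall>\<^sub>F n in sequentially. u \<le> g n u \<and> 0 \<le> PP u (g n u)"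
      using ev[OF that, of u] by eventually_elim (use g in auto)
    show "u \<le> f u"
      by (rule tendsto_lowerbound[OF lim[OF that]]) (use ev' in \<open>auto elim: eventually_mono\<close>)
    have "(\<lambda>n. PP u (g n u)) \<longlonglongrightarrow> PP u (f u)"
      unfolding PP_def by (intro tendsto_intros lim that)
    then show "0 \<le> PP u (f u)"
      by (rule tendsto_lowerbound) (use ev' in \<open>auto elim: eventually_mono\<close>)
  qed
  \<comment> \<open>Differentiating the limit requires uniform convergence of the derivatives near
    \<open>v\<close>. On \<open>{p..q}\<close> the Lipschitz bound for \<open>GG\<close> turns the
    uniform estimate \<open>gap_lim\<close> into one for the slopes.\<close>
  have "(f has_real_derivative GG v (f v)) (at v)" if v: "0 < v" for v
  proof -
    define p q where "p = v / 2" and "q = 2 * v"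
    have pq: "0 < p" "p < v" "v < q" using v by (auto simp: p_def q_def)
    define M where "M = 2 * sqrt (q\<^sup>2 + q)"
    have upper: "w \<in> {u..u + M}" if "u \<in> {p..q}" "u \<le> w" "0 \<le> PP u w" for u w
    proof -
      have "u\<^sup>2 \<le> q\<^sup>2" using that pq by (intro power_mono) auto
      then have "2 * sqrt (u\<^sup>2 + u) \<le> M" using that by (simp add: M_def)
      with PP_nonneg_upper[of u w] that pq show ?thesis by auto
    qed
    obtain L where L: "L \<ge> 0" "\<And>u x y. u \<in> {p..q} \<Longrightarrow> x \<in> {0..M} \<Longrightarrow> y \<in> {0..M} \<Longrightarrow>
       \<bar>GG u (u + x) - GG u (u + y)\<bar> \<le> L * \<bar>x - y\<bar>"
      using GG_lipschitz[OF \<open>0 < p\<close>] by metis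
    obtain N where N: "\<And>n. n \<ge> N \<Longrightarrow> {p..q} \<subseteq> {e n..real n + 1}"
      using ev[OF pq(1), of q] unfolding eventually_sequentially by blast
    have der: "(g (n + N) has_derivative (\<lambda>h. GG u (g (n + N) u) * h)) (at u within {p..q})"
      if "u \<in> {p..q}" for n u
      using g[of u "n + N"] N[of "n + N"] that
      by (auto simp: has_field_derivative_def intro: has_derivative_subset)
    have unif: "\<forall>\<^sub>F n in sequentially. \<forall>u\<in>{p..q}. \<forall>h. norm (GG u (g (n + N) u) * h - GG u (f u) * h) \<le> r * norm h"
      if "0 < r" for r
    proof -
      have "(\<lambda>n. L * \<beta> (n + N)) \<longlonglongrightarrow> L * 0"
        by (intro tendsto_intros LIMSEQ_ignore_initial_segment \<beta>0)
      then have "\<forall>\<^sub>F n in sequentially. L * \<beta> (n + N) < r"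
        using \<open>0 < r\<close> by (intro order_tendstoD) auto
      then show ?thesis
      proof eventually_elim
        case (elim n)
        show ?case
        proof (intro ballI allI)
          fix u h assume u: "u \<in> {p..q}"
          then have un: "u \<in> {e (n + N)..real (n + N) + 1}" using N[of "n + N"] by auto
          have "0 < u" using u pq by auto
          have mem: "g (n + N) u \<in> {u..u + M}" "f u \<in> {u..u + M}"
            using upper[OF u] g[OF un] f_ge f_PP \<open>0 < u\<close> by blast+
          have "\<bar>GG u (g (n + N) u) - GG u (f u)\<bar> \<le> L * \<bar>g (n + N) u - f u\<bar>"
            using L(2)[OF u, of "g (n + N) u - u" "f u - u"] mem by simp
          also have "\<dots> \<le> L * \<beta> (n + N)"
            using gap_lim[OF un] L(1) by (intro mult_left_mono) (auto simp: abs_minus_commute)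
          also have "\<dots> \<le> r" using elim by simp
          finally have "\<bar>GG u (g (n + N) u) - GG u (f u)\<bar> * \<bar>h\<bar> \<le> r * \<bar>h\<bar>"
            by (rule mult_right_mono) simp
          then show "norm (GG u (g (n + N) u) * h - GG u (f u) * h) \<le> r * norm h"
            by (simp add: abs_mult flip: left_diff_distrib)
        qed
      qed
    qed
    \<comment> \<open>Termwise differentiation yields its own limit function \<open>h\<close>;
      uniqueness of limits identifies it with \<open>f\<close> on \<open>{p..q}\<close>. Indices are
      shifted by \<open>N\<close> so that every member of the sequence solves the equation on
      \<open>{p..q}\<close>.\<close>
    have "\<exists>h. \<forall>u\<in>{p..q}. (\<lambda>n. g (n + N) u) \<longlonglongrightarrow> h u \<and>
        (h has_derivative (\<lambda>x. GG u (f u) * x)) (at u within {p..q})"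
      by (rule has_derivative_sequence[OF _ der unif, where ?x0.0 = v and l = "f v"])
        (use pq in \<open>auto intro!: LIMSEQ_ignore_initial_segment lim\<close>)
    then obtain h where h: "\<And>u. u \<in> {p..q} \<Longrightarrow> (\<lambda>n. g (n + N) u) \<longlonglongrightarrow> h u"
      "\<And>u. u \<in> {p..q} \<Longrightarrow> (h has_derivative (\<lambda>x. GG u (f u) * x)) (at u within {p..q})"
      by blast
    have hf: "h u = f u" if "u \<in> {p..q}" for u
      using LIMSEQ_unique[OF h(1)[OF that] LIMSEQ_ignore_initial_segment[OF lim]] that pq by auto
    have "(h has_real_derivative GG v (f v)) (at v within {p..q})"
      using h(2)[of v] pq by (simp add: has_field_derivative_def)
    then have "(f has_real_derivative GG v (f v)) (at v within {p..q})"
      by (rule has_field_derivative_transform_within[OF _ zero_less_one]) (use pq hf in auto)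
    then show ?thesis
      using at_within_Icc_at[of p v q] pq by simp
  qed
  with f_ge f_PP show ?thesis by blast
qed

text \<open>The choice is harmless: two such functions both tend to 0 at the origin, and by
  \<open>scalar_contraction\<close> their distance does not grow with \<open>u\<close>, so they
  coincide on positive arguments.\<close>

definition separatrix :: "real \<Rightarrow> real" where
  "separatrix = (SOME f. \<forall>u>0. (f has_real_derivative GG u (f u)) (at u) \<and> u \<le> f u \<and> 0 \<le> PP u (f u))"

lemma separatrix_props:
  "\<forall>u>0. (separatrix has_real_derivative GG u (separatrix u)) (at u) \<and> u \<le> separatrix u
    \<and> 0 \<le> PP u (separatrix u)"
  unfolding separatrix_def by (rule someI_ex[OF separatrix_exists])

lemma
  assumes "0 < u"
  shows separatrix_derivative: "(separatrix has_real_derivative GG u (separatrix u)) (at u)"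
    and separatrix_ge: "u \<le> separatrix u"
    and separatrix_PP_nonneg: "0 \<le> PP u (separatrix u)"
  using separatrix_props assms by blast+

text \<open>The strict barrier is started at \<open>u / 2\<close> from the weak inequality.
  Strictness is what makes \<open>F1\<close> negative on and below the separatrix.\<close>

lemma separatrix_PP_pos:
  assumes "0 < u"
  shows "0 < PP u (separatrix u)"
proof (rule barrier_pos[of "u / 2" u, OF _ PP_solution_derivative])
  fix t assume t: "t \<in> {u / 2..u}"
  then have "0 < t" using assms by auto
  then show "(separatrix has_real_derivative GG t (separatrix t)) (at t within {u / 2..u})"
    using has_field_derivative_at_within[OF separatrix_derivative] by blast
  show "PP t (separatrix t) = 0 \<Longrightarrow>
      6 * t + 4 + 2 * separatrix t + (2 * t - 2 * separatrix t) * GG t (separatrix t) > 0"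
    using \<open>0 < t\<close> separatrix_ge by (intro PP_zero_slope) auto
qed (use assms separatrix_PP_nonneg in auto)

section \<open>Behaviour of the separatrix at the origin\<close>

lemma separatrix_tendsto_0: "(separatrix \<longlongrightarrow> 0) (at_right 0)"
proof (rule tendsto_sandwich[of "\<lambda>u. u" _ _ "\<lambda>u. u + 2 * sqrt (u\<^sup>2 + u)"])
  have "((\<lambda>u::real. u + 2 * sqrt (u\<^sup>2 + u)) \<longlongrightarrow> 0 + 2 * sqrt (0\<^sup>2 + 0)) (at_right 0)"
    by (intro tendsto_intros)
  then show "((\<lambda>u::real. u + 2 * sqrt (u\<^sup>2 + u)) \<longlongrightarrow> 0) (at_right 0)" by simp
  show "\<forall>\<^sub>F u in at_right 0. separatrix u \<le> u + 2 * sqrt (u\<^sup>2 + u)"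
    using eventually_at_right_less[of "0::real"]
    by eventually_elim (intro PP_nonneg_upper separatrix_PP_nonneg)
  show "\<forall>\<^sub>F u in at_right 0. u \<le> separatrix u"
    using eventually_at_right_less[of "0::real"] by eventually_elim (rule separatrix_ge)
qed (auto intro!: tendsto_eq_intros)

text \<open>Substituting \<open>u = w^2 / y\<close> turns the logarithmic slope into the function
  \<open>r\<close> of \<open>w\<close>, rational and regular at \<open>w = 0\<close>. The limit
  exceeds the logarithmic slope 1/2 of the parabola exactly for \<open>y < 2\<close>.\<close>

lemma GG_parabola_slope:
  assumes "y > 0"
  shows "((\<lambda>u. GG u (sqrt (y * u)) * u / sqrt (y * u)) \<longlongrightarrow> (4 - y) / (2 * y)) (at_right 0)"
proof -
  define r where "r w = (1 + w) * (2 + w\<^sup>2 / y + w) * (3 * w\<^sup>2 / y + 4 + 2 * w - y)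
    / ((w\<^sup>2 / y + 1) * (1 + w / y) * (3 * w + 4 + 2 * w\<^sup>2 / y - w ^ 3 / y\<^sup>2) * y)" for w
  have "(r \<longlongrightarrow> (1 + 0) * (2 + 0\<^sup>2 / y + 0) * (3 * 0\<^sup>2 / y + 4 + 2 * 0 - y)
    / ((0\<^sup>2 / y + 1) * (1 + 0 / y) * (3 * 0 + 4 + 2 * 0\<^sup>2 / y - 0 ^ 3 / y\<^sup>2) * y)) (at_right 0)"
    unfolding r_def using assms by (intro tendsto_intros) auto
  moreover have "(1 + 0) * (2 + 0\<^sup>2 / y + 0) * (3 * 0\<^sup>2 / y + 4 + 2 * 0 - y)
    / ((0\<^sup>2 / y + 1) * (1 + 0 / y) * (3 * 0 + 4 + 2 * 0\<^sup>2 / y - 0 ^ 3 / y\<^sup>2) * y) = (4 - y) / (2 * y)"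
    using assms by (simp add: divide_simps)
  ultimately have r: "(r \<longlongrightarrow> (4 - y) / (2 * y)) (at_right 0)"
    by simp
  have "((\<lambda>u. sqrt (y * u)) \<longlongrightarrow> sqrt (y * 0)) (at_right 0)" by (intro tendsto_intros)
  moreover have "\<forall>\<^sub>F u in at_right 0. sqrt (y * u) > 0"
    using eventually_at_right_less[of "0::real"] by eventually_elim (use assms in simp)
  ultimately have "filterlim (\<lambda>u. sqrt (y * u)) (at_right 0) (at_right 0)"
    by (auto simp: filterlim_at elim: eventually_mono)
  with r have "((\<lambda>u. r (sqrt (y * u))) \<longlongrightarrow> (4 - y) / (2 * y)) (at_right 0)"
    by (rule filterlim_compose)
  moreover have "\<forall>\<^sub>F u in at_right 0. r (sqrt (y * u)) = GG u (sqrt (y * u)) * u / sqrt (y * u)"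
    using eventually_at_right_less[of "0::real"]
  proof eventually_elim
    case (elim u)
    define w where "w = sqrt (y * u)"
    have w: "w > 0" "w\<^sup>2 = y * u" using elim assms by (auto simp: w_def)
    then have u: "u = w\<^sup>2 / y" using assms by simp
    define p where "p = 1 + w / y"
    define q where "q = 3 * w + 4 + 2 * w\<^sup>2 / y - w ^ 3 / y\<^sup>2"
    define s where "s = 3 * w\<^sup>2 / y + 4 + 2 * w - y"
    define l where "l = (1 + w) * (2 + w\<^sup>2 / y + w)"
    have P: "PP u w = u * s"
      unfolding PP_def s_def u using assms by (simp add: field_simps power2_eq_square)
    have M: "MM u w = w * q"
      unfolding MM_def q_def u using assms w(1) by (simp add: field_simps eval_nat_numeral)
    have N: "NN u w = w * u * (l * s)"
      unfolding NN_def P l_def by (simp add: u)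
    have D: "DD u w = w * w * (p * q)"
      unfolding DD_def M p_def by (subst u) (simp add: field_simps power2_eq_square)
    have "GG u w * u / w = (u / (w * w)) * (l * s) / ((u + 1) * (p * q))"
      unfolding GG_def N D using w elim by (simp add: ac_simps)
    also have "u / (w * w) = 1 / y" using w elim assms by (simp add: power2_eq_square)
    finally show ?case
      unfolding w_def[symmetric] by (simp add: r_def l_def s_def p_def q_def u mult.assoc mult.left_commute mult.commute)
  qed
  ultimately show ?thesis by (rule Lim_transform_eventually)
qed

text \<open>For \<open>y < 2\<close> the parabola \<open>w\<^sup>2 = y u\<close> is a strict subsolution near \<open>0\<close>. If the separatrix were
  below it somewhere, the gap would grow as \<open>u\<close> decreases, but both tend to \<open>0\<close>.\<close>

lemma separatrix_parabola_bounds: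
  assumes y: "y > 0"
  shows "y < 2 \<Longrightarrow> \<forall>\<^sub>F u in at_right 0. sqrt (y * u) \<le> separatrix u"
    and "y > 2 \<Longrightarrow> \<forall>\<^sub>F u in at_right 0. separatrix u \<le> sqrt (y * u)"
proof -
  define m where "m u = sqrt (y * u)" for u
  define h where "h u = separatrix u - m u" for u
  have m': "(m has_real_derivative m u / (2 * u)) (at u)" if "u > 0" for u
    unfolding m_def using that y
    by (auto intro!: derivative_eq_intros simp: field_simps real_sqrt_mult)
  have h': "(h has_real_derivative GG u (separatrix u) - m u / (2 * u)) (at u)" if "u > 0" for u
    unfolding h_def using separatrix_derivative[OF that] m'[OF that] by (rule DERIV_diff)
  have "(m \<longlongrightarrow> sqrt (y * 0)) (at_right 0)" unfolding m_def by (intro tendsto_intros)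
  then have "(h \<longlongrightarrow> 0 - sqrt (y * 0)) (at_right 0)"
    unfolding h_def by (intro tendsto_intros separatrix_tendsto_0)
  then have h0: "(h \<longlongrightarrow> 0) (at_right 0)" by simp
  have slope: "((\<lambda>u. GG u (m u) * u / m u) \<longlongrightarrow> (4 - y) / (2 * y)) (at_right 0)"
    unfolding m_def by (rule GG_parabola_slope[OF y])
  \<comment> \<open>For \<open>u < y\<close> the parabola lies above the diagonal, as
    \<open>GG_antimono\<close> requires when the parabola is the lower of the two curves.\<close>
  have m_ge: "u \<le> m u" if "0 < u" "u < y" for u
    unfolding m_def using that by (intro real_le_rsqrt) (simp add: power2_eq_square)
  have m_pos: "m u > 0" if "0 < u" for u using that y by (simp add: m_def)
  have near: "\<exists>u0>0. \<forall>u. 0 < u \<longrightarrow> u < u0 \<longrightarrow> P u \<and> u < y" if "\<forall>\<^sub>F u in at_right 0. P u" for P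
  proof -
    have "\<forall>\<^sub>F u in at_right 0. P u \<and> u < y"
      using that eventually_at_right_less[of "0::real"]
      by (intro eventually_conj) (use y in \<open>auto simp: eventually_at_right_field\<close>)
    then show ?thesis by (auto simp: eventually_at_right_field)
  qed
  show "\<forall>\<^sub>F u in at_right 0. sqrt (y * u) \<le> separatrix u" if "y < 2"
  proof -
    have "1 / 2 < (4 - y) / (2 * y)" using that y by (simp add: field_simps)
    then have "\<forall>\<^sub>F u in at_right 0. GG u (m u) * u / m u > 1 / 2"
      by (rule order_tendstoD[OF slope])
    then obtain u0 where u0: "u0 > 0"
      "\<And>u. 0 < u \<Longrightarrow> u < u0 \<Longrightarrow> GG u (m u) * u / m u > 1 / 2 \<and> u < y"
      using near by blast
    have gt: "GG u (m u) > m u / (2 * u)" if "0 < u" "u < u0" for u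
      using u0(2)[OF that] m_pos[OF that(1)] that by (simp add: field_simps)
    have "m u1 \<le> separatrix u1" if u1: "0 < u1" "u1 < u0" for u1
    proof (rule ccontr)
      assume "\<not> ?thesis"
      then have c: "h u1 < 0" by (simp add: h_def)
      \<comment> \<open>The gap cannot close towards the origin. At the level
        \<open>h u1 < 0\<close> the separatrix is below the parabola and has the larger slope, so
        \<open>h\<close> crosses this level only upwards; \<open>h v \<ge> h u1\<close> would force
        \<open>h u1 > h u1\<close>.\<close>
      have "h v < h u1" if v: "0 < v" "v < u1" for v
      proof (rule ccontr)
        assume "\<not> h v < h u1"
        then have "h v - h u1 \<ge> 0" by simp
        have "h u1 - h u1 > 0"
        proof (rule barrier_pos[of v u1 "\<lambda>u. h u - h u1" "\<lambda>u. GG u (separatrix u) - m u / (2 * u)"])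
          fix t assume t: "t \<in> {v..u1}"
          then have t0: "0 < t" "t < u0" using v u1 by auto
          show "((\<lambda>u. h u - h u1) has_real_derivative GG t (separatrix t) - m t / (2 * t)) (at t within {v..u1})"
            using has_field_derivative_at_within[OF h'[OF t0(1)]] by (auto intro!: derivative_eq_intros)
          assume "h t - h u1 = 0"
          then have "separatrix t \<le> m t" using c by (simp add: h_def)
          then have "GG t (m t) \<le> GG t (separatrix t)"
            using separatrix_ge t0 by (intro GG_antimono) auto
          then show "GG t (separatrix t) - m t / (2 * t) > 0" using gt[OF t0] by simp
        qed (use v \<open>h v - h u1 \<ge> 0\<close> in auto)
        then show False by simp
      qed
      then have "\<forall>\<^sub>F v in at_right 0. h v \<le> h u1"
        using u1(1) by (force simp: eventually_at_right_field)
      from tendsto_upperbound[OF h0 this] c show False by simp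
    qed
    then show ?thesis using u0(1) by (auto simp: eventually_at_right_field m_def)
  qed
  show "\<forall>\<^sub>F u in at_right 0. separatrix u \<le> sqrt (y * u)" if "y > 2"
  proof -
    have "1 / 2 > (4 - y) / (2 * y)" using that y by (simp add: field_simps)
    then have "\<forall>\<^sub>F u in at_right 0. GG u (m u) * u / m u < 1 / 2"
      by (rule order_tendstoD[OF slope])
    then obtain u0 where u0: "u0 > 0"
      "\<And>u. 0 < u \<Longrightarrow> u < u0 \<Longrightarrow> GG u (m u) * u / m u < 1 / 2 \<and> u < y"
      using near by blast
    have lt: "GG u (m u) < m u / (2 * u)" if "0 < u" "u < u0" for u
      using u0(2)[OF that] m_pos[OF that(1)] that by (simp add: field_simps)
    have "m u1 \<ge> separatrix u1" if u1: "0 < u1" "u1 < u0" for u1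
    proof (rule ccontr)
      assume "\<not> ?thesis"
      then have c: "h u1 > 0" by (simp add: h_def)
      have "h v > h u1" if v: "0 < v" "v < u1" for v
      proof (rule ccontr)
        assume "\<not> h v > h u1"
        then have "h u1 - h v \<ge> 0" by simp
        have "h u1 - h u1 > 0"
        proof (rule barrier_pos[of v u1 "\<lambda>u. h u1 - h u" "\<lambda>u. - (GG u (separatrix u) - m u / (2 * u))"])
          fix t assume t: "t \<in> {v..u1}"
          then have t0: "0 < t" "t < u0" using v u1 by auto
          show "((\<lambda>u. h u1 - h u) has_real_derivative - (GG t (separatrix t) - m t / (2 * t))) (at t within {v..u1})"
            using has_field_derivative_at_within[OF h'[OF t0(1)]] by (auto intro!: derivative_eq_intros)
          assume "h u1 - h t = 0"
          then have "separatrix t \<ge> m t" using c by (simp add: h_def)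
          then have "GG t (m t) \<ge> GG t (separatrix t)"
            using m_ge u0(2) t0 by (intro GG_antimono) auto
          then show "- (GG t (separatrix t) - m t / (2 * t)) > 0" using lt[OF t0] by simp
        qed (use v \<open>h u1 - h v \<ge> 0\<close> in auto)
        then show False by simp
      qed
      then have "\<forall>\<^sub>F v in at_right 0. h v \<ge> h u1"
        using u1(1) by (force simp: eventually_at_right_field)
      from tendsto_lowerbound[OF h0 this] c show False by simp
    qed
    then show ?thesis using u0(1) by (auto simp: eventually_at_right_field m_def)
  qed
qed

lemma separatrix_square_ratio: "((\<lambda>u. (separatrix u)\<^sup>2 / u) \<longlongrightarrow> 2) (at_right 0)"
proof (rule order_tendstoI)
  fix a :: real assume "a < 2"
  \<comment> \<open>The maximum with 1 keeps \<open>y\<close> positive for every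
    \<open>a\<close>.\<close>
  define y where "y = (max a 1 + 2) / 2"
  have y: "a < y" "0 < y" "y < 2" using \<open>a < 2\<close> by (auto simp: y_def)
  show "\<forall>\<^sub>F u in at_right 0. a < (separatrix u)\<^sup>2 / u"
    using separatrix_parabola_bounds(1)[OF y(2,3)] eventually_at_right_less[of "0::real"]
  proof eventually_elim
    case (elim u)
    then have "(sqrt (y * u))\<^sup>2 \<le> (separatrix u)\<^sup>2" using y by (intro power_mono) auto
    then have "y * u \<le> (separatrix u)\<^sup>2" using y elim by simp
    then have "y \<le> (separatrix u)\<^sup>2 / u" using elim by (simp add: field_simps)
    with y show ?case by simp
  qed
next
  fix a :: real assume "2 < a"
  define y where "y = (a + 2) / 2"
  have y: "y < a" "0 < y" "2 < y" using \<open>2 < a\<close> by (auto simp: y_def)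
  show "\<forall>\<^sub>F u in at_right 0. (separatrix u)\<^sup>2 / u < a"
    using separatrix_parabola_bounds(2)[OF y(2,3)] eventually_at_right_less[of "0::real"]
  proof eventually_elim
    case (elim u)
    have "0 \<le> separatrix u" using separatrix_ge[of u] elim by simp
    then have "(separatrix u)\<^sup>2 \<le> (sqrt (y * u))\<^sup>2" using elim by (intro power_mono) auto
    then have "(separatrix u)\<^sup>2 \<le> y * u" using y elim by simp
    then have "(separatrix u)\<^sup>2 / u \<le> y" using elim by (simp add: field_simps)
    with y show ?case by simp
  qed
qed

section \<open>Maximal solutions of the flow\<close>

text \<open>Boundedness is carried along because the Lipschitz constant of a product involves bounds
  on its factors. The class is closed under ring operations and under inverses of functions bounded
  below by a positive constant, which covers the rational field of the flow on compact
  boxes.\<close>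

definition bounded_lipschitz :: "'a::metric_space set \<Rightarrow> ('a \<Rightarrow> real) \<Rightarrow> bool" where
  "bounded_lipschitz S f \<longleftrightarrow> (\<exists>L. L-lipschitz_on S f) \<and> (\<exists>M. \<forall>x\<in>S. \<bar>f x\<bar> \<le> M)"

lemma bounded_lipschitzI:
  assumes "\<And>x y. x \<in> S \<Longrightarrow> y \<in> S \<Longrightarrow> \<bar>f x - f y\<bar> \<le> L * dist x y" "\<And>x. x \<in> S \<Longrightarrow> \<bar>f x\<bar> \<le> M"
  shows "bounded_lipschitz S f"
proof -
  have "(max L 0)-lipschitz_on S f"
  proof (rule lipschitz_onI)
    fix x y assume xy: "x \<in> S" "y \<in> S"
    have "L * dist x y \<le> max L 0 * dist x y" by (rule mult_right_mono) auto
    with assms(1)[OF xy] show "dist (f x) (f y) \<le> max L 0 * dist x y" by (simp add: dist_real_def)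
  qed simp
  with assms(2) show ?thesis unfolding bounded_lipschitz_def by blast
qed

lemma bounded_lipschitzE:
  assumes "bounded_lipschitz S f"
  obtains L M where "L \<ge> 0" "M \<ge> 0" "\<And>x y. x \<in> S \<Longrightarrow> y \<in> S \<Longrightarrow> \<bar>f x - f y\<bar> \<le> L * dist x y"
    "\<And>x. x \<in> S \<Longrightarrow> \<bar>f x\<bar> \<le> M"
proof -
  obtain L M where "L-lipschitz_on S f" and M: "\<forall>x\<in>S. \<bar>f x\<bar> \<le> M"
    using assms unfolding bounded_lipschitz_def by blast
  then have "L \<ge> 0" "\<And>x y. x \<in> S \<Longrightarrow> y \<in> S \<Longrightarrow> \<bar>f x - f y\<bar> \<le> L * dist x y"
    by (auto simp: lipschitz_on_def dist_real_def)
  moreover have "\<And>x. x \<in> S \<Longrightarrow> \<bar>f x\<bar> \<le> max M 0" using M by force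
  ultimately show thesis using that[of L "max M 0"] by simp
qed

lemma bounded_lipschitz_const: "bounded_lipschitz S (\<lambda>_. c)"
  by (rule bounded_lipschitzI[of _ _ 0 "\<bar>c\<bar>"]) auto

lemma bounded_lipschitz_add:
  assumes "bounded_lipschitz S f" "bounded_lipschitz S g"
  shows "bounded_lipschitz S (\<lambda>x. f x + g x)"
proof -
  obtain L M L' M' where "\<And>x y. x \<in> S \<Longrightarrow> y \<in> S \<Longrightarrow> \<bar>f x - f y\<bar> \<le> L * dist x y"
    "\<And>x. x \<in> S \<Longrightarrow> \<bar>f x\<bar> \<le> M" "\<And>x y. x \<in> S \<Longrightarrow> y \<in> S \<Longrightarrow> \<bar>g x - g y\<bar> \<le> L' * dist x y"
    "\<And>x. x \<in> S \<Longrightarrow> \<bar>g x\<bar> \<le> M'"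
    using bounded_lipschitzE[OF assms(1)] bounded_lipschitzE[OF assms(2)] by metis
  then show ?thesis
    by (intro bounded_lipschitzI[of _ _ "L + L'" "M + M'"]) (fastforce simp: algebra_simps)+
qed

lemma bounded_lipschitz_mult:
  assumes "bounded_lipschitz S f" "bounded_lipschitz S g"
  shows "bounded_lipschitz S (\<lambda>x. f x * g x)"
proof -
  obtain L M where f: "L \<ge> 0" "M \<ge> 0" "\<And>x y. x \<in> S \<Longrightarrow> y \<in> S \<Longrightarrow> \<bar>f x - f y\<bar> \<le> L * dist x y"
    "\<And>x. x \<in> S \<Longrightarrow> \<bar>f x\<bar> \<le> M"
    using bounded_lipschitzE[OF assms(1)] by metis
  obtain L' M' where g: "L' \<ge> 0" "M' \<ge> 0" "\<And>x y. x \<in> S \<Longrightarrow> y \<in> S \<Longrightarrow> \<bar>g x - g y\<bar> \<le> L' * dist x y"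
    "\<And>x. x \<in> S \<Longrightarrow> \<bar>g x\<bar> \<le> M'"
    using bounded_lipschitzE[OF assms(2)] by metis
  show ?thesis
  proof (rule bounded_lipschitzI[of _ _ "M * L' + L * M'" "M * M'"])
    fix x y assume xy: "x \<in> S" "y \<in> S"
    have "\<bar>f x * g x - f y * g y\<bar> = \<bar>f x * (g x - g y) + (f x - f y) * g y\<bar>"
      by (simp add: algebra_simps)
    also have "\<dots> \<le> \<bar>f x\<bar> * \<bar>g x - g y\<bar> + \<bar>f x - f y\<bar> * \<bar>g y\<bar>"
      by (metis abs_mult abs_triangle_ineq)
    also have "\<dots> \<le> M * (L' * dist x y) + (L * dist x y) * M'"
      using f g xy by (intro add_mono mult_mono) auto
    finally show "\<bar>f x * g x - f y * g y\<bar> \<le> (M * L' + L * M') * dist x y"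
      by (simp add: algebra_simps)
  next
    fix x assume "x \<in> S"
    then show "\<bar>f x * g x\<bar> \<le> M * M'" unfolding abs_mult using f g by (intro mult_mono) auto
  qed
qed

lemma bounded_lipschitz_inverse:
  assumes "bounded_lipschitz S f" "c > 0" "\<And>x. x \<in> S \<Longrightarrow> c \<le> f x"
  shows "bounded_lipschitz S (\<lambda>x. inverse (f x))"
proof -
  obtain L M where f: "L \<ge> 0" "\<And>x y. x \<in> S \<Longrightarrow> y \<in> S \<Longrightarrow> \<bar>f x - f y\<bar> \<le> L * dist x y"
    using bounded_lipschitzE[OF assms(1)] by metis
  have inv: "\<bar>inverse (f x)\<bar> \<le> inverse c" if "x \<in> S" for x
    using assms(2) assms(3)[OF that] by (simp add: le_imp_inverse_le)
  show ?thesis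
  proof (rule bounded_lipschitzI[of _ _ "inverse c * L * inverse c" "inverse c"])
    fix x y assume xy: "x \<in> S" "y \<in> S"
    have "f x \<noteq> 0" "f y \<noteq> 0" using assms(2) assms(3)[OF xy(1)] assms(3)[OF xy(2)] by auto
    then have "\<bar>inverse (f x) - inverse (f y)\<bar> = \<bar>inverse (f x)\<bar> * \<bar>f x - f y\<bar> * \<bar>inverse (f y)\<bar>"
      by (simp add: inverse_diff_inverse abs_mult)
    also have "\<dots> \<le> inverse c * (L * dist x y) * inverse c"
      using f xy inv assms(2) by (intro mult_mono) auto
    finally show "\<bar>inverse (f x) - inverse (f y)\<bar> \<le> inverse c * L * inverse c * dist x y"
      by (simp add: algebra_simps)
  qed (use inv in auto)
qed

lemma bounded_lipschitz_diff:
  assumes "bounded_lipschitz S f" "bounded_lipschitz S g"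
  shows "bounded_lipschitz S (\<lambda>x. f x - g x)"
  using bounded_lipschitz_add[OF assms(1) bounded_lipschitz_mult[OF bounded_lipschitz_const assms(2)], of "-1"]
  by simp

lemma bounded_lipschitz_inner:
  fixes S :: "'a::euclidean_space set"
  assumes "bounded S"
  shows "bounded_lipschitz S (\<lambda>x. x \<bullet> v)"
proof -
  obtain M where M: "\<And>x. x \<in> S \<Longrightarrow> norm x \<le> M" using assms unfolding bounded_iff by blast
  show ?thesis
  proof (rule bounded_lipschitzI[of _ _ "norm v" "M * norm v"])
    show "\<bar>x \<bullet> v - y \<bullet> v\<bar> \<le> norm v * dist x y" for x y
      using Cauchy_Schwarz_ineq2[of "x - y" v] by (simp add: inner_diff_left dist_norm mult.commute)
    show "\<bar>x \<bullet> v\<bar> \<le> M * norm v" if "x \<in> S" for x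
      using Cauchy_Schwarz_ineq2[of x v] M[OF that]
      by (meson mult_right_mono norm_ge_zero order_trans)
  qed
qed

section \<open>Local solvability and uniqueness for the flow\<close>

definition xcf_field :: "real \<times> real \<times> real \<Rightarrow> real \<times> real \<times> real" where
  "xcf_field = (\<lambda>(a, b, c).
     (- (2 * a * F2 a b c * F3 a b c) / (a * b * c)\<^sup>2,
      - (2 * b * F3 a b c * F1 a b c) / (a * b * c)\<^sup>2,
      - (2 * c * F1 a b c * F2 a b c) / (a * b * c)\<^sup>2))"

lemma mem_cbox3: "(a, b, c) \<in> cbox (x, x, x) (y, y, y :: real) \<longleftrightarrow> a \<in> {x..y} \<and> b \<in> {x..y} \<and> c \<in> {x..y}"
  by (auto simp: cbox_Pair_eq)

lemma xcf_field_lipschitz: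
  assumes "m > 0"
  obtains L B where "L \<ge> 0" "B \<ge> 0"
    "\<And>p q. p \<in> cbox (m, m, m) (M, M, M) \<Longrightarrow> q \<in> cbox (m, m, m) (M, M, M) \<Longrightarrow>
      dist (xcf_field p) (xcf_field q) \<le> L * dist p q"
    "\<And>p. p \<in> cbox (m, m, m) (M, M, M) \<Longrightarrow> norm (xcf_field p) \<le> B"
proof -
  define S :: "(real \<times> real \<times> real) set" where "S = cbox (m, m, m) (M, M, M)"
  have S: "bounded S" by (simp add: S_def)
  have co: "bounded_lipschitz S (\<lambda>p. fst p)" "bounded_lipschitz S (\<lambda>p. fst (snd p))"
    "bounded_lipschitz S (\<lambda>p. snd (snd p))"
    using bounded_lipschitz_inner[OF S, of "(1, 0, 0)"] bounded_lipschitz_inner[OF S, of "(0, 1, 0)"]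
      bounded_lipschitz_inner[OF S, of "(0, 0, 1)"]
    by (simp_all add: inner_prod_def)
  note bl = bounded_lipschitz_const bounded_lipschitz_add bounded_lipschitz_mult bounded_lipschitz_diff co
  have F: "bounded_lipschitz S (\<lambda>p. F1 (fst p) (fst (snd p)) (snd (snd p)))"
    "bounded_lipschitz S (\<lambda>p. F2 (fst p) (fst (snd p)) (snd (snd p)))"
    "bounded_lipschitz S (\<lambda>p. F3 (fst p) (fst (snd p)) (snd (snd p)))"
    unfolding F1_def F2_def F3_def power2_eq_square by (intro bl)+
  have I: "bounded_lipschitz S (\<lambda>p. inverse ((fst p * fst (snd p) * snd (snd p))\<^sup>2))"
  proof (rule bounded_lipschitz_inverse)
    show "bounded_lipschitz S (\<lambda>p. (fst p * fst (snd p) * snd (snd p))\<^sup>2)"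
      unfolding power2_eq_square by (intro bl)
    show "(m * m * m)\<^sup>2 > 0" using assms by simp
    show "(m * m * m)\<^sup>2 \<le> (fst p * fst (snd p) * snd (snd p))\<^sup>2" if "p \<in> S" for p
      using that assms unfolding S_def
      by (cases p) (auto simp: mem_cbox3 intro!: power_mono mult_mono)
  qed
  define f1 f2 f3 where "f1 p = fst (xcf_field p)" and "f2 p = fst (snd (xcf_field p))"
    and "f3 p = snd (snd (xcf_field p))" for p
  let ?F1 = "\<lambda>p. F1 (fst p) (fst (snd p)) (snd (snd p))"
  let ?F2 = "\<lambda>p. F2 (fst p) (fst (snd p)) (snd (snd p))"
  let ?F3 = "\<lambda>p. F3 (fst p) (fst (snd p)) (snd (snd p))"
  let ?I = "\<lambda>p. inverse ((fst p * fst (snd p) * snd (snd p))\<^sup>2)"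
  have "f1 = (\<lambda>p. (- 2) * (fst p * (?F2 p * (?F3 p * ?I p))))"
    "f2 = (\<lambda>p. (- 2) * (fst (snd p) * (?F3 p * (?F1 p * ?I p))))"
    "f3 = (\<lambda>p. (- 2) * (snd (snd p) * (?F1 p * (?F2 p * ?I p))))"
    by (simp_all add: fun_eq_iff f1_def f2_def f3_def xcf_field_def divide_inverse)
  then have "bounded_lipschitz S f1" "bounded_lipschitz S f2" "bounded_lipschitz S f3"
    by (simp_all only:) (intro bounded_lipschitz_mult bounded_lipschitz_const F I co; fail)+
  then obtain L1 M1 where lip1: "L1 \<ge> 0" "M1 \<ge> 0"
      "\<And>p q. p \<in> S \<Longrightarrow> q \<in> S \<Longrightarrow> \<bar>f1 p - f1 q\<bar> \<le> L1 * dist p q" "\<And>p. p \<in> S \<Longrightarrow> \<bar>f1 p\<bar> \<le> M1"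
    by (metis bounded_lipschitzE)
  obtain L2 M2 where lip2: "L2 \<ge> 0" "M2 \<ge> 0"
      "\<And>p q. p \<in> S \<Longrightarrow> q \<in> S \<Longrightarrow> \<bar>f2 p - f2 q\<bar> \<le> L2 * dist p q" "\<And>p. p \<in> S \<Longrightarrow> \<bar>f2 p\<bar> \<le> M2"
    using \<open>bounded_lipschitz S f2\<close> by (metis bounded_lipschitzE)
  obtain L3 M3 where lip3: "L3 \<ge> 0" "M3 \<ge> 0"
      "\<And>p q. p \<in> S \<Longrightarrow> q \<in> S \<Longrightarrow> \<bar>f3 p - f3 q\<bar> \<le> L3 * dist p q" "\<And>p. p \<in> S \<Longrightarrow> \<bar>f3 p\<bar> \<le> M3"
    using \<open>bounded_lipschitz S f3\<close> by (metis bounded_lipschitzE)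
  have f: "xcf_field p = (f1 p, f2 p, f3 p)" for p by (simp add: f1_def f2_def f3_def)
  have n: "norm (a, b, c) \<le> \<bar>a\<bar> + \<bar>b\<bar> + \<bar>c\<bar>" for a b c :: real
    using norm_Pair_le[of a "(b, c)"] norm_Pair_le[of b c] by simp
  show thesis
  proof (rule that[of "L1 + L2 + L3" "M1 + M2 + M3"])
    fix p assume "p \<in> cbox (m, m, m) (M, M, M)"
    then have p: "p \<in> S" by (simp add: S_def)
    show "norm (xcf_field p) \<le> M1 + M2 + M3"
      unfolding f using n[of "f1 p" "f2 p" "f3 p"] lip1(4)[OF p] lip2(4)[OF p] lip3(4)[OF p] by linarith
    fix q assume "q \<in> cbox (m, m, m) (M, M, M)"
    then have q: "q \<in> S" by (simp add: S_def)
    have "dist (xcf_field p) (xcf_field q) \<le> \<bar>f1 p - f1 q\<bar> + \<bar>f2 p - f2 q\<bar> + \<bar>f3 p - f3 q\<bar>"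
      unfolding f dist_norm diff_Pair by (rule n)
    also have "\<dots> \<le> (L1 + L2 + L3) * dist p q"
      using lip1(3)[OF p q] lip2(3)[OF p q] lip3(3)[OF p q] by (simp add: distrib_right)
    finally show "dist (xcf_field p) (xcf_field q) \<le> (L1 + L2 + L3) * dist p q" .
  qed (use lip1 lip2 lip3 in auto)
qed

text \<open>Gronwall argument: \<open>exp (- 2 * L * t)\<close> times the squared distance does not
  increase. Squaring avoids differentiating the norm at 0.\<close>

lemma lipschitz_ode_unique:
  fixes x y :: "real \<Rightarrow> 'a::euclidean_space"
  assumes "a \<le> b"
    and x: "\<And>t. t \<in> {a..b} \<Longrightarrow> (x has_vector_derivative f (x t)) (at t within {a..b})" "\<And>t. t \<in> {a..b} \<Longrightarrow> x t \<in> S"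
    and y: "\<And>t. t \<in> {a..b} \<Longrightarrow> (y has_vector_derivative f (y t)) (at t within {a..b})" "\<And>t. t \<in> {a..b} \<Longrightarrow> y t \<in> S"
    and lip: "\<And>p q. p \<in> S \<Longrightarrow> q \<in> S \<Longrightarrow> dist (f p) (f q) \<le> L * dist p q"
    and "x a = y a"
  shows "x b = y b"
proof -
  define e where "e t = (x t - y t) \<bullet> (x t - y t)" for t
  define g where "g t = exp (- 2 * L * t) * e t" for t
  define e' where "e' t = 2 * ((x t - y t) \<bullet> (f (x t) - f (y t)))" for t
  have e: "(e has_real_derivative e' t) (at t within {a..b})" if "t \<in> {a..b}" for t
  proof -
    have "((\<lambda>t. x t - y t) has_derivative (\<lambda>h. h *\<^sub>R (f (x t) - f (y t)))) (at t within {a..b})"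
      using has_vector_derivative_diff[OF x(1)[OF that] y(1)[OF that]] by (simp add: has_vector_derivative_def)
    from has_derivative_inner[OF this this] show ?thesis
      unfolding e_def has_field_derivative_def
      by (rule has_derivative_eq_rhs) (auto simp: e'_def inner_commute algebra_simps)
  qed
  have g: "(g has_real_derivative exp (- 2 * L * t) * (e' t - 2 * L * e t)) (at t within {a..b})" if "t \<in> {a..b}" for t
    unfolding g_def by (auto intro!: derivative_eq_intros e[OF that] simp: algebra_simps)
  have "g b \<le> g a"
  proof (rule DERIV_nonpos_imp_decreasing_open[OF \<open>a \<le> b\<close>])
    show "continuous_on {a..b} g"
      using g by (meson DERIV_continuous continuous_on_eq_continuous_within)
    fix t assume t: "a < t" "t < b"
    then have tab: "t \<in> {a..b}" by simp
    have "e' t \<le> 2 * (norm (x t - y t) * norm (f (x t) - f (y t)))"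
      using norm_cauchy_schwarz[of "x t - y t" "f (x t) - f (y t)"] by (simp add: e'_def)
    also have "\<dots> \<le> 2 * (norm (x t - y t) * (L * norm (x t - y t)))"
      using lip[OF x(2)[OF tab] y(2)[OF tab]] by (simp add: dist_norm mult_left_mono)
    also have "\<dots> = 2 * L * e t" by (simp add: e_def power2_norm_eq_inner[symmetric] power2_eq_square)
    finally have "exp (- 2 * L * t) * (e' t - 2 * L * e t) \<le> 0"
      by (intro mult_nonneg_nonpos) auto
    moreover have "DERIV g t :> exp (- 2 * L * t) * (e' t - 2 * L * e t)"
      using g[OF tab] t by (simp add: at_within_Icc_at)
    ultimately show "\<exists>y. DERIV g t :> y \<and> y \<le> 0" by blast
  qed
  also have "g a = 0" using \<open>x a = y a\<close> by (simp add: g_def e_def)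
  finally have "e b \<le> 0" by (simp add: g_def mult_le_0_iff)
  then show ?thesis unfolding e_def by (metis eq_iff_diff_eq_0 inner_ge_zero inner_eq_zero_iff order_antisym)
qed

text \<open>The time \<open>\<tau>\<close> depends on the box and not on the point \<open>p\<close>;
  this uniformity is what later prevents a maximal solution from ending inside a box. The sign
  \<open>\<sigma>\<close> treats forward and backward time together.\<close>

lemma xcf_local_existence:
  assumes "m > 0" "m \<le> M"
  obtains \<tau> where "\<tau> > 0"
    "\<And>\<sigma> p. \<bar>\<sigma>\<bar> = 1 \<Longrightarrow> p \<in> cbox (m, m, m) (M, M, M) \<Longrightarrow> \<exists>x. x 0 = p \<and>
      (\<forall>t\<in>{0..\<tau>}. x t \<in> cbox (m/2, m/2, m/2) (M + m, M + m, M + m) \<and>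
        (x has_vector_derivative \<sigma> *\<^sub>R xcf_field (x t)) (at t within {0..\<tau>}))"
proof -
  define lo hi :: "real \<times> real \<times> real" where "lo = (m/2, m/2, m/2)" and "hi = (M + m, M + m, M + m)"
  obtain L B where LB: "L \<ge> 0" "B \<ge> 0"
    "\<And>p q. p \<in> cbox lo hi \<Longrightarrow> q \<in> cbox lo hi \<Longrightarrow> dist (xcf_field p) (xcf_field q) \<le> L * dist p q"
    "\<And>p. p \<in> cbox lo hi \<Longrightarrow> norm (xcf_field p) \<le> B"
    unfolding lo_def hi_def using xcf_field_lipschitz[of "m/2"] assms by (metis half_gt_zero)
  have lohi: "clamp lo hi p \<in> cbox lo hi" for p
    using assms by (intro clamp_in_interval) (auto simp: lo_def hi_def Basis_prod_def)
  \<comment> \<open>The speed is at most \<open>B\<close> on the enlarged box, so within time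
    \<open>\<tau>\<close> the solution moves by at most \<open>m / 2\<close>. It stays in that box,
    where the clamp is the identity.\<close>
  define \<tau> where "\<tau> = m / 2 / (B + 1)"
  have \<tau>: "\<tau> > 0" "B * \<tau> \<le> m / 2" using assms LB by (auto simp: \<tau>_def field_simps)
  show thesis
  proof (rule that[OF \<tau>(1)])
    fix \<sigma> :: real and p assume \<sigma>: "\<bar>\<sigma>\<bar> = 1" and p: "p \<in> cbox (m, m, m) (M, M, M)"
    define H where "H q = \<sigma> *\<^sub>R xcf_field (clamp lo hi q)" for q
    have lip: "dist (H q) (H r) \<le> L * dist q r" for q r
    proof -
      have "dist (H q) (H r) = dist (xcf_field (clamp lo hi q)) (xcf_field (clamp lo hi r))"
        using \<sigma> by (simp add: H_def dist_norm flip: scaleR_diff_right)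
      also have "\<dots> \<le> L * dist (clamp lo hi q) (clamp lo hi r)" by (intro LB lohi)
      also have "\<dots> \<le> L * dist q r" by (intro mult_left_mono dist_clamps_le_dist_args LB)
      finally show ?thesis .
    qed
    have "L-lipschitz_on UNIV H" using lip LB by (auto intro: lipschitz_onI)
    then have cH: "continuous_on UNIV H" by (rule lipschitz_on_continuous_on)
    have cont: "continuous_on ({0..\<tau>} \<times> UNIV) (\<lambda>(t, q). H q)"
      unfolding case_prod_unfold
      by (rule continuous_on_compose2[OF cH continuous_on_snd[OF continuous_on_id]]) auto
    obtain x where x: "x 0 = p" "\<And>t. t \<in> {0..\<tau>} \<Longrightarrow> (x has_vector_derivative H (x t)) (at t within {0..\<tau>})"
      by (rule picard_lindelof[OF less_imp_le[OF \<tau>(1)] cont lip]) auto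
    have near: "norm (x t - p) \<le> m / 2" if t: "t \<in> {0..\<tau>}" for t
    proof -
      have "norm (x t - x 0) \<le> B * norm (t - 0)"
      proof (rule differentiable_bound[where f' = "\<lambda>t h. h *\<^sub>R H (x t)"])
        show "(x has_derivative (\<lambda>h. h *\<^sub>R H (x s))) (at s within {0..\<tau>})" if "s \<in> {0..\<tau>}" for s
          using x(2)[OF that] by (simp add: has_vector_derivative_def)
        show "onorm (\<lambda>h. h *\<^sub>R H (x s)) \<le> B" for s
        proof (rule onorm_le)
          fix h :: real
          show "norm (h *\<^sub>R H (x s)) \<le> B * norm h"
            using LB(4)[OF lohi[of "x s"]] \<sigma> by (simp add: H_def abs_mult mult.commute[of B] mult_left_mono)
        qed
      qed (use t \<tau> in auto)
      also have "\<dots> \<le> B * \<tau>" using t LB by (intro mult_left_mono) auto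
      finally show ?thesis using \<tau> x by simp
    qed
    have box: "x t \<in> cbox lo hi" if "t \<in> {0..\<tau>}" for t
    proof -
      obtain a b c where xt: "x t = (a, b, c)" by (metis prod_cases3)
      obtain a0 b0 c0 where p0: "p = (a0, b0, c0)" by (metis prod_cases3)
      have "\<bar>a - a0\<bar> \<le> m / 2" "\<bar>b - b0\<bar> \<le> m / 2" "\<bar>c - c0\<bar> \<le> m / 2"
        using near[OF that] norm_fst_le[of "(a - a0)" "(b - b0, c - c0)"] norm_snd_le[of "(b - b0, c - c0)" "a - a0"]
          norm_fst_le[of "b - b0" "c - c0"] norm_snd_le[of "c - c0" "b - b0"]
        unfolding xt p0 by (simp_all add: real_norm_def)
      then show ?thesis using p assms unfolding xt p0 lo_def hi_def mem_cbox3 atLeastAtMost_iff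
        by (intro conjI; linarith)
    qed
    show "\<exists>x. x 0 = p \<and> (\<forall>t\<in>{0..\<tau>}. x t \<in> cbox (m/2, m/2, m/2) (M + m, M + m, M + m) \<and>
        (x has_vector_derivative \<sigma> *\<^sub>R xcf_field (x t)) (at t within {0..\<tau>}))"
    proof (intro exI conjI ballI)
      fix t assume t: "t \<in> {0..\<tau>}"
      show "x t \<in> cbox (m/2, m/2, m/2) (M + m, M + m, M + m)" using box[OF t] by (simp add: lo_def hi_def)
      show "(x has_vector_derivative \<sigma> *\<^sub>R xcf_field (x t)) (at t within {0..\<tau>})"
        using x(2)[OF t] box[OF t] by (simp add: H_def clamp_cancel_cbox)
    qed (rule x)
  qed
qed

section \<open>Extension past the left end and existence of maximal solutions\<close>

definition octant_solution :: "ereal \<Rightarrow> ereal \<Rightarrow> (real \<Rightarrow> real \<times> real \<times> real) \<Rightarrow> bool" where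
  "octant_solution a b X \<longleftrightarrow> (\<forall>t\<in>einterval a b.
     0 < fst (X t) \<and> 0 < fst (snd (X t)) \<and> 0 < snd (snd (X t)) \<and>
     (X has_vector_derivative xcf_field (X t)) (at t))"

lemma xcf_solution_on_iff:
  "xcf_solution_on (einterval a b) A B C \<longleftrightarrow> octant_solution a b (\<lambda>t. (A t, B t, C t))"
proof -
  have "((\<lambda>t. (A t, B t, C t)) has_vector_derivative (x, y, z)) (at t) \<longleftrightarrow>
      (A has_real_derivative x) (at t) \<and> (B has_real_derivative y) (at t) \<and> (C has_real_derivative z) (at t)"
    (is "?l \<longleftrightarrow> ?r") for t x y z
  proof
    assume l: ?l
    have "((\<lambda>t. fst (A t, B t, C t)) has_vector_derivative fst (x, y, z)) (at t)"
      "((\<lambda>t. fst (snd (A t, B t, C t))) has_vector_derivative fst (snd (x, y, z))) (at t)"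
      "((\<lambda>t. snd (snd (A t, B t, C t))) has_vector_derivative snd (snd (x, y, z))) (at t)"
      by (intro bounded_linear.has_vector_derivative[OF bounded_linear_fst]
          bounded_linear.has_vector_derivative[OF bounded_linear_snd] l)+
    then show ?r by (simp add: has_real_derivative_iff_has_vector_derivative)
  next
    assume ?r
    then show ?l
      by (auto simp: has_real_derivative_iff_has_vector_derivative intro!: has_vector_derivative_Pair)
  qed
  then show ?thesis
    by (simp add: xcf_solution_on_def octant_solution_def xcf_field_def)
qed

text \<open>The equation is autonomous, so equal values at \<open>c\<close> give equal one-sided
  derivatives there, and the glued function is differentiable across \<open>c\<close>.\<close>

lemma vector_derivative_glue:
  fixes x y :: "real \<Rightarrow> 'a::real_normed_vector"
  assumes lr: "l < c" "c < r"
    and y: "\<And>t. t \<in> {l<..c} \<Longrightarrow> (y has_vector_derivative f (y t)) (at t within {l<..c})"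
    and x: "\<And>t. t \<in> {c..<r} \<Longrightarrow> (x has_vector_derivative f (x t)) (at t within {c..<r})"
    and "x c = y c" and t: "t \<in> {l<..<r}"
  shows "((\<lambda>t. if t \<in> {l<..c} then y t else x t) has_vector_derivative
    f (if t \<in> {l<..c} then y t else x t)) (at t)"
proof -
  have cl: "closure {l<..c} \<inter> closure {c..<r} = {c}" using lr by auto
  have S: "{l<..c} \<union> {c} = {l<..c}" "{c..<r} \<union> {c} = {c..<r}" using lr by auto
  have "((\<lambda>t. if t \<in> {l<..c} then y t else x t) has_vector_derivative
      (if t \<in> {l<..c} then f (y t) else f (x t))) (at t within {l<..<r})"
  proof (rule has_vector_derivative_If_within_closures[of t "{l<..c}" "{c..<r}", unfolded cl S])
    show "t \<in> {l<..c} \<union> {c..<r}" using t by auto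
    show "{l<..<r} = {l<..c} \<union> {c..<r}" using lr by auto
    show "t \<in> closure {l<..c} \<Longrightarrow> t \<in> closure {c..<r} \<Longrightarrow> y t = x t"
      using cl assms(5) by (metis IntI singletonD)
    then show "t \<in> closure {l<..c} \<Longrightarrow> t \<in> closure {c..<r} \<Longrightarrow> f (y t) = f (x t)"
      by simp
  qed (use x y in auto)
  then have "((\<lambda>t. if t \<in> {l<..c} then y t else x t) has_vector_derivative
      (if t \<in> {l<..c} then f (y t) else f (x t))) (at t)"
    using at_within_open[OF t] by simp
  then show ?thesis by (simp only: if_distrib[of f])
qed

lemma has_vector_derivative_reversed:
  assumes "(y has_vector_derivative v) (at (c - t) within S)" "(\<lambda>s. c - s) ` T \<subseteq> S"
  shows "((\<lambda>t. y (c - t)) has_vector_derivative - v) (at t within T)"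
proof -
  have "((\<lambda>t. c - t) has_vector_derivative - 1) (at t within T)"
    by (auto intro!: derivative_eq_intros)
  from vector_diff_chain_within[OF this has_vector_derivative_within_subset[OF assms]]
  show ?thesis by (simp add: o_def)
qed

text \<open>A solution confined to the box can be restarted close to the left end and, by the
  uniform existence time, continued backward beyond it. Maximality speaks of extensions that agree
  on the whole old interval, so the continuation is matched with the solution by uniqueness.\<close>

lemma xcf_maximal_escape:
  assumes max: "xcf_maximal_solution (ereal T) Tf A B C"
    and t1: "t1 \<in> einterval (- ereal T) Tf" and "m > 0" "m \<le> M"
    and box: "\<And>t. t \<in> einterval (- ereal T) Tf \<Longrightarrow> t \<le> t1 \<Longrightarrow> (A t, B t, C t) \<in> cbox (m, m, m) (M, M, M)"
  shows False
proof -
  define X where "X t = (A t, B t, C t)" for t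
  define J where "J = einterval (- ereal T) Tf"
  have sol: "octant_solution (- ereal T) Tf X"
    using max unfolding xcf_maximal_solution_def xcf_solution_on_iff X_def by blast
  obtain \<tau> where \<tau>: "\<tau> > 0" and ex: "\<And>\<sigma> p. \<bar>\<sigma>\<bar> = 1 \<Longrightarrow> p \<in> cbox (m, m, m) (M, M, M) \<Longrightarrow> \<exists>x. x 0 = p \<and>
      (\<forall>t\<in>{0..\<tau>}. x t \<in> cbox (m/2, m/2, m/2) (M + m, M + m, M + m) \<and>
        (x has_vector_derivative \<sigma> *\<^sub>R xcf_field (x t)) (at t within {0..\<tau>}))"
    using xcf_local_existence[OF \<open>m > 0\<close> \<open>m \<le> M\<close>] by metis
  \<comment> \<open>\<open>t2\<close> lies within \<open>\<tau> / 2\<close> of the left end, so the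
    backward solution from \<open>t2\<close> reaches the time
    \<open>t2 - \<tau> < - T\<close>.\<close>
  define t2 where "t2 = min t1 (- T + \<tau> / 2)"
  have J: "t \<in> J \<longleftrightarrow> - T < t \<and> ereal t < Tf" for t by (simp add: J_def einterval_def)
  have t2: "t2 \<in> J" "t2 \<le> t1" "\<tau> - t2 > T"
    using t1 \<tau> unfolding J_def[symmetric] J
    by (auto simp: t2_def min_def intro: le_less_trans[of _ "ereal t1"])
  have sub: "t \<in> J" if "- T < t" "t \<le> t2" for t
    using that t2(1) unfolding J by (auto intro: le_less_trans[of _ "ereal t2"])
  obtain y where y: "y 0 = X t2" "\<And>s. s \<in> {0..\<tau>} \<Longrightarrow> y s \<in> cbox (m/2, m/2, m/2) (M + m, M + m, M + m)"
    "\<And>s. s \<in> {0..\<tau>} \<Longrightarrow> (y has_vector_derivative (- 1) *\<^sub>R xcf_field (y s)) (at s within {0..\<tau>})"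
    using ex[of "-1" "X t2"] box[of t2] t2 unfolding J_def X_def by auto
  have X': "(X has_vector_derivative xcf_field (X t)) (at t)" if "t \<in> J" for t
    using sol that unfolding octant_solution_def J_def by blast
  obtain L where L: "\<And>p q. p \<in> cbox (m/2, m/2, m/2) (M + m, M + m, M + m) \<Longrightarrow>
      q \<in> cbox (m/2, m/2, m/2) (M + m, M + m, M + m) \<Longrightarrow> dist (xcf_field p) (xcf_field q) \<le> L * dist p q"
    using xcf_field_lipschitz[of "m/2"] \<open>m > 0\<close> by (metis half_gt_zero)
  have agree: "y (t2 - t) = X t" if t: "t \<in> J" "t \<le> t2" for t
  proof -
    have le: "t2 - t \<le> \<tau>" using t t2 \<tau> unfolding J t2_def by auto
    have "y (t2 - t) = X (t2 - (t2 - t))"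
    proof (rule lipschitz_ode_unique[where f = "\<lambda>p. - xcf_field p" and L = L and a = 0 and b = "t2 - t"
          and x = y and y = "\<lambda>s. X (t2 - s)" and S = "cbox (m/2, m/2, m/2) (M + m, M + m, M + m)"])
      fix s assume s: "s \<in> {0..t2 - t}"
      then have s': "s \<in> {0..\<tau>}" "t2 - s \<in> J" "t2 - s \<le> t1"
        using le t2 t sub[of "t2 - s"] unfolding J by auto
      show "(y has_vector_derivative - xcf_field (y s)) (at s within {0..t2 - t})"
        using has_vector_derivative_within_subset[OF y(3)[OF s'(1)], of "{0..t2 - t}"] le by auto
      show "y s \<in> cbox (m/2, m/2, m/2) (M + m, M + m, M + m)" by (rule y(2)[OF s'(1)])
      show "((\<lambda>s. X (t2 - s)) has_vector_derivative - xcf_field (X (t2 - s))) (at s within {0..t2 - t})"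
        by (rule has_vector_derivative_reversed[OF X'[OF s'(2)]]) simp
      show "X (t2 - s) \<in> cbox (m/2, m/2, m/2) (M + m, M + m, M + m)"
        using box[OF s'(2)[unfolded J_def] s'(3)] \<open>m > 0\<close> unfolding X_def mem_cbox3 by auto
    qed (use t y L in \<open>auto simp: dist_minus\<close>)
    then show ?thesis by simp
  qed
  define Z where "Z t = (if t \<in> {t2 - \<tau><..t2} then y (t2 - t) else X t)" for t
  have Z_agree: "Z t = X t" if "t \<in> J" for t
    using agree[OF that] by (auto simp: Z_def)
  have "octant_solution (- ereal (\<tau> - t2)) Tf Z"
    unfolding octant_solution_def
  proof (intro ballI)
    fix t assume "t \<in> einterval (- ereal (\<tau> - t2)) Tf"
    then have t: "t2 - \<tau> < t" "ereal t < Tf" by (auto simp: einterval_def)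
    have "0 < fst (Z t) \<and> 0 < fst (snd (Z t)) \<and> 0 < snd (snd (Z t))"
    proof (cases "t \<le> t2")
      case True
      obtain a b c where abc: "y (t2 - t) = (a, b, c)" by (metis prod_cases3)
      show ?thesis
        using y(2)[of "t2 - t"] True t \<open>m > 0\<close> unfolding Z_def abc mem_cbox3 by (simp add: abc)
    next
      case False
      then have "t \<in> J" using t t2(1) unfolding J by auto
      then show ?thesis
        using sol Z_agree unfolding octant_solution_def J_def by simp
    qed
    moreover have "(Z has_vector_derivative xcf_field (Z t)) (at t)"
    proof -
      have "ereal (max t t2) < Tf" using t t2(1) unfolding J by (simp add: max_def)
      \<comment> \<open>\<open>Tf\<close> may be infinite; the gluing takes place on an interval
        with a real right end \<open>r\<close>.\<close>
      then obtain r where r: "ereal (max t t2) < ereal r" "ereal r < Tf" using ereal_dense2 by blast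
      show ?thesis
        unfolding Z_def
      proof (rule vector_derivative_glue[where r = r])
        fix s assume s: "s \<in> {t2 - \<tau><..t2}"
        then have "t2 - s \<in> {0..\<tau>}" by auto
        moreover have "(\<lambda>s. t2 - s) ` {t2 - \<tau><..t2} \<subseteq> {0..\<tau>}" by auto
        ultimately have "((\<lambda>t. y (t2 - t)) has_vector_derivative - ((- 1) *\<^sub>R xcf_field (y (t2 - s))))
            (at s within {t2 - \<tau><..t2})"
          by (intro has_vector_derivative_reversed[OF y(3)])
        then show "((\<lambda>t. y (t2 - t)) has_vector_derivative xcf_field (y (t2 - s))) (at s within {t2 - \<tau><..t2})"
          by simp
      next
        fix s assume s: "s \<in> {t2..<r}"
        then have "s \<in> J" using t2(1) r(2) unfolding J by (auto intro: less_trans[of _ "ereal r"])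
        then show "(X has_vector_derivative xcf_field (X s)) (at s within {t2..<r})"
          by (rule has_vector_derivative_at_within[OF X'])
      qed (use t r \<tau> y in auto)
    qed
    ultimately show "0 < fst (Z t) \<and> 0 < fst (snd (Z t)) \<and> 0 < snd (snd (Z t)) \<and>
        (Z has_vector_derivative xcf_field (Z t)) (at t)" by simp
  qed
  then have "xcf_solution_on (einterval (- ereal (\<tau> - t2)) Tf)
      (\<lambda>t. fst (Z t)) (\<lambda>t. fst (snd (Z t))) (\<lambda>t. snd (snd (Z t)))"
    unfolding xcf_solution_on_iff by simp
  moreover have "\<forall>t\<in>einterval (- ereal T) Tf. fst (Z t) = A t \<and> fst (snd (Z t)) = B t \<and> snd (snd (Z t)) = C t"
    using Z_agree unfolding J_def X_def by simp
  moreover have "ereal T \<le> ereal (\<tau> - t2)" using t2 by simp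
  ultimately have "ereal (\<tau> - t2) = ereal T"
    using max unfolding xcf_maximal_solution_def by blast
  then show False using t2 by simp
qed

lemma einterval_subsetD:
  assumes "einterval a b \<subseteq> einterval c d" "a < 0" "0 < b"
  shows "c \<le> a" "b \<le> d"
proof -
  show "c \<le> a"
  proof (rule ccontr)
    assume "\<not> c \<le> a"
    then have "a < min c 0" using \<open>a < 0\<close> by auto
    then obtain r where "a < ereal r" "ereal r < min c 0" using ereal_dense2 by blast
    moreover from this have "ereal r < b" using less_trans[of "ereal r" 0 b] \<open>0 < b\<close> by simp
    ultimately have "r \<in> einterval a b" "r \<notin> einterval c d"
      by (auto simp: einterval_def)
    then show False using assms(1) by blast
  qed
  show "b \<le> d"
  proof (rule ccontr)
    assume "\<not> b \<le> d"
    then have "max d 0 < b" using \<open>0 < b\<close> by auto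
    then obtain r where "max d 0 < ereal r" "ereal r < b" using ereal_dense2 by blast
    moreover from this have "a < ereal r" using less_trans[of a 0 "ereal r"] \<open>a < 0\<close> by simp
    ultimately have "r \<in> einterval a b" "r \<notin> einterval c d"
      by (auto simp: einterval_def)
    then show False using assms(1) by blast
  qed
qed

lemma xcf_local_solution:
  assumes "0 < a" "0 < b" "0 < c"
  obtains \<tau> X where "\<tau> > 0" "octant_solution (ereal (- \<tau>)) (ereal \<tau>) X" "X 0 = (a, b, c)"
proof -
  define m where "m = min a (min b c)"
  define M where "M = max a (max b c)"
  have mM: "m > 0" "m \<le> M" using assms by (auto simp: m_def M_def)
  obtain \<tau> where \<tau>: "\<tau> > 0" and ex: "\<And>\<sigma> p. \<bar>\<sigma>\<bar> = 1 \<Longrightarrow> p \<in> cbox (m, m, m) (M, M, M) \<Longrightarrow> \<exists>x. x 0 = p \<and>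
      (\<forall>t\<in>{0..\<tau>}. x t \<in> cbox (m/2, m/2, m/2) (M + m, M + m, M + m) \<and>
        (x has_vector_derivative \<sigma> *\<^sub>R xcf_field (x t)) (at t within {0..\<tau>}))"
    using xcf_local_existence[OF mM] by metis
  have p: "(a, b, c) \<in> cbox (m, m, m) (M, M, M)" by (auto simp: mem_cbox3 m_def M_def)
  obtain x where x: "x 0 = (a, b, c)"
    "\<And>s. s \<in> {0..\<tau>} \<Longrightarrow> x s \<in> cbox (m/2, m/2, m/2) (M + m, M + m, M + m)"
    "\<And>s. s \<in> {0..\<tau>} \<Longrightarrow> (x has_vector_derivative xcf_field (x s)) (at s within {0..\<tau>})"
    using ex[OF _ p, of 1] by auto
  obtain y where y: "y 0 = (a, b, c)"
    "\<And>s. s \<in> {0..\<tau>} \<Longrightarrow> y s \<in> cbox (m/2, m/2, m/2) (M + m, M + m, M + m)"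
    "\<And>s. s \<in> {0..\<tau>} \<Longrightarrow> (y has_vector_derivative - xcf_field (y s)) (at s within {0..\<tau>})"
    using ex[OF _ p, of "-1"] by auto
  define X where "X t = (if t \<in> {- \<tau><..0} then y (0 - t) else x t)" for t
  have "octant_solution (ereal (- \<tau>)) (ereal \<tau>) X"
    unfolding octant_solution_def
  proof (intro ballI)
    fix t assume "t \<in> einterval (ereal (- \<tau>)) (ereal \<tau>)"
    then have t: "t \<in> {- \<tau><..<\<tau>}" by (auto simp: einterval_def)
    have "X t \<in> cbox (m/2, m/2, m/2) (M + m, M + m, M + m)"
      using t x(2)[of t] y(2)[of "- t"] by (auto simp: X_def)
    then have "0 < fst (X t) \<and> 0 < fst (snd (X t)) \<and> 0 < snd (snd (X t))"
      using mM by (cases "X t") (auto simp: mem_cbox3)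
    moreover have "(X has_vector_derivative xcf_field (X t)) (at t)"
      unfolding X_def
    proof (rule vector_derivative_glue[where r = \<tau>])
      fix s assume s: "s \<in> {- \<tau><..0}"
      then have "0 - s \<in> {0..\<tau>}" by auto
      moreover have "(\<lambda>s. 0 - s) ` {- \<tau><..0} \<subseteq> {0..\<tau>}" by auto
      ultimately have "((\<lambda>t. y (0 - t)) has_vector_derivative - (- xcf_field (y (0 - s))))
          (at s within {- \<tau><..0})"
        by (intro has_vector_derivative_reversed[OF y(3)])
      then show "((\<lambda>t. y (0 - t)) has_vector_derivative xcf_field (y (0 - s))) (at s within {- \<tau><..0})"
        by simp
    next
      fix s assume s: "s \<in> {0..<\<tau>}"
      then show "(x has_vector_derivative xcf_field (x s)) (at s within {0..<\<tau>})"
        by (intro has_vector_derivative_within_subset[OF x(3)]) auto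
    qed (use t \<tau> x y in auto)
    ultimately show "0 < fst (X t) \<and> 0 < fst (snd (X t)) \<and> 0 < snd (snd (X t)) \<and>
        (X has_vector_derivative xcf_field (X t)) (at t)" by simp
  qed
  moreover have "X 0 = (a, b, c)" using \<tau> y by (simp add: X_def)
  ultimately show thesis using \<tau> that by blast
qed

text \<open>Zorn's lemma on graphs. Inclusion of graphs means a longer interval together with
  agreement on the shorter one, which is the order used in \<open>xcf_maximal_solution\<close>. All
  graphs contain \<open>(0, q)\<close>, so the union of a chain again lives on an interval.\<close>

lemma xcf_maximal_solution_exists:
  assumes "0 < a" "0 < b" "0 < c"
  shows "\<exists>Tb Tf A B C. xcf_maximal_solution Tb Tf A B C \<and> (A 0, B 0, C 0) = (a, b, c)"
proof -
  define q where "q = (a, b, c)"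
  define graph where "graph l r X = (\<lambda>t. (t, X t)) ` einterval l r" for l r and X :: "real \<Rightarrow> real \<times> real \<times> real"
  define \<A> where "\<A> = {g. \<exists>l r X. l < 0 \<and> 0 < r \<and> octant_solution l r X \<and> X 0 = q \<and> g = graph l r X}"
  have mem: "(t, p) \<in> graph l r X \<longleftrightarrow> t \<in> einterval l r \<and> p = X t" for t p l r X
    by (auto simp: graph_def)
  have "\<A> \<noteq> {}"
  proof -
    obtain \<tau> X where "\<tau> > 0" "octant_solution (ereal (- \<tau>)) (ereal \<tau>) X" "X 0 = q"
      using xcf_local_solution[OF assms] unfolding q_def by blast
    moreover from this have "ereal (- \<tau>) < 0" "0 < ereal \<tau>" by simp_all
    ultimately have "graph (ereal (- \<tau>)) (ereal \<tau>) X \<in> \<A>" unfolding \<A>_def by blast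
    then show ?thesis by blast
  qed
  moreover have "\<Union>\<C> \<in> \<A>" if ne: "\<C> \<noteq> {}" and ch: "subset.chain \<A> \<C>" for \<C>
  proof -
    have "\<C> \<subseteq> \<A>" using ch by (simp add: subset_chain_def)
    then have "\<forall>g\<in>\<C>. \<exists>l r X. l < 0 \<and> 0 < r \<and> octant_solution l r X \<and> X 0 = q \<and> g = graph l r X"
      unfolding \<A>_def by blast
    then obtain l r X where lrX: "\<And>g. g \<in> \<C> \<Longrightarrow>
        l g < 0 \<and> 0 < r g \<and> octant_solution (l g) (r g) (X g) \<and> X g 0 = q \<and> g = graph (l g) (r g) (X g)"
      by metis
    define L R where "L = (INF g\<in>\<C>. l g)" and "R = (SUP g\<in>\<C>. r g)"
    \<comment> \<open>Members of a chain are comparable, so all of them that are defined at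
      \<open>t\<close> give the same value there and the choice is determined.\<close>
    define Y where "Y t = (SOME p. (t, p) \<in> \<Union>\<C>)" for t
    have unique: "X g t = X h t" if "g \<in> \<C>" "h \<in> \<C>" "t \<in> einterval (l g) (r g)" "t \<in> einterval (l h) (r h)" for g h t
    proof -
      have "(t, X g t) \<in> g" "(t, X h t) \<in> h" using that lrX mem by metis+
      moreover have "g \<subseteq> h \<or> h \<subseteq> g" using ch that by (auto simp: subset_chain_def)
      ultimately show ?thesis using that lrX mem by (metis subsetD)
    qed
    have Y: "Y t = X g t" if "g \<in> \<C>" "t \<in> einterval (l g) (r g)" for g t
    proof -
      have "(t, X g t) \<in> \<Union>\<C>" using that lrX mem by (metis UnionI)
      then have "(t, Y t) \<in> \<Union>\<C>" unfolding Y_def by (rule someI)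
      then obtain h where "h \<in> \<C>" "(t, Y t) \<in> h" by blast
      then have "t \<in> einterval (l h) (r h)" "Y t = X h t" using lrX mem by metis+
      then show ?thesis using unique[OF that(1) \<open>h \<in> \<C>\<close> that(2)] by simp
    qed
    have cover: "\<exists>g\<in>\<C>. t \<in> einterval (l g) (r g)" if "t \<in> einterval L R" for t
    proof (cases "t \<le> 0")
      case True
      have "L < ereal t" using that by (simp add: einterval_def)
      then obtain g where "g \<in> \<C>" "l g < ereal t" unfolding L_def by (auto simp: INF_less_iff)
      moreover have "ereal t < r g" using True lrX[OF \<open>g \<in> \<C>\<close>] by (auto intro: le_less_trans[of _ 0])
      ultimately show ?thesis by (auto simp: einterval_def)
    next
      case False
      have "ereal t < R" using that by (simp add: einterval_def)
      then obtain g where "g \<in> \<C>" "ereal t < r g" unfolding R_def by (auto simp: less_SUP_iff)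
      moreover have "l g < ereal t" using False lrX[OF \<open>g \<in> \<C>\<close>] by (auto intro: less_trans[of _ 0])
      ultimately show ?thesis by (auto simp: einterval_def)
    qed
    have sub: "einterval (l g) (r g) \<subseteq> einterval L R" if "g \<in> \<C>" for g
    proof -
      have "L \<le> l g" "r g \<le> R" using that by (auto simp: L_def R_def INF_lower SUP_upper)
      then show ?thesis by (auto simp: einterval_def intro: le_less_trans less_le_trans)
    qed
    obtain g0 where g0: "g0 \<in> \<C>" using ne by blast
    have LR: "L < 0" "0 < R"
      using lrX[OF g0] g0 by (auto simp: L_def R_def INF_less_iff less_SUP_iff)
    have "octant_solution L R Y"
      unfolding octant_solution_def
    proof (intro ballI)
      fix t assume "t \<in> einterval L R"
      then obtain g where g: "g \<in> \<C>" "t \<in> einterval (l g) (r g)" using cover by blast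
      then have sol: "0 < fst (X g t) \<and> 0 < fst (snd (X g t)) \<and> 0 < snd (snd (X g t)) \<and>
          (X g has_vector_derivative xcf_field (X g t)) (at t)"
        using lrX unfolding octant_solution_def by blast
      then have "(Y has_vector_derivative xcf_field (X g t)) (at t)"
        using has_vector_derivative_transform_within_open[of "X g" _ t "einterval (l g) (r g)" Y] g Y[OF g(1)] by auto
      with sol Y[OF g] show "0 < fst (Y t) \<and> 0 < fst (snd (Y t)) \<and> 0 < snd (snd (Y t)) \<and>
          (Y has_vector_derivative xcf_field (Y t)) (at t)" by simp
    qed
    moreover have "Y 0 = q"
      using Y[OF g0, of 0] lrX[OF g0] by (simp add: einterval_def zero_ereal_def)
    moreover have "\<Union>\<C> = graph L R Y"
    proof -
      have eq: "(t, p) \<in> \<Union>\<C> \<longleftrightarrow> (t, p) \<in> graph L R Y" for t p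
      proof
        assume "(t, p) \<in> \<Union>\<C>"
        then obtain g where g: "g \<in> \<C>" "(t, p) \<in> g" by blast
        then have "t \<in> einterval (l g) (r g)" "p = X g t" using lrX mem by metis+
        then show "(t, p) \<in> graph L R Y" using sub[OF g(1)] Y[OF g(1)] mem by auto
      next
        assume "(t, p) \<in> graph L R Y"
        then have "t \<in> einterval L R" "p = Y t" using mem by auto
        moreover from this(1) obtain g where "g \<in> \<C>" "t \<in> einterval (l g) (r g)" using cover by blast
        ultimately have "(t, p) \<in> g" using lrX Y mem by metis
        with \<open>g \<in> \<C>\<close> show "(t, p) \<in> \<Union>\<C>" by blast
      qed
      show ?thesis
      proof (rule set_eqI)
        show "x \<in> \<Union>\<C> \<longleftrightarrow> x \<in> graph L R Y" for x
          using eq[of "fst x" "snd x"] by (simp only: prod.collapse)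
      qed
    qed
    ultimately have "L < 0 \<and> 0 < R \<and> octant_solution L R Y \<and> Y 0 = q \<and> \<Union>\<C> = graph L R Y"
      using LR by (intro conjI)
    then show ?thesis unfolding \<A>_def by (intro CollectI exI)
  qed
  ultimately have "\<exists>g\<in>\<A>. \<forall>h\<in>\<A>. g \<subseteq> h \<longrightarrow> h = g" by (rule subset_Zorn_nonempty)
  then obtain G where G: "G \<in> \<A>" "\<And>h. h \<in> \<A> \<Longrightarrow> G \<subseteq> h \<Longrightarrow> h = G" by metis
  obtain l r X where "l < 0 \<and> 0 < r \<and> octant_solution l r X \<and> X 0 = q \<and> G = graph l r X"
    using G(1) unfolding \<A>_def mem_Collect_eq by (elim exE)
  then have lr: "l < 0" "0 < r" and sol: "octant_solution l r X" and X0: "X 0 = q"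
    and max: "\<And>h. h \<in> \<A> \<Longrightarrow> graph l r X \<subseteq> h \<Longrightarrow> h = graph l r X"
    using G(2) by auto
  define A B C where "A t = fst (X t)" and "B t = fst (snd (X t))" and "C t = snd (snd (X t))" for t
  have XABC: "X = (\<lambda>t. (A t, B t, C t))" by (simp add: A_def B_def C_def)
  have "xcf_maximal_solution (- l) r A B C"
    unfolding xcf_maximal_solution_def
  proof (intro conjI allI impI; (elim conjE)?)
    show "0 < - l" "0 < r" using lr by (auto simp: ereal_uminus_less_reorder)
    show "xcf_solution_on (einterval (- (- l)) r) A B C"
      using sol by (simp add: xcf_solution_on_iff XABC[symmetric])
    fix Tb' Tf' A' B' C'
    assume ext: "- l \<le> Tb'" "r \<le> Tf'" "xcf_solution_on (einterval (- Tb') Tf') A' B' C'"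
      and eq: "\<forall>t\<in>einterval (- (- l)) r. A' t = A t \<and> B' t = B t \<and> C' t = C t"
    define X' where "X' t = (A' t, B' t, C' t)" for t
    have le: "- Tb' \<le> l" using ext(1) by (simp add: ereal_uminus_le_reorder)
    have sub: "einterval l r \<subseteq> einterval (- Tb') Tf'"
      using le ext(2) by (auto simp: einterval_def intro: le_less_trans less_le_trans)
    have X': "X' t = X t" if "t \<in> einterval l r" for t
      using eq that by (simp add: X'_def XABC)
    have "0 \<in> einterval l r" using lr by (simp add: einterval_def zero_ereal_def)
    then have "X' 0 = q" using X' X0 by simp
    moreover have "- Tb' < 0" "0 < Tf'" using le ext(2) lr by auto
    moreover have "octant_solution (- Tb') Tf' X'" using ext(3) by (simp add: xcf_solution_on_iff X'_def[abs_def])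
    ultimately have "graph (- Tb') Tf' X' \<in> \<A>"
      unfolding \<A>_def by (intro CollectI exI[of _ "- Tb'"] exI[of _ Tf'] exI[of _ X'] conjI refl)
    moreover have "graph l r X \<subseteq> graph (- Tb') Tf' X'" using sub X' by (force simp: graph_def)
    ultimately have "graph (- Tb') Tf' X' = graph l r X" by (rule max)
    \<comment> \<open>Projecting equal graphs to the time axis gives equal intervals, and intervals
      around 0 determine their ends.\<close>
    then have "fst ` graph (- Tb') Tf' X' = fst ` graph l r X" by simp
    then have "einterval (- Tb') Tf' = einterval l r" by (simp add: graph_def image_image)
    then have "l \<le> - Tb'" "Tf' \<le> r"
      using einterval_subsetD[of "- Tb'" Tf' l r] \<open>- Tb' < 0\<close> \<open>0 < Tf'\<close> by auto
    with le ext(2) show "Tb' = - l" "Tf' = r" by (auto simp: ereal_uminus_eq_reorder)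
  qed
  moreover have "(A 0, B 0, C 0) = (a, b, c)" using X0 by (simp add: XABC q_def)
  ultimately show ?thesis by blast
qed

section \<open>Backward limits and domination by one coefficient\<close>

text \<open>Times approaching the left end of \<open>J\<close>. This also makes sense for
  \<open>J\<close> unbounded below, so limits can be taken before the backward existence time is
  known to be finite; afterwards the filter is \<open>at_right (Inf J)\<close>.\<close>

definition backward :: "real set \<Rightarrow> real filter" where
  "backward J = (INF t\<in>J. principal {s \<in> J. s < t})"

locale down_interval =
  fixes J :: "real set"
  assumes nonempty: "J \<noteq> {}"
    and ivl: "\<And>s t r. s \<in> J \<Longrightarrow> t \<in> J \<Longrightarrow> s \<le> r \<Longrightarrow> r \<le> t \<Longrightarrow> r \<in> J"
    and below: "\<And>t. t \<in> J \<Longrightarrow> \<exists>s\<in>J. s < t"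
begin

lemma eventually_backward: "eventually P (backward J) \<longleftrightarrow> (\<exists>t\<in>J. \<forall>s\<in>J. s < t \<longrightarrow> P s)"
proof -
  have "eventually P (backward J) \<longleftrightarrow> (\<exists>t\<in>J. eventually P (principal {s \<in> J. s < t}))"
    unfolding backward_def
  proof (rule eventually_INF_base[OF nonempty])
    fix a b assume "a \<in> J" "b \<in> J"
    then have "min a b \<in> J" by (simp add: min_def)
    then show "\<exists>x\<in>J. principal {s \<in> J. s < x} \<le> inf (principal {s \<in> J. s < a}) (principal {s \<in> J. s < b})"
      by (intro bexI[of _ "min a b"]) (auto simp: le_principal eventually_principal)
  qed
  then show ?thesis by (auto simp: eventually_principal)
qed

lemma backward_nontrivial [simp]: "backward J \<noteq> bot"
  using below by (auto simp: trivial_limit_def eventually_backward)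

lemma eventually_backward_le:
  assumes "t \<in> J" "\<And>s. s \<in> J \<Longrightarrow> s \<le> t \<Longrightarrow> P s"
  shows "eventually P (backward J)"
  unfolding eventually_backward using assms by (intro bexI[of _ t]) auto

lemma backward_eq_at_right:
  assumes "bdd_below J"
  shows "backward J = at_right (Inf J)"
proof (rule filter_eqI)
  have Inf: "Inf J < t" if t: "t \<in> J" for t
  proof -
    obtain s where "s \<in> J" "s < t" using below[OF t] by blast
    then show ?thesis using cInf_lower[OF _ assms] by (meson le_less_trans)
  qed
  have mem: "s \<in> J" if s: "Inf J < s" "s < t" and t: "t \<in> J" for s t
  proof -
    obtain r where "r \<in> J" "r < s" using cInf_lessD[OF nonempty s(1)] by blast
    then show ?thesis using ivl[OF _ t] s by auto
  qed
  fix P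
  have "eventually P (backward J) \<longleftrightarrow> (\<exists>t\<in>J. \<forall>s>Inf J. s < t \<longrightarrow> P s)"
    unfolding eventually_backward using Inf mem by meson
  also have "\<dots> \<longleftrightarrow> (\<exists>b>Inf J. \<forall>s>Inf J. s < b \<longrightarrow> P s)"
  proof
    assume "\<exists>b>Inf J. \<forall>s>Inf J. s < b \<longrightarrow> P s"
    then obtain b where b: "b > Inf J" "\<forall>s>Inf J. s < b \<longrightarrow> P s" by blast
    then obtain r where "r \<in> J" "r < b" using cInf_lessD[OF nonempty b(1)] by blast
    then show "\<exists>t\<in>J. \<forall>s>Inf J. s < t \<longrightarrow> P s" using b by (intro bexI[of _ r]) auto
  qed (use Inf in blast)
  also have "\<dots> \<longleftrightarrow> eventually P (at_right (Inf J))"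
    by (simp add: eventually_at_right_field)
  finally show "eventually P (backward J) \<longleftrightarrow> eventually P (at_right (Inf J))" .
qed

lemma deriv_mono:
  assumes "s \<in> J" "t \<in> J" "s \<le> t"
    and "\<And>r. r \<in> J \<Longrightarrow> r \<le> t \<Longrightarrow> (f has_real_derivative f' r) (at r)"
    and "\<And>r. r \<in> J \<Longrightarrow> r \<le> t \<Longrightarrow> f' r \<ge> 0"
  shows "f s \<le> f t"
  using assms ivl[OF assms(1,2)] by (intro DERIV_nonneg_imp_nondecreasing[OF assms(3)]) blast

lemma mono_tendsto:
  fixes f :: "real \<Rightarrow> real"
  assumes t1: "t1 \<in> J" and mono: "\<And>s t. s \<in> J \<Longrightarrow> t \<in> J \<Longrightarrow> s \<le> t \<Longrightarrow> t \<le> t1 \<Longrightarrow> f s \<le> f t"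
    and lower: "\<And>t. t \<in> J \<Longrightarrow> t \<le> t1 \<Longrightarrow> m \<le> f t"
  obtains l where "l \<ge> m" "(f \<longlongrightarrow> l) (backward J)" "\<And>t. t \<in> J \<Longrightarrow> t \<le> t1 \<Longrightarrow> l \<le> f t"
proof -
  define S where "S = f ` {t \<in> J. t \<le> t1}"
  have S: "S \<noteq> {}" "bdd_below S" using t1 lower by (auto simp: S_def intro: bdd_belowI[of _ m])
  have le: "Inf S \<le> f t" if "t \<in> J" "t \<le> t1" for t
    using that S by (intro cInf_lower) (auto simp: S_def)
  show thesis
  proof
    show "Inf S \<ge> m" using S lower by (intro cInf_greatest) (auto simp: S_def)
    show "(f \<longlongrightarrow> Inf S) (backward J)"
    proof (rule order_tendstoI)
      fix a assume "a < Inf S"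
      then show "\<forall>\<^sub>F t in backward J. a < f t"
        using le by (intro eventually_backward_le[OF t1]) force
    next
      fix a assume "Inf S < a"
      then obtain t where t: "t \<in> J" "t \<le> t1" "f t < a"
        using cInf_lessD[OF S(1)] by (auto simp: S_def)
      show "\<forall>\<^sub>F t in backward J. f t < a"
        using mono t by (intro eventually_backward_le[OF t(1)]) (meson le_less_trans)
    qed
  qed (use le in auto)
qed

text \<open>Both \<open>f + p\<close> and \<open>p\<close> are monotone and bounded below, and
  \<open>f\<close> is their difference. The majorant \<open>p\<close> plays the role of an
  integrability condition on \<open>f'\<close>.\<close>

lemma dominated_derivative_tendsto:
  fixes f p :: "real \<Rightarrow> real"
  assumes t1: "t1 \<in> J"
    and f: "\<And>t. t \<in> J \<Longrightarrow> t \<le> t1 \<Longrightarrow> (f has_real_derivative f' t) (at t)"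
    and p: "\<And>t. t \<in> J \<Longrightarrow> t \<le> t1 \<Longrightarrow> (p has_real_derivative p' t) (at t)"
    and dom: "\<And>t. t \<in> J \<Longrightarrow> t \<le> t1 \<Longrightarrow> \<bar>f' t\<bar> \<le> p' t"
    and p0: "\<And>t. t \<in> J \<Longrightarrow> t \<le> t1 \<Longrightarrow> 0 \<le> p t"
  obtains l where "(f \<longlongrightarrow> l) (backward J)"
proof -
  have mono1: "f s + p s \<le> f t + p t" if "s \<in> J" "t \<in> J" "s \<le> t" "t \<le> t1" for s t
  proof (rule deriv_mono[OF that(1-3)])
    fix r assume "r \<in> J" "r \<le> t"
    then have r: "r \<in> J" "r \<le> t1" using that by auto
    show "((\<lambda>t. f t + p t) has_real_derivative f' r + p' r) (at r)" by (intro DERIV_add f p r)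
    show "f' r + p' r \<ge> 0" using dom[OF r] by simp
  qed
  have mono2: "p s - f s \<le> p t - f t" if "s \<in> J" "t \<in> J" "s \<le> t" "t \<le> t1" for s t
  proof (rule deriv_mono[OF that(1-3)])
    fix r assume "r \<in> J" "r \<le> t"
    then have r: "r \<in> J" "r \<le> t1" using that by auto
    show "((\<lambda>t. p t - f t) has_real_derivative p' r - f' r) (at r)" by (intro DERIV_diff f p r)
    show "p' r - f' r \<ge> 0" using dom[OF r] by simp
  qed
  have mono3: "p s \<le> p t" if "s \<in> J" "t \<in> J" "s \<le> t" "t \<le> t1" for s t
    using mono1[OF that] mono2[OF that] by simp
  obtain a where a: "(p \<longlongrightarrow> a) (backward J)"
    using mono_tendsto[OF t1, of p 0] mono3 p0 by metis
  have "f t1 - p t1 \<le> f t + p t" if "t \<in> J" "t \<le> t1" for t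
    using mono2[OF that(1) t1 that(2)] p0[OF that] by simp
  then obtain b where b: "((\<lambda>t. f t + p t) \<longlongrightarrow> b) (backward J)"
    using mono_tendsto[OF t1, of "\<lambda>t. f t + p t"] mono1 by metis
  have "((\<lambda>t. f t + p t - p t) \<longlongrightarrow> b - a) (backward J)" by (intro tendsto_diff a b)
  then show thesis using that by simp
qed

end

section \<open>From linear vanishing to power laws\<close>

lemma tendsto_quotient_at_right:
  fixes f :: "real \<Rightarrow> real"
  assumes "(f \<longlongrightarrow> 0) (at_right a)" "\<forall>\<^sub>F t in at_right a. (f has_real_derivative f' t) (at t)"
    and "(f' \<longlongrightarrow> k) (at_right a)"
  shows "((\<lambda>t. f t / (t - a)) \<longlongrightarrow> k) (at_right a)"
proof (rule lhopital_right[where f' = f' and g' = "\<lambda>_. 1"])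
  have "((\<lambda>t. t - a) \<longlongrightarrow> a - a) (at_right a)" by (intro tendsto_intros)
  then show "((\<lambda>t. t - a) \<longlongrightarrow> 0) (at_right a)" by simp
  show "\<forall>\<^sub>F t in at_right a. t - a \<noteq> 0"
    using eventually_at_right_less[of a] by eventually_elim simp
  show "\<forall>\<^sub>F t in at_right a. ((\<lambda>t. t - a) has_real_derivative 1) (at t)"
    by (intro always_eventually allI) (auto intro!: derivative_eq_intros)
qed (use assms in auto)

text \<open>Here \<open>f\<close> vanishes linearly in time and \<open>g\<close> is comparable to a
  power of \<open>f\<close>. In the applications \<open>f = D^(-14)\<close>, with
  \<open>p = - 1 / 14\<close> for \<open>D\<close> and \<open>p = 3 / 14\<close> for the two other
  coefficients.\<close>

lemma asymp_equiv_powr_at_right: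
  fixes f g :: "real \<Rightarrow> real"
  assumes lim: "((\<lambda>t. f t / (t - a)) \<longlongrightarrow> k) (at_right a)" and "0 < k"
    and f: "\<forall>\<^sub>F t in at_right a. 0 < f t"
    and g: "((\<lambda>t. g t * f t powr (- p)) \<longlongrightarrow> c) (at_right a)" and "0 < c"
  shows "g \<sim>[at_right a] (\<lambda>t. c * k powr p * (t - a) powr p)"
proof (rule asymp_equivI')
  have "((\<lambda>t. g t * f t powr (- p) * (f t / (t - a)) powr p / (c * k powr p)) \<longlongrightarrow>
      c * k powr p / (c * k powr p)) (at_right a)"
    using assms by (intro tendsto_intros) auto
  also have "c * k powr p / (c * k powr p) = 1" using assms by simp
  finally have "((\<lambda>t. g t * f t powr (- p) * (f t / (t - a)) powr p / (c * k powr p)) \<longlongrightarrow> 1) (at_right a)" .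
  moreover have "\<forall>\<^sub>F t in at_right a. g t * f t powr (- p) * (f t / (t - a)) powr p / (c * k powr p)
      = g t / (c * k powr p * (t - a) powr p)"
    using f eventually_at_right_less[of a]
  proof eventually_elim
    case (elim t)
    then have "f t powr (- p) * (f t / (t - a)) powr p = 1 / (t - a) powr p"
      by (simp add: powr_divide powr_minus field_simps)
    then have "g t * f t powr (- p) * (f t / (t - a)) powr p = g t / (t - a) powr p"
      by (simp add: mult.assoc)
    then show ?case by simp
  qed
  ultimately show "((\<lambda>t. g t / (c * k powr p * (t - a) powr p)) \<longlongrightarrow> 1) (at_right a)"
    by (rule Lim_transform_eventually)
qed

context down_interval
begin

text \<open>Applied with \<open>(D, X, Y) = (A, B, C)\<close> in case (1) and with \<open>(B, C, A)\<close> in case (2).\<close>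

lemma dominance:
  fixes D X Y FD FX FY :: "real \<Rightarrow> real"
  assumes t1: "t1 \<in> J" and \<epsilon>: "0 < \<epsilon>" "0 < K"
    and pos: "\<And>t. t \<in> J \<Longrightarrow> t \<le> t1 \<Longrightarrow> 0 < D t \<and> 0 < X t \<and> 0 < Y t"
    and D': "\<And>t. t \<in> J \<Longrightarrow> t \<le> t1 \<Longrightarrow> (D has_real_derivative - (2 * D t * FX t * FY t) / (D t * X t * Y t)\<^sup>2) (at t)"
    and X': "\<And>t. t \<in> J \<Longrightarrow> t \<le> t1 \<Longrightarrow> (X has_real_derivative - (2 * X t * FY t * FD t) / (D t * X t * Y t)\<^sup>2) (at t)"
    and Y': "\<And>t. t \<in> J \<Longrightarrow> t \<le> t1 \<Longrightarrow> (Y has_real_derivative - (2 * Y t * FD t * FX t) / (D t * X t * Y t)\<^sup>2) (at t)"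
    and FX: "\<And>t. t \<in> J \<Longrightarrow> t \<le> t1 \<Longrightarrow> \<epsilon> * (D t)\<^sup>2 \<le> FX t"
    and FY: "\<And>t. t \<in> J \<Longrightarrow> t \<le> t1 \<Longrightarrow> \<epsilon> * (D t)\<^sup>2 \<le> FY t"
    and FD: "\<And>t. t \<in> J \<Longrightarrow> t \<le> t1 \<Longrightarrow> \<epsilon> * (D t)\<^sup>2 \<le> - FD t \<and> - FD t \<le> K * (D t)\<^sup>2"
    and approx: "\<And>t. t \<in> J \<Longrightarrow> t \<le> t1 \<Longrightarrow> \<bar>FX t - (D t)\<^sup>2\<bar> \<le> K * D t * (X t + Y t) \<and>
        \<bar>FY t - (D t)\<^sup>2\<bar> \<le> K * D t * (X t + Y t) \<and> \<bar>FD t + 3 * (D t)\<^sup>2\<bar> \<le> K * D t * (X t + Y t)"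
    and escape: "\<And>m M. 0 < m \<Longrightarrow> m \<le> M \<Longrightarrow> (\<And>t. t \<in> J \<Longrightarrow> t \<le> t1 \<Longrightarrow>
        D t \<in> {m..M} \<and> X t \<in> {m..M} \<and> Y t \<in> {m..M}) \<Longrightarrow> \<not> bdd_below J"
  shows "bdd_below J \<and> (\<exists>\<eta>1>0. \<exists>\<eta>2>0. \<exists>\<eta>3>0.
    D \<sim>[at_right (Inf J)] (\<lambda>t. \<eta>1 * (t - Inf J) powr (- 1 / 14)) \<and>
    X \<sim>[at_right (Inf J)] (\<lambda>t. \<eta>2 * (t - Inf J) powr (3 / 14)) \<and>
    Y \<sim>[at_right (Inf J)] (\<lambda>t. \<eta>3 * (t - Inf J) powr (3 / 14)))"
proof -
  define h where "h t = 2 / (D t * X t * Y t)\<^sup>2" for t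
  have h: "h t > 0" if "t \<in> J" "t \<le> t1" for t using pos[OF that] by (simp add: h_def)
  have F: "FX t > 0" "FY t > 0" "FD t < 0" if "t \<in> J" "t \<le> t1" for t
  proof -
    have "\<epsilon> * (D t)\<^sup>2 > 0" using pos[OF that] \<epsilon> by simp
    then show "FX t > 0" "FY t > 0" "FD t < 0" using FX[OF that] FY[OF that] FD[OF that] by linarith+
  qed
  have dD: "(D has_real_derivative - (h t * D t * FX t * FY t)) (at t)"
    and dX: "(X has_real_derivative - (h t * X t * FY t * FD t)) (at t)"
    and dY: "(Y has_real_derivative - (h t * Y t * FD t * FX t)) (at t)" if "t \<in> J" "t \<le> t1" for t
    using D'[OF that] X'[OF that] Y'[OF that] by (simp_all add: h_def)
  have D_mono: "D t \<le> D s" if "s \<in> J" "t \<in> J" "s \<le> t" "t \<le> t1" for s t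
  proof -
    have "- D s \<le> - D t"
    proof (rule deriv_mono[OF that(1-3)])
      fix r assume "r \<in> J" "r \<le> t"
      then have r: "r \<in> J" "r \<le> t1" using that by auto
      show "((\<lambda>t. - D t) has_real_derivative h r * D r * FX r * FY r) (at r)"
        using DERIV_minus[OF dD[OF r]] by simp
      show "0 \<le> h r * D r * FX r * FY r" using h[OF r] pos[OF r] F[OF r] by simp
    qed
    then show ?thesis by simp
  qed
  have X_mono: "X s \<le> X t" if "s \<in> J" "t \<in> J" "s \<le> t" "t \<le> t1" for s t
  proof (rule deriv_mono[OF that(1-3)])
    fix r assume "r \<in> J" "r \<le> t"
    then have r: "r \<in> J" "r \<le> t1" using that by auto
    show "(X has_real_derivative - (h r * X r * FY r * FD r)) (at r)" by (rule dX[OF r])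
    show "0 \<le> - (h r * X r * FY r * FD r)" using h[OF r] pos[OF r] F[OF r] by (simp add: mult_nonneg_nonpos)
  qed
  have Y_mono: "Y s \<le> Y t" if "s \<in> J" "t \<in> J" "s \<le> t" "t \<le> t1" for s t
  proof (rule deriv_mono[OF that(1-3)])
    fix r assume "r \<in> J" "r \<le> t"
    then have r: "r \<in> J" "r \<le> t1" using that by auto
    show "(Y has_real_derivative - (h r * Y r * FD r * FX r)) (at r)" by (rule dY[OF r])
    show "0 \<le> - (h r * Y r * FD r * FX r)" using h[OF r] pos[OF r] F[OF r]
      by (simp add: mult_nonneg_nonpos mult_nonpos_nonneg)
  qed
  have p1: "0 < D t1" "0 < X t1" "0 < Y t1" using pos[OF t1] by auto
  \<comment> \<open>The derivative of \<open>X^2\<close> is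
    \<open>4 * FY * (- FD) / (D * Y)^2\<close>, at least
    \<open>4 * \<epsilon>^2 * D^2 / Y^2\<close>. Backward in time \<open>D\<close> grows and
    \<open>Y\<close> shrinks, so the value \<open>c\<close> at \<open>t1\<close> is a lower bound,
    and \<open>X^2\<close> would become negative after a finite time.\<close>
  define c where "c = 4 * \<epsilon>\<^sup>2 * (D t1)\<^sup>2 / (Y t1)\<^sup>2"
  have "c > 0" using p1 \<epsilon> by (simp add: c_def)
  have X2: "(X t)\<^sup>2 - c * t \<le> (X t1)\<^sup>2 - c * t1" if t: "t \<in> J" "t \<le> t1" for t
  proof (rule deriv_mono[OF t(1) t1 t(2)])
    fix r assume r: "r \<in> J" "r \<le> t1"
    note pr = pos[OF r]
    show "((\<lambda>t. (X t)\<^sup>2 - c * t) has_real_derivative 2 * X r * - (h r * X r * FY r * FD r) - c) (at r)"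
      by (auto intro!: derivative_eq_intros dX[OF r])
    have "c \<le> 4 * \<epsilon>\<^sup>2 * (D r)\<^sup>2 / (Y r)\<^sup>2"
      unfolding c_def using p1 pr D_mono[OF r(1) t1 r(2)] Y_mono[OF r(1) t1 r(2)] \<epsilon>
      by (intro frac_le mult_left_mono power_mono) auto
    also have "\<dots> = 4 * (\<epsilon> * (D r)\<^sup>2) * (\<epsilon> * (D r)\<^sup>2) / ((D r)\<^sup>2 * (Y r)\<^sup>2)"
      using pr by (simp add: power2_eq_square)
    also have "\<dots> \<le> 4 * FY r * (- FD r) / ((D r)\<^sup>2 * (Y r)\<^sup>2)"
      using FY[OF r] FD[OF r] F[OF r] \<epsilon> by (intro divide_right_mono mult_mono) auto
    also have "\<dots> = 2 * X r * - (h r * X r * FY r * FD r)"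
      using pr by (simp add: h_def field_simps power2_eq_square)
    finally show "0 \<le> 2 * X r * - (h r * X r * FY r * FD r) - c" by simp
  qed
  have bdd: "bdd_below J"
  proof (rule bdd_belowI)
    fix t assume t: "t \<in> J"
    show "min t1 (t1 - (X t1)\<^sup>2 / c) \<le> t"
    proof (cases "t \<le> t1")
      case True
      have "c * (t1 - t) \<le> (X t1)\<^sup>2" using X2[OF t True] zero_le_power2[of "X t"]
        unfolding right_diff_distrib by linarith
      then have "t1 - t \<le> (X t1)\<^sup>2 / c" using \<open>c > 0\<close> by (simp add: field_simps)
      then show ?thesis by simp
    qed simp
  qed
  define q where "q t = inverse (D t)" for t
  have dq: "(q has_real_derivative h t * FX t * FY t * q t) (at t)" if "t \<in> J" "t \<le> t1" for t
    unfolding q_def using pos[OF that]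
    by (auto intro!: derivative_eq_intros dD[OF that] simp: field_simps)
  have q: "q t > 0" "q t \<le> q t1" if "t \<in> J" "t \<le> t1" for t
    using pos[OF that] D_mono[OF that(1) t1 that(2)] p1 by (auto simp: q_def le_imp_inverse_le)
  define r where "r = K / \<epsilon>"
  have r: "r > 0" using \<epsilon> by (simp add: r_def)
  have ratio: "- FD t \<le> r * FX t" "- FD t \<le> r * FY t" if "t \<in> J" "t \<le> t1" for t
  proof -
    have "- FD t \<le> r * (\<epsilon> * (D t)\<^sup>2)" using FD[OF that] \<epsilon> by (simp add: r_def)
    moreover have "r * (\<epsilon> * (D t)\<^sup>2) \<le> r * FX t" "r * (\<epsilon> * (D t)\<^sup>2) \<le> r * FY t"
      using r FX[OF that] FY[OF that] by (auto intro!: mult_left_mono)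
    ultimately show "- FD t \<le> r * FX t" "- FD t \<le> r * FY t" by linarith+
  qed
  \<comment> \<open>\<open>ln Z + r * ln D\<close> does not decrease backward in time, so
    \<open>Z\<close> can approach 0 only if \<open>D\<close> is unbounded.\<close>
  have lower: "ln (Z t1) + r * (ln (D t1) - ln (D t)) \<le> ln (Z t)"
    if Z: "\<And>t. t \<in> J \<Longrightarrow> t \<le> t1 \<Longrightarrow> 0 < Z t"
      and dZ: "\<And>t. t \<in> J \<Longrightarrow> t \<le> t1 \<Longrightarrow> (Z has_real_derivative - (h t * Z t * G t * FD t)) (at t)"
      and G: "\<And>t. t \<in> J \<Longrightarrow> t \<le> t1 \<Longrightarrow> 0 \<le> G t \<and> - FD t * G t \<le> r * FX t * FY t"
      and t: "t \<in> J" "t \<le> t1"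
    for Z G t
  proof -
    have "- (ln (Z t) + r * ln (D t)) \<le> - (ln (Z t1) + r * ln (D t1))"
    proof (rule deriv_mono[OF t(1) t1 t(2)])
      fix s assume s: "s \<in> J" "s \<le> t1"
      show "((\<lambda>t. - (ln (Z t) + r * ln (D t))) has_real_derivative h s * (G s * FD s + r * FX s * FY s)) (at s)"
        using pos[OF s] Z[OF s]
        by (auto intro!: derivative_eq_intros dD[OF s] dZ[OF s] simp: field_simps)
      show "0 \<le> h s * (G s * FD s + r * FX s * FY s)"
        using h[OF s] G[OF s] by (intro mult_nonneg_nonneg) (auto simp: algebra_simps)
    qed
    then show ?thesis by (simp add: algebra_simps)
  qed
  \<comment> \<open>If \<open>D\<close> were bounded, \<open>X\<close> and \<open>Y\<close> would
    stay away from 0 and the whole solution would lie in a box, contradicting \<open>escape\<close>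
    and \<open>bdd\<close>.\<close>
  have unbounded: "\<exists>t\<in>J. t \<le> t1 \<and> M < D t" for M
  proof (rule ccontr)
    assume "\<not> ?thesis"
    then have le: "D t \<le> M" if "t \<in> J" "t \<le> t1" for t using that by force
    have ln_le: "ln (D t) \<le> ln M" if "t \<in> J" "t \<le> t1" for t
      using le[OF that] pos[OF that] by simp
    define x where "x = exp (ln (X t1) + r * (ln (D t1) - ln M))"
    define y where "y = exp (ln (Y t1) + r * (ln (D t1) - ln M))"
    have xy: "x \<le> X t" "y \<le> Y t" if t: "t \<in> J" "t \<le> t1" for t
    proof -
      have "ln (X t1) + r * (ln (D t1) - ln M) \<le> ln (X t1) + r * (ln (D t1) - ln (D t))"
        "ln (Y t1) + r * (ln (D t1) - ln M) \<le> ln (Y t1) + r * (ln (D t1) - ln (D t))"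
        using ln_le[OF t] r by (auto intro!: mult_left_mono)
      moreover have "ln (X t1) + r * (ln (D t1) - ln (D t)) \<le> ln (X t)"
      proof (rule lower[where G = FY])
        show "0 \<le> FY t \<and> - FD t * FY t \<le> r * FX t * FY t" if "t \<in> J" "t \<le> t1" for t
          using F[OF that] mult_right_mono[OF ratio(1)[OF that], of "FY t"] by auto
      qed (use pos dX t in auto)
      moreover have "ln (Y t1) + r * (ln (D t1) - ln (D t)) \<le> ln (Y t)"
      proof (rule lower[where G = FX])
        show "0 \<le> FX t \<and> - FD t * FX t \<le> r * FX t * FY t" if "t \<in> J" "t \<le> t1" for t
          using F[OF that] mult_right_mono[OF ratio(2)[OF that], of "FX t"] by (auto simp: algebra_simps)
        show "(Y has_real_derivative - (h t * Y t * FX t * FD t)) (at t)" if "t \<in> J" "t \<le> t1" for t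
          using dY[OF that] by (simp add: mult.commute mult.left_commute)
      qed (use pos t in auto)
      ultimately have "ln x \<le> ln (X t)" "ln y \<le> ln (Y t)" by (auto simp: x_def y_def)
      then show "x \<le> X t" "y \<le> Y t" using pos[OF t] by (simp_all add: x_def y_def ln_ge_iff)
    qed
    define m where "m = min (D t1) (min x y)"
    define N where "N = max (max M (D t1)) (max (X t1) (Y t1))"
    have "\<not> bdd_below J"
    proof (rule escape[of m N])
      show "0 < m" using p1 by (simp add: m_def x_def y_def)
      show "m \<le> N" by (auto simp: m_def N_def)
      show "D t \<in> {m..N} \<and> X t \<in> {m..N} \<and> Y t \<in> {m..N}" if t: "t \<in> J" "t \<le> t1" for t
        using D_mono[OF t(1) t1 t(2)] X_mono[OF t(1) t1 t(2)] Y_mono[OF t(1) t1 t(2)] le[OF t] xy[OF t]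
        by (auto simp: m_def N_def)
    qed
    with bdd show False by simp
  qed
  have q0: "(q \<longlongrightarrow> 0) (backward J)"
  proof (rule order_tendstoI)
    fix a :: real assume "a < 0"
    then show "\<forall>\<^sub>F t in backward J. a < q t"
      using q by (intro eventually_backward_le[OF t1]) (meson less_trans)
  next
    fix a :: real assume "0 < a"
    obtain t where t: "t \<in> J" "t \<le> t1" "inverse a < D t" using unbounded by blast
    show "\<forall>\<^sub>F t in backward J. q t < a"
    proof (rule eventually_backward_le[OF t(1)])
      fix s assume "s \<in> J" "s \<le> t"
      then have "inverse a < D s" using D_mono[of s t] t by simp
      then show "q s < a" using \<open>0 < a\<close> unfolding q_def
        by (metis inverse_inverse_eq inverse_positive_iff_positive less_imp_inverse_less)
    qed
  qed
  txt \<open>The derivative of \<open>ln X + 3 ln D\<close> is dominated by that of \<open>1 / D\<close>, so \<open>X D\<^sup>3\<close> converges.\<close>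
  define c2 where "c2 = 4 * K * (X t1 + Y t1)"
  have approx_q: "\<bar>FX t / (D t)\<^sup>2 - 1\<bar> \<le> K * (X t1 + Y t1) * q t"
    "\<bar>FY t / (D t)\<^sup>2 - 1\<bar> \<le> K * (X t1 + Y t1) * q t"
    "\<bar>FD t + 3 * FX t\<bar> \<le> c2 * D t" "\<bar>FD t + 3 * FY t\<bar> \<le> c2 * D t" if t: "t \<in> J" "t \<le> t1" for t
  proof -
    have D: "D t > 0" using pos[OF t] by simp
    have le: "K * D t * (X t + Y t) \<le> K * D t * (X t1 + Y t1)"
      using D \<epsilon> X_mono[OF t(1) t1 t(2)] Y_mono[OF t(1) t1 t(2)] by (intro mult_left_mono) auto
    have ap: "\<bar>FX t - (D t)\<^sup>2\<bar> \<le> K * D t * (X t1 + Y t1)" "\<bar>FY t - (D t)\<^sup>2\<bar> \<le> K * D t * (X t1 + Y t1)"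
      "\<bar>FD t + 3 * (D t)\<^sup>2\<bar> \<le> K * D t * (X t1 + Y t1)"
      using approx[OF t] le by linarith+
    have gen: "\<bar>G / (D t)\<^sup>2 - 1\<bar> \<le> K * (X t1 + Y t1) * q t"
      if "\<bar>G - (D t)\<^sup>2\<bar> \<le> K * D t * (X t1 + Y t1)" for G
    proof -
      have "G / (D t)\<^sup>2 - 1 = (G - (D t)\<^sup>2) / (D t)\<^sup>2"
        using D by (simp add: diff_divide_distrib)
      then have "\<bar>G / (D t)\<^sup>2 - 1\<bar> = \<bar>G - (D t)\<^sup>2\<bar> / (D t)\<^sup>2" by (simp add: abs_divide)
      also have "\<dots> \<le> K * D t * (X t1 + Y t1) / (D t)\<^sup>2" using that by (intro divide_right_mono) auto
      also have "\<dots> = K * (X t1 + Y t1) * q t" using D by (simp add: q_def field_simps power2_eq_square)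
      finally show ?thesis .
    qed
    show "\<bar>FX t / (D t)\<^sup>2 - 1\<bar> \<le> K * (X t1 + Y t1) * q t" "\<bar>FY t / (D t)\<^sup>2 - 1\<bar> \<le> K * (X t1 + Y t1) * q t"
      using gen ap by auto
    have "c2 * D t = 4 * (K * D t * (X t1 + Y t1))" by (simp add: c2_def)
    then show "\<bar>FD t + 3 * FX t\<bar> \<le> c2 * D t" "\<bar>FD t + 3 * FY t\<bar> \<le> c2 * D t" using ap by linarith+
  qed
  have limit: "\<exists>\<xi>>0. ((\<lambda>t. Z t * D t ^ 3) \<longlongrightarrow> \<xi>) (backward J)"
    if Z: "\<And>t. t \<in> J \<Longrightarrow> t \<le> t1 \<Longrightarrow> 0 < Z t"
      and dZ: "\<And>t. t \<in> J \<Longrightarrow> t \<le> t1 \<Longrightarrow> (Z has_real_derivative - (h t * Z t * G t * FD t)) (at t)"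
      and G: "\<And>t. t \<in> J \<Longrightarrow> t \<le> t1 \<Longrightarrow> 0 < G t \<and> \<epsilon> * (D t)\<^sup>2 \<le> H t \<and> FX t * FY t = G t * H t
          \<and> \<bar>FD t + 3 * H t\<bar> \<le> c2 * D t"
    for Z G H
  proof -
    obtain l where l: "((\<lambda>t. ln (Z t) + 3 * ln (D t)) \<longlongrightarrow> l) (backward J)"
    proof (rule dominated_derivative_tendsto[OF t1])
      fix t assume t: "t \<in> J" "t \<le> t1"
      show "((\<lambda>t. ln (Z t) + 3 * ln (D t)) has_real_derivative - (h t * G t * (FD t + 3 * H t))) (at t)"
        using pos[OF t] Z[OF t] G[OF t]
        by (auto intro!: derivative_eq_intros dD[OF t] dZ[OF t] simp: field_simps)
      show "((\<lambda>t. c2 / \<epsilon> * q t) has_real_derivative c2 / \<epsilon> * (h t * FX t * FY t * q t)) (at t)"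
        by (rule DERIV_cmult[OF dq[OF t]])
      have c2: "c2 \<ge> 0" using \<epsilon> p1 by (simp add: c2_def)
      have D: "D t > 0" using pos[OF t] by simp
      have "\<bar>- (h t * G t * (FD t + 3 * H t))\<bar> = h t * G t * \<bar>FD t + 3 * H t\<bar>"
        using h[OF t] G[OF t] by (simp add: abs_mult)
      also have "\<dots> \<le> h t * G t * (c2 * D t)"
        using h[OF t] G[OF t] by (intro mult_left_mono) auto
      also have "\<dots> = c2 / \<epsilon> * (h t * G t * (\<epsilon> * (D t)\<^sup>2) * q t)"
        using \<epsilon> D by (simp add: q_def power2_eq_square)
      also have "\<dots> \<le> c2 / \<epsilon> * (h t * G t * H t * q t)"
        using h[OF t] G[OF t] c2 \<epsilon> q[OF t] by (intro mult_left_mono mult_right_mono) auto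
      also have "\<dots> = c2 / \<epsilon> * (h t * FX t * FY t * q t)"
        using G[OF t] by (simp add: mult.assoc)
      finally show "\<bar>- (h t * G t * (FD t + 3 * H t))\<bar> \<le> c2 / \<epsilon> * (h t * FX t * FY t * q t)" .
      show "0 \<le> c2 / \<epsilon> * q t" using c2 \<epsilon> q[OF t] by simp
    qed
    have "((\<lambda>t. exp (ln (Z t) + 3 * ln (D t))) \<longlongrightarrow> exp l) (backward J)" by (intro tendsto_exp l)
    moreover have "\<forall>\<^sub>F t in backward J. exp (ln (Z t) + 3 * ln (D t)) = Z t * D t ^ 3"
    proof (rule eventually_backward_le[OF t1])
      fix t assume t: "t \<in> J" "t \<le> t1"
      have "exp (3 * ln (D t)) = D t ^ 3" using pos[OF t] by (simp add: exp_of_nat_mult[of 3, simplified])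
      then show "exp (ln (Z t) + 3 * ln (D t)) = Z t * D t ^ 3" using Z[OF t] by (simp add: exp_add)
    qed
    ultimately have "((\<lambda>t. Z t * D t ^ 3) \<longlongrightarrow> exp l) (backward J)" by (rule Lim_transform_eventually)
    then show ?thesis by (intro exI[of _ "exp l"]) simp
  qed
  obtain \<xi> where \<xi>: "\<xi> > 0" "((\<lambda>t. X t * D t ^ 3) \<longlongrightarrow> \<xi>) (backward J)"
    using limit[of X FY FX] pos dX F FX approx_q by (auto simp: mult.commute)
  obtain \<upsilon> where \<upsilon>: "\<upsilon> > 0" "((\<lambda>t. Y t * D t ^ 3) \<longlongrightarrow> \<upsilon>) (backward J)"
  proof -
    have "(Y has_real_derivative - (h t * Y t * FX t * FD t)) (at t)" if "t \<in> J" "t \<le> t1" for t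
      using dY[OF that] by (simp add: mult.commute mult.left_commute)
    then show thesis using limit[of Y FX FY] pos F FY approx_q that by auto
  qed
  define a where "a = Inf J"
  have ba: "backward J = at_right a" unfolding a_def by (rule backward_eq_at_right[OF bdd])
  \<comment> \<open>The derivative of \<open>D^(-14)\<close> is \<open>28 * FX * FY\<close> divided
    by \<open>D^4 * (X * D^3)^2 * (Y * D^3)^2\<close>. As \<open>FX\<close> and \<open>FY\<close>
    are asymptotic to \<open>D^2\<close>, it tends to \<open>\<kappa>\<close>.\<close>
  define \<kappa> where "\<kappa> = 28 * 1 * 1 / (\<xi>\<^sup>2 * \<upsilon>\<^sup>2)"
  have \<kappa>: "\<kappa> > 0" using \<xi> \<upsilon> by (simp add: \<kappa>_def)
  define w where "w t = q t ^ 14" for t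
  define w' where "w' t = 28 * (FX t / (D t)\<^sup>2) * (FY t / (D t)\<^sup>2) / ((X t * D t ^ 3)\<^sup>2 * (Y t * D t ^ 3)\<^sup>2)" for t
  have one: "((\<lambda>t. G t / (D t)\<^sup>2) \<longlongrightarrow> 1) (backward J)"
    if "\<And>t. t \<in> J \<Longrightarrow> t \<le> t1 \<Longrightarrow> \<bar>G t / (D t)\<^sup>2 - 1\<bar> \<le> K * (X t1 + Y t1) * q t" for G
  proof -
    have "((\<lambda>t. K * (X t1 + Y t1) * q t) \<longlongrightarrow> K * (X t1 + Y t1) * 0) (backward J)"
      by (intro tendsto_intros q0)
    then have lim0: "((\<lambda>t. K * (X t1 + Y t1) * q t) \<longlongrightarrow> 0) (backward J)" by simp
    have "\<forall>\<^sub>F t in backward J. norm (G t / (D t)\<^sup>2 - 1) \<le> K * (X t1 + Y t1) * q t"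
      by (rule eventually_backward_le[OF t1]) (use that in auto)
    from Lim_null_comparison[OF this lim0]
    have "((\<lambda>t. G t / (D t)\<^sup>2 - 1) \<longlongrightarrow> 0) (backward J)" .
    then show ?thesis by (simp add: LIM_zero_iff)
  qed
  have "(w' \<longlongrightarrow> \<kappa>) (backward J)"
    unfolding w'_def \<kappa>_def
    by (intro tendsto_intros one approx_q \<xi> \<upsilon>) (use \<xi>(1) \<upsilon>(1) in auto)
  moreover have "(w \<longlongrightarrow> 0 ^ 14) (backward J)"
    unfolding w_def by (intro tendsto_intros q0)
  moreover have "\<forall>\<^sub>F t in backward J. (w has_real_derivative w' t) (at t)"
  proof (rule eventually_backward_le[OF t1])
    fix t assume t: "t \<in> J" "t \<le> t1"
    have "(w has_real_derivative of_nat 14 * (h t * FX t * FY t * q t) * q t ^ (14 - Suc 0)) (at t)"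
      unfolding w_def by (rule DERIV_power[OF dq[OF t], THEN DERIV_cong]) (simp add: mult_ac)
    also have "of_nat 14 * (h t * FX t * FY t * q t) * q t ^ (14 - Suc 0) = w' t"
      using pos[OF t] unfolding w'_def h_def q_def
      by (simp add: field_simps eval_nat_numeral)
    finally show "(w has_real_derivative w' t) (at t)" .
  qed
  ultimately have lim: "((\<lambda>t. w t / (t - a)) \<longlongrightarrow> \<kappa>) (at_right a)"
    unfolding ba by (intro tendsto_quotient_at_right) auto
  have wpos: "\<forall>\<^sub>F t in at_right a. 0 < w t"
    unfolding ba[symmetric] w_def by (rule eventually_backward_le[OF t1]) (rule zero_less_power[OF q(1)])
  have w_powr: "w t powr (n / 14) = q t powr n" if "t \<in> J" "t \<le> t1" for t n
  proof -
    have "w t = q t powr 14" using q[OF that] by (simp add: w_def powr_numeral)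
    then show ?thesis by (simp add: powr_powr)
  qed
  have "D \<sim>[at_right a] (\<lambda>t. 1 * \<kappa> powr (- 1 / 14) * (t - a) powr (- 1 / 14))"
  proof (rule asymp_equiv_powr_at_right[OF lim \<kappa> wpos])
    have "\<forall>\<^sub>F t in backward J. 1 = D t * w t powr (- (- 1 / 14))"
    proof (rule eventually_backward_le[OF t1])
      fix t assume t: "t \<in> J" "t \<le> t1"
      show "1 = D t * w t powr (- (- 1 / 14))"
        using w_powr[OF t, of 1] q[OF t] pos[OF t] by (simp add: q_def)
    qed
    then show "((\<lambda>t. D t * w t powr (- (- 1 / 14))) \<longlongrightarrow> 1) (at_right a)"
      unfolding ba by (rule Lim_transform_eventually[OF tendsto_const])
  qed simp
  moreover have "Z \<sim>[at_right a] (\<lambda>t. \<zeta> * \<kappa> powr (3 / 14) * (t - a) powr (3 / 14))"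
    if Z: "((\<lambda>t. Z t * D t ^ 3) \<longlongrightarrow> \<zeta>) (backward J)" "\<zeta> > 0" for Z \<zeta>
  proof (rule asymp_equiv_powr_at_right[OF lim \<kappa> wpos _ Z(2)])
    have "\<forall>\<^sub>F t in backward J. Z t * D t ^ 3 = Z t * w t powr (- (3 / 14))"
    proof (rule eventually_backward_le[OF t1])
      fix t assume t: "t \<in> J" "t \<le> t1"
      show "Z t * D t ^ 3 = Z t * w t powr (- (3 / 14))"
        using w_powr[OF t, of "-3"] q[OF t] pos[OF t]
        by (simp add: q_def powr_minus powr_numeral power_inverse)
    qed
    then show "((\<lambda>t. Z t * w t powr (- (3 / 14))) \<longlongrightarrow> \<zeta>) (at_right a)"
      using Z(1) unfolding ba by (rule Lim_transform_eventually[rotated])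
  qed
  ultimately have "D \<sim>[at_right a] (\<lambda>t. \<kappa> powr (- 1 / 14) * (t - a) powr (- 1 / 14))"
    "X \<sim>[at_right a] (\<lambda>t. \<xi> * \<kappa> powr (3 / 14) * (t - a) powr (3 / 14))"
    "Y \<sim>[at_right a] (\<lambda>t. \<upsilon> * \<kappa> powr (3 / 14) * (t - a) powr (3 / 14))"
    using \<xi> \<upsilon> by auto
  then show ?thesis
    using bdd \<kappa> \<xi>(1) \<upsilon>(1) unfolding a_def
    by (intro conjI exI[of _ "\<kappa> powr (- 1 / 14)"] exI[of _ "\<xi> * \<kappa> powr (3 / 14)"]
        exI[of _ "\<upsilon> * \<kappa> powr (3 / 14)"]) auto
qed

end

section \<open>Dynamics of the flow backward in time\<close>

lemma F1_eq: "F1 a b c = (b - c)\<^sup>2 - 3 * a\<^sup>2 - 2 * a * (b + c)"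
  by (simp add: F1_def power2_eq_square algebra_simps)

lemma F2_eq: "F2 a b c = a\<^sup>2 - (b - c) * (3 * b + c) - 2 * a * (b - c)"
  by (simp add: F2_def power2_eq_square algebra_simps)

lemma F3_eq: "F3 a b c = a\<^sup>2 + (b - c) * (b + 3 * c) + 2 * a * (b - c)"
  by (simp add: F3_def power2_eq_square algebra_simps)

lemma F3_ge:
  assumes "0 < a" "0 < c" "c < b"
  shows "a\<^sup>2 \<le> F3 a b c" "0 < F3 a b c"
proof -
  have "0 \<le> (b - c) * (b + 3 * c)" "0 \<le> 2 * a * (b - c)" using assms by auto
  then show "a\<^sup>2 \<le> F3 a b c" unfolding F3_eq by linarith
  moreover have "0 < a\<^sup>2" using assms by simp
  ultimately show "0 < F3 a b c" by linarith
qed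

text \<open>\<open>F1 \<ge> 0\<close> forces \<open>b - c > a\<close>, whereas
  \<open>F2 \<ge> 0\<close> would force \<open>(b - c) * (3 * b + c) \<le> a^2\<close> and hence
  \<open>b - c \<le> a\<close>. So the two regions that lead to domination are disjoint.\<close>

lemma F1_nonneg_F2_neg:
  assumes "0 < a" "0 < c" "c < b" "0 \<le> F1 a b c"
  shows "F2 a b c < 0"
proof -
  have "(b - c)\<^sup>2 \<ge> 3 * a\<^sup>2 + 2 * a * (b + c)" using assms(4) unfolding F1_eq by simp
  moreover have "0 < a\<^sup>2" "0 < 2 * a * (b + c)" using assms by auto
  ultimately have "a\<^sup>2 < (b - c)\<^sup>2" by linarith
  also have "\<dots> \<le> (b - c) * (3 * b + c)" using assms unfolding power2_eq_square by (intro mult_left_mono) auto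
  finally have "a\<^sup>2 < (b - c) * (3 * b + c)" .
  moreover have "0 \<le> 2 * a * (b - c)" using assms by simp
  ultimately show ?thesis unfolding F2_eq by linarith
qed

text \<open>Maximality enters only as \<open>escape\<close>: if the left end is finite, no box
  contains the solution at all earlier times.\<close>

locale xcf_backward = down_interval +
  fixes A B C :: "real \<Rightarrow> real"
  assumes sol: "xcf_solution_on J A B C"
    and CB: "\<And>t. t \<in> J \<Longrightarrow> C t < B t"
    and escape: "\<And>t1 m M. t1 \<in> J \<Longrightarrow> 0 < m \<Longrightarrow> m \<le> M \<Longrightarrow> (\<And>t. t \<in> J \<Longrightarrow> t \<le> t1 \<Longrightarrow>
      A t \<in> {m..M} \<and> B t \<in> {m..M} \<and> C t \<in> {m..M}) \<Longrightarrow> \<not> bdd_below J"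
begin

definition f1 :: "real \<Rightarrow> real" where "f1 t = F1 (A t) (B t) (C t)"
definition f2 :: "real \<Rightarrow> real" where "f2 t = F2 (A t) (B t) (C t)"
definition f3 :: "real \<Rightarrow> real" where "f3 t = F3 (A t) (B t) (C t)"
definition h :: "real \<Rightarrow> real" where "h t = 2 / (A t * B t * C t)\<^sup>2"

lemma pos: "0 < A t" "0 < B t" "0 < C t" "0 < h t" if "t \<in> J"
  using sol that unfolding xcf_solution_on_def h_def by auto

lemma
  assumes "t \<in> J"
  shows dA: "(A has_real_derivative - (h t * A t * f2 t * f3 t)) (at t)"
    and dB: "(B has_real_derivative - (h t * B t * f3 t * f1 t)) (at t)"
    and dC: "(C has_real_derivative - (h t * C t * f1 t * f2 t)) (at t)"
  using sol assms unfolding xcf_solution_on_def h_def f1_def f2_def f3_def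
  by (auto simp: mult_ac)

lemma f3_pos: "0 < f3 t" "(A t)\<^sup>2 \<le> f3 t" if "t \<in> J"
  unfolding f3_def using F3_ge pos[OF that] CB[OF that] by auto

lemma f1_neg: "f1 t < 0" if "t \<in> J" "0 \<le> f2 t"
  using F1_nonneg_F2_neg[of "A t" "C t" "B t"] pos[OF that(1)] CB[OF that(1)] that unfolding f1_def f2_def
  by force

lemma f2_neg: "f2 t < 0" if "t \<in> J" "0 \<le> f1 t"
  using F1_nonneg_F2_neg[of "A t" "C t" "B t"] pos[OF that(1)] CB[OF that(1)] that unfolding f1_def f2_def
  by force

lemma df1:
  assumes "t \<in> J"
  shows "(f1 has_real_derivative (- 6 * A t - 2 * C t - 2 * B t) * - (h t * A t * f2 t * f3 t)
    + (2 * B t - 2 * C t - 2 * A t) * - (h t * B t * f3 t * f1 t)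
    + (2 * C t - 2 * B t - 2 * A t) * - (h t * C t * f1 t * f2 t)) (at t)"
proof -
  have "f1 = (\<lambda>t. - 3 * (A t)\<^sup>2 + (B t)\<^sup>2 + (C t)\<^sup>2 - 2 * B t * C t - 2 * A t * C t - 2 * A t * B t)"
    by (simp add: fun_eq_iff f1_def F1_def)
  then show ?thesis
    by (auto intro!: derivative_eq_intros dA dB dC assms) (simp add: algebra_simps)
qed

lemma df2:
  assumes "t \<in> J"
  shows "(f2 has_real_derivative (2 * A t + 2 * C t - 2 * B t) * - (h t * A t * f2 t * f3 t)
    + (- 6 * B t + 2 * C t - 2 * A t) * - (h t * B t * f3 t * f1 t)
    + (2 * C t + 2 * B t + 2 * A t) * - (h t * C t * f1 t * f2 t)) (at t)"
proof -
  have "f2 = (\<lambda>t. - 3 * (B t)\<^sup>2 + (A t)\<^sup>2 + (C t)\<^sup>2 + 2 * B t * C t + 2 * A t * C t - 2 * A t * B t)"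
    by (simp add: fun_eq_iff f2_def F2_def)
  then show ?thesis
    by (auto intro!: derivative_eq_intros dA dB dC assms) (simp add: algebra_simps)
qed

lemma backward_barrier:
  assumes "t0 \<in> J" "t \<in> J" "t < t0" "0 \<le> g t0"
    and g: "\<And>s. s \<in> J \<Longrightarrow> (g has_real_derivative g' s) (at s)"
    and neg: "\<And>s. s \<in> J \<Longrightarrow> g s = 0 \<Longrightarrow> g' s < 0"
  shows "0 < g t"
proof -
  have "0 < g (- (- t))"
  proof (rule barrier_pos[of "- t0" "- t" "\<lambda>s. g (- s)" "\<lambda>s. - g' (- s)"])
    fix s assume s: "s \<in> {- t0..- t}"
    then have "- s \<in> J" using ivl[OF assms(2,1), of "- s"] by auto
    show "((\<lambda>s. g (- s)) has_real_derivative - g' (- s)) (at s within {- t0..- t})"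
      using DERIV_chain2[OF g[OF \<open>- s \<in> J\<close>] DERIV_minus[OF DERIV_ident]] by simp
    show "g (- s) = 0 \<Longrightarrow> 0 < - g' (- s)" using neg[OF \<open>- s \<in> J\<close>] by simp
  qed (use assms in auto)
  then show ?thesis by simp
qed

text \<open>Where \<open>f2\<close> vanishes, only the term of its derivative coming from
  \<open>B'\<close> survives, and it is negative because \<open>f1 < 0\<close> there. For
  \<open>f1\<close> in \<open>f1_pos_backward\<close> the term from \<open>A'\<close> plays the same
  role.\<close>

lemma f2_pos_backward:
  assumes "t0 \<in> J" "0 \<le> f2 t0" "t \<in> J" "t < t0"
  shows "0 < f2 t"
proof (rule backward_barrier[OF assms(1,3,4,2) df2])
  fix s assume s: "s \<in> J" "f2 s = 0"
  have "f1 s < 0" using f1_neg s by simp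
  then have "0 < h s * B s * f3 s * - f1 s" using pos[OF s(1)] f3_pos[OF s(1)] by (intro mult_pos_pos) auto
  moreover have "- 6 * B s + 2 * C s - 2 * A s < 0" using pos[OF s(1)] CB[OF s(1)] by simp
  ultimately have "(- 6 * B s + 2 * C s - 2 * A s) * (h s * B s * f3 s * - f1 s) < 0"
    by (rule mult_neg_pos[rotated])
  then show "(2 * A s + 2 * C s - 2 * B s) * - (h s * A s * f2 s * f3 s)
    + (- 6 * B s + 2 * C s - 2 * A s) * - (h s * B s * f3 s * f1 s)
    + (2 * C s + 2 * B s + 2 * A s) * - (h s * C s * f1 s * f2 s) < 0" using s by simp
qed

lemma f1_pos_backward:
  assumes "t0 \<in> J" "0 \<le> f1 t0" "t \<in> J" "t < t0"
  shows "0 < f1 t"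
proof (rule backward_barrier[OF assms(1,3,4,2) df1])
  fix s assume s: "s \<in> J" "f1 s = 0"
  have "f2 s < 0" using f2_neg s by simp
  then have "0 < h s * A s * - f2 s * f3 s" using pos[OF s(1)] f3_pos[OF s(1)] by (intro mult_pos_pos) auto
  moreover have "- 6 * A s - 2 * C s - 2 * B s < 0" using pos[OF s(1)] by simp
  ultimately have "(- 6 * A s - 2 * C s - 2 * B s) * (h s * A s * - f2 s * f3 s) < 0"
    by (rule mult_neg_pos[rotated])
  then show "(- 6 * A s - 2 * C s - 2 * B s) * - (h s * A s * f2 s * f3 s)
    + (2 * B s - 2 * C s - 2 * A s) * - (h s * B s * f3 s * f1 s)
    + (2 * C s - 2 * B s - 2 * A s) * - (h s * C s * f1 s * f2 s) < 0" using s by simp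
qed

text \<open>\<open>dominance\<close> is applied with \<open>D = A\<close>. Positivity of
  \<open>f2\<close> has to be improved to a lower bound by a multiple of \<open>A^2\<close>, which
  the degree two homogeneity of \<open>F2\<close> provides.\<close>

lemma case1_asymptotics:
  assumes "t0 \<in> J" "0 \<le> f2 t0"
  shows "bdd_below J \<and> (\<exists>\<eta>1>0. \<exists>\<eta>2>0. \<exists>\<eta>3>0.
    A \<sim>[at_right (Inf J)] (\<lambda>t. \<eta>1 * (t - Inf J) powr (- 1 / 14)) \<and>
    B \<sim>[at_right (Inf J)] (\<lambda>t. \<eta>2 * (t - Inf J) powr (3 / 14)) \<and>
    C \<sim>[at_right (Inf J)] (\<lambda>t. \<eta>3 * (t - Inf J) powr (3 / 14)))"
proof -
  obtain t1 where t1: "t1 \<in> J" "t1 < t0" using below[OF assms(1)] by blast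
  have f2: "0 < f2 t" and f1: "f1 t < 0" if "t \<in> J" "t \<le> t1" for t
  proof -
    show "0 < f2 t" using f2_pos_backward[OF assms that(1)] that(2) t1(2) by simp
    then show "f1 t < 0" using f1_neg that by simp
  qed
  have mono: "A t1 \<le> A t \<and> B t \<le> B t1 \<and> C t \<le> C t1 \<and> B t - C t \<le> B t1 - C t1" if t: "t \<in> J" "t \<le> t1" for t
  proof (intro conjI)
    have "- A t \<le> - A t1"
    proof (rule deriv_mono[OF t(1) t1(1) t(2)])
      fix r assume r: "r \<in> J" "r \<le> t1"
      show "((\<lambda>t. - A t) has_real_derivative h r * A r * f2 r * f3 r) (at r)"
        using DERIV_minus[OF dA[OF r(1)]] by simp
      show "0 \<le> h r * A r * f2 r * f3 r" using pos[OF r(1)] f2[OF r] f3_pos[OF r(1)] by simp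
    qed
    then show "A t1 \<le> A t" by simp
    show "B t \<le> B t1"
    proof (rule deriv_mono[OF t(1) t1(1) t(2) dB])
      fix r assume r: "r \<in> J" "r \<le> t1"
      show "0 \<le> - (h r * B r * f3 r * f1 r)"
        using pos[OF r(1)] f1[OF r] f3_pos[OF r(1)] by (simp add: mult_nonneg_nonpos)
    qed
    show "C t \<le> C t1"
    proof (rule deriv_mono[OF t(1) t1(1) t(2) dC])
      fix r assume r: "r \<in> J" "r \<le> t1"
      show "0 \<le> - (h r * C r * f1 r * f2 r)"
        using pos[OF r(1)] f1[OF r] f2[OF r] by (simp add: mult_nonneg_nonpos mult_nonpos_nonneg)
    qed
    \<comment> \<open>Monotonicity of \<open>B\<close> and of \<open>C\<close> does not control
      their difference, which enters \<open>f2\<close> with a negative sign.\<close>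
    show "B t - C t \<le> B t1 - C t1"
    proof (rule deriv_mono[OF t(1) t1(1) t(2) DERIV_diff[OF dB dC]])
      fix r assume r: "r \<in> J" "r \<le> t1"
      have "f3 r - f2 r = 4 * (B r - C r) * (A r + B r + C r)"
        by (simp add: f3_def f2_def F3_eq F2_eq algebra_simps)
      also have "\<dots> \<ge> 0" using pos[OF r(1)] CB[OF r(1)] by simp
      finally have "C r * f2 r \<le> B r * f3 r"
        using pos[OF r(1)] CB[OF r(1)] f2[OF r] by (intro mult_mono) auto
      then have "0 \<le> h r * - f1 r * (B r * f3 r - C r * f2 r)"
        using pos[OF r(1)] f1[OF r] by (intro mult_nonneg_nonneg) auto
      also have "\<dots> = - (h r * B r * f3 r * f1 r) - - (h r * C r * f1 r * f2 r)"
        by (simp add: algebra_simps)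
      finally show "0 \<le> - (h r * B r * f3 r * f1 r) - - (h r * C r * f1 r * f2 r)" .
    qed
  qed
  \<comment> \<open>Backward in time \<open>A\<close> grows by a factor
    \<open>\<rho> \<ge> 1\<close>, while \<open>B\<close>, \<open>C\<close> and \<open>B - C\<close>
    shrink. As \<open>F2\<close> is a quadratic form, \<open>f2 t \<ge> \<rho>^2 * f2 t1\<close>,
    which is \<open>e * (A t)^2\<close>; likewise \<open>\<beta>\<close> bounds
    \<open>(B + C) / A\<close> at all earlier times.\<close>
  define e where "e = f2 t1 / (A t1)\<^sup>2"
  define \<beta> where "\<beta> = (B t1 + C t1) / A t1"
  define K where "K = 3 + 3 * \<beta>"
  have p1: "0 < A t1" "0 < B t1" "0 < C t1" "C t1 < B t1" using pos[OF t1(1)] CB[OF t1(1)] by auto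
  have e: "0 < e" using f2[OF t1(1)] p1 by (simp add: e_def)
  have \<beta>: "0 < \<beta>" using p1 by (simp add: \<beta>_def)
  have bounds: "e * (A t)\<^sup>2 \<le> f2 t" "f2 t \<le> (A t)\<^sup>2" "2 * (A t)\<^sup>2 \<le> - f1 t" "- f1 t \<le> K * (A t)\<^sup>2"
    "\<bar>f2 t - (A t)\<^sup>2\<bar> \<le> K * A t * (B t + C t)" "\<bar>f3 t - (A t)\<^sup>2\<bar> \<le> K * A t * (B t + C t)"
    "\<bar>f1 t + 3 * (A t)\<^sup>2\<bar> \<le> K * A t * (B t + C t)" if t: "t \<in> J" "t \<le> t1" for t
  proof -
    define a b c d where "a = A t" and "b = B t" and "c = C t" and "d = B t - C t"
    have p: "0 < a" "0 < b" "0 < c" "0 < d" "b = c + d"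
      using pos[OF t(1)] CB[OF t(1)] by (auto simp: a_def b_def c_def d_def)
    have F: "f1 t = d\<^sup>2 - 3 * a\<^sup>2 - 2 * a * (b + c)" "f2 t = a\<^sup>2 - d * (3 * b + c) - 2 * a * d"
      "f3 t = a\<^sup>2 + d * (b + 3 * c) + 2 * a * d"
      by (simp_all add: f1_def f2_def f3_def F1_eq F2_eq F3_eq a_def b_def c_def d_def)
    define \<rho> where "\<rho> = a / A t1"
    have \<rho>: "1 \<le> \<rho>" "a = \<rho> * A t1" using mono[OF t] p1 by (auto simp: \<rho>_def a_def)
    have bc: "b + c \<le> \<beta> * a"
    proof -
      have "b + c \<le> B t1 + C t1" using mono[OF t] by (simp add: b_def c_def)
      also have "\<dots> = \<beta> * A t1" using p1 by (simp add: \<beta>_def)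
      also have "\<dots> \<le> \<beta> * a" using mono[OF t] \<beta> by (simp add: a_def)
      finally show ?thesis .
    qed
    have quad: "x * y \<le> \<beta> * (a * (b + c))" if "0 \<le> x" "x \<le> b + c" "0 \<le> y" "y \<le> b + c" for x y
    proof -
      have "x * y \<le> (b + c) * (\<beta> * a)" using that bc by (intro mult_mono) auto
      then show ?thesis by (simp add: mult_ac)
    qed
    have a_bc: "0 \<le> a * (b + c)" "0 \<le> \<beta> * (a * (b + c))" using p \<beta> by auto
    have ad: "a * d \<le> a * (b + c)" using p by (intro mult_left_mono) auto
    have "0 < f2 t" by (rule f2[OF t])
    moreover have "3 * d\<^sup>2 \<le> d * (3 * b + c)"
      using p unfolding power2_eq_square by (simp add: algebra_simps)
    moreover have "0 \<le> a * d" using p by simp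
    \<comment> \<open>\<open>f2 > 0\<close> keeps \<open>d\<close> small against \<open>a\<close>,
      so the positive term \<open>d^2\<close> of \<open>f1\<close> cannot spoil
      \<open>- f1 \<ge> 2 * a^2\<close>.\<close>
    ultimately have d2: "3 * d\<^sup>2 \<le> a\<^sup>2" unfolding F by linarith
    have "e * a\<^sup>2 = f2 t1 * \<rho>\<^sup>2"
      using p1 by (simp add: e_def \<rho>_def power_divide)
    also have "f2 t1 = (A t1)\<^sup>2 - (B t1 - C t1) * (3 * B t1 + C t1) - 2 * A t1 * (B t1 - C t1)"
      by (simp add: f2_def F2_eq)
    also have "\<dots> * \<rho>\<^sup>2 = a\<^sup>2 - \<rho>\<^sup>2 * ((B t1 - C t1) * (3 * B t1 + C t1)) - 2 * a * (\<rho> * (B t1 - C t1))"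
      unfolding \<rho>(2) by (simp add: power2_eq_square algebra_simps)
    also have "\<dots> \<le> a\<^sup>2 - d * (3 * b + c) - 2 * a * d"
    proof -
      have "d * (3 * b + c) \<le> (B t1 - C t1) * (3 * B t1 + C t1)"
        using mono[OF t] p p1 unfolding b_def c_def d_def by (intro mult_mono) auto
      moreover have "1 * ((B t1 - C t1) * (3 * B t1 + C t1)) \<le> \<rho>\<^sup>2 * ((B t1 - C t1) * (3 * B t1 + C t1))"
        using \<rho> p1 by (intro mult_right_mono) auto
      moreover have "1 * (B t1 - C t1) \<le> \<rho> * (B t1 - C t1)" using \<rho> p1 by (intro mult_right_mono) auto
      then have "d \<le> \<rho> * (B t1 - C t1)" using mono[OF t] by (simp add: d_def)
      then have "2 * a * d \<le> 2 * a * (\<rho> * (B t1 - C t1))" using p by (intro mult_left_mono) auto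
      ultimately show ?thesis by linarith
    qed
    finally show "e * (A t)\<^sup>2 \<le> f2 t" unfolding F a_def .
    have "0 \<le> d * (3 * b + c)" "0 \<le> 2 * a * d" using p by auto
    then show "f2 t \<le> (A t)\<^sup>2" unfolding F a_def by linarith
    have "3 * a\<^sup>2 - d\<^sup>2 \<ge> 2 * a\<^sup>2" using d2 zero_le_power2[of d] by linarith
    then show "2 * (A t)\<^sup>2 \<le> - f1 t" unfolding F a_def[symmetric] using a_bc by linarith
    have "2 * a * (b + c) \<le> 2 * a * (\<beta> * a)" using bc p by (intro mult_left_mono) auto
    then have "2 * a * (b + c) \<le> 2 * (\<beta> * a\<^sup>2)" by (simp add: power2_eq_square mult_ac)
    moreover have "0 \<le> \<beta> * a\<^sup>2" using \<beta> by simp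
    ultimately show "- f1 t \<le> K * (A t)\<^sup>2"
      unfolding F a_def[symmetric] K_def distrib_right using zero_le_power2[of d] by linarith
    have K: "K * a * (b + c) = 3 * (a * (b + c)) + 3 * (\<beta> * (a * (b + c)))"
      by (simp add: K_def algebra_simps)
    have "d * (b + c) \<le> \<beta> * (a * (b + c))" "d * b \<le> \<beta> * (a * (b + c))" "d * c \<le> \<beta> * (a * (b + c))"
      "d * d \<le> \<beta> * (a * (b + c))"
      by (rule quad; use p in linarith)+
    moreover have "0 \<le> d * b" "0 \<le> d * c" "0 \<le> d * d" "0 \<le> a * d" using p by auto
    moreover have "d * (b + c) = d * b + d * c" by (simp add: algebra_simps)
    moreover have E: "f2 t - a\<^sup>2 = - (3 * (d * b) + d * c + 2 * (a * d))"
      "f3 t - a\<^sup>2 = d * b + 3 * (d * c) + 2 * (a * d)"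
      "f1 t + 3 * a\<^sup>2 = d * d - 2 * (a * (b + c))"
      unfolding F by (simp_all add: algebra_simps power2_eq_square)
    ultimately show "\<bar>f2 t - (A t)\<^sup>2\<bar> \<le> K * A t * (B t + C t)" "\<bar>f3 t - (A t)\<^sup>2\<bar> \<le> K * A t * (B t + C t)"
      "\<bar>f1 t + 3 * (A t)\<^sup>2\<bar> \<le> K * A t * (B t + C t)"
      unfolding a_def[symmetric] b_def[symmetric] c_def[symmetric] K E abs_le_iff
      using ad a_bc by linarith+
  qed
  have "e \<le> 1"
  proof -
    have "e * (A t1)\<^sup>2 \<le> 1 * (A t1)\<^sup>2" using bounds(1,2)[OF t1(1)] by simp
    then show ?thesis using p1 by (simp add: mult_le_cancel_right)
  qed
  then have eA: "e * (A t)\<^sup>2 \<le> (A t)\<^sup>2" for t by (simp add: mult_left_le_one_le e less_imp_le)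
  show ?thesis
  proof (rule dominance[OF t1(1) e, of K A B C f2 f3 f1])
    show "0 < K" using \<beta> by (simp add: K_def)
    fix t assume t: "t \<in> J" "t \<le> t1"
    note s = sol[unfolded xcf_solution_on_def, rule_format, OF t(1)]
    show "0 < A t \<and> 0 < B t \<and> 0 < C t" using pos[OF t(1)] by simp
    show "(A has_real_derivative - (2 * A t * f2 t * f3 t) / (A t * B t * C t)\<^sup>2) (at t)"
      "(B has_real_derivative - (2 * B t * f3 t * f1 t) / (A t * B t * C t)\<^sup>2) (at t)"
      "(C has_real_derivative - (2 * C t * f1 t * f2 t) / (A t * B t * C t)\<^sup>2) (at t)"
      using s by (auto simp: f1_def f2_def f3_def)
    show "e * (A t)\<^sup>2 \<le> f2 t" by (rule bounds[OF t])
    show "e * (A t)\<^sup>2 \<le> f3 t" using eA[of t] f3_pos[OF t(1)] by simp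
    show "e * (A t)\<^sup>2 \<le> - f1 t \<and> - f1 t \<le> K * (A t)\<^sup>2"
      using eA[of t] bounds(3,4)[OF t] zero_le_power2[of "A t"] by linarith
    show "\<bar>f2 t - (A t)\<^sup>2\<bar> \<le> K * A t * (B t + C t) \<and> \<bar>f3 t - (A t)\<^sup>2\<bar> \<le> K * A t * (B t + C t) \<and>
        \<bar>f1 t + 3 * (A t)\<^sup>2\<bar> \<le> K * A t * (B t + C t)" using bounds[OF t] by simp
  qed (use escape[OF t1(1)] in blast)
qed

lemma case2_asymptotics:
  assumes "t0 \<in> J" "0 \<le> f1 t0"
  shows "bdd_below J \<and> (\<exists>\<eta>1>0. \<exists>\<eta>2>0. \<exists>\<eta>3>0.
    A \<sim>[at_right (Inf J)] (\<lambda>t. \<eta>1 * (t - Inf J) powr (3 / 14)) \<and>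
    B \<sim>[at_right (Inf J)] (\<lambda>t. \<eta>2 * (t - Inf J) powr (- 1 / 14)) \<and>
    C \<sim>[at_right (Inf J)] (\<lambda>t. \<eta>3 * (t - Inf J) powr (3 / 14)))"
proof -
  obtain t1 where t1: "t1 \<in> J" "t1 < t0" using below[OF assms(1)] by blast
  have f1: "0 < f1 t" and f2: "f2 t < 0" if "t \<in> J" "t \<le> t1" for t
  proof -
    show "0 < f1 t" using f1_pos_backward[OF assms that(1)] that(2) t1(2) by simp
    then show "f2 t < 0" using f2_neg that by simp
  qed
  have mono: "B t1 \<le> B t \<and> A t \<le> A t1 \<and> C t \<le> C t1" if t: "t \<in> J" "t \<le> t1" for t
  proof (intro conjI)
    have "- B t \<le> - B t1"
    proof (rule deriv_mono[OF t(1) t1(1) t(2)])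
      fix r assume r: "r \<in> J" "r \<le> t1"
      show "((\<lambda>t. - B t) has_real_derivative h r * B r * f3 r * f1 r) (at r)"
        using DERIV_minus[OF dB[OF r(1)]] by simp
      show "0 \<le> h r * B r * f3 r * f1 r" using pos[OF r(1)] f1[OF r] f3_pos[OF r(1)] by simp
    qed
    then show "B t1 \<le> B t" by simp
    show "A t \<le> A t1"
    proof (rule deriv_mono[OF t(1) t1(1) t(2) dA])
      fix r assume r: "r \<in> J" "r \<le> t1"
      show "0 \<le> - (h r * A r * f2 r * f3 r)"
        using pos[OF r(1)] f2[OF r] f3_pos[OF r(1)] by (simp add: mult_nonneg_nonpos mult_nonpos_nonneg)
    qed
    show "C t \<le> C t1"
    proof (rule deriv_mono[OF t(1) t1(1) t(2) dC])
      fix r assume r: "r \<in> J" "r \<le> t1"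
      show "0 \<le> - (h r * C r * f1 r * f2 r)"
        using pos[OF r(1)] f1[OF r] f2[OF r] by (simp add: mult_nonneg_nonpos)
    qed
  qed
  have p1: "0 < A t1" "0 < B t1" "0 < C t1" "C t1 < B t1" using pos[OF t1(1)] CB[OF t1(1)] by auto
  \<comment> \<open>The first entry makes \<open>e * B^2\<close> a lower bound for
    \<open>f1\<close>, by homogeneity, as \<open>B\<close> grows and \<open>A\<close>,
    \<open>C\<close> shrink backward. The second gives \<open>e * B^2 \<le> (B - C) * B\<close>,
    which serves \<open>f3\<close> and \<open>- f2\<close>.\<close>
  define e where "e = min (f1 t1 / (B t1)\<^sup>2) ((B t1 - C t1) / B t1)"
  have e: "0 < e" using f1[OF t1(1)] p1 by (simp add: e_def)
  have bounds: "e * (B t)\<^sup>2 \<le> f1 t" "e * (B t)\<^sup>2 \<le> f3 t" "e * (B t)\<^sup>2 \<le> - f2 t" "- f2 t \<le> 7 * (B t)\<^sup>2"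
    "\<bar>f3 t - (B t)\<^sup>2\<bar> \<le> 7 * B t * (C t + A t)" "\<bar>f1 t - (B t)\<^sup>2\<bar> \<le> 7 * B t * (C t + A t)"
    "\<bar>f2 t + 3 * (B t)\<^sup>2\<bar> \<le> 7 * B t * (C t + A t)" if t: "t \<in> J" "t \<le> t1" for t
  proof -
    define a b c d where "a = A t" and "b = B t" and "c = C t" and "d = B t - C t"
    have p: "0 < a" "0 < b" "0 < c" "0 < d" "b = c + d"
      using pos[OF t(1)] CB[OF t(1)] by (auto simp: a_def b_def c_def d_def)
    have F: "f1 t = d\<^sup>2 - 3 * a\<^sup>2 - 2 * a * (b + c)" "f2 t = a\<^sup>2 - d * (3 * b + c) - 2 * a * d"
      "f3 t = a\<^sup>2 + d * (b + 3 * c) + 2 * a * d"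
      by (simp_all add: f1_def f2_def f3_def F1_eq F2_eq F3_eq a_def b_def c_def d_def)
    define \<rho> where "\<rho> = b / B t1"
    have \<rho>: "1 \<le> \<rho>" "b = \<rho> * B t1" using mono[OF t] p1 by (auto simp: \<rho>_def b_def)
    have a\<rho>: "a \<le> \<rho> * A t1"
    proof -
      have "1 * A t1 \<le> \<rho> * A t1" using \<rho> p1 by (intro mult_right_mono) auto
      then show ?thesis using mono[OF t] by (simp add: a_def)
    qed
    have c\<rho>: "c \<le> \<rho> * C t1"
    proof -
      have "1 * C t1 \<le> \<rho> * C t1" using \<rho> p1 by (intro mult_right_mono) auto
      then show ?thesis using mono[OF t] by (simp add: c_def)
    qed
    have d\<rho>: "\<rho> * (B t1 - C t1) \<le> d" using c\<rho> \<rho> p by (simp add: algebra_simps)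
    have "0 < f1 t" by (rule f1[OF t])
    moreover have "0 \<le> 2 * a * (b + c)" "0 \<le> a\<^sup>2" using p by auto
    ultimately have "a\<^sup>2 \<le> d\<^sup>2" unfolding F by linarith
    \<comment> \<open>With \<open>a \<le> d\<close> the term \<open>a^2\<close> of \<open>f2\<close>
      is absorbed by \<open>2 * a * d\<close>.\<close>
    then have ad: "a \<le> d" using p by (simp add: power2_le_iff_abs_le)
    have "f1 t1 / (B t1)\<^sup>2 * b\<^sup>2 = f1 t1 * \<rho>\<^sup>2" using p1 by (simp add: \<rho>_def power_divide)
    also have "\<dots> = (\<rho> * (B t1 - C t1))\<^sup>2 - 3 * (\<rho> * A t1)\<^sup>2 - 2 * (\<rho> * A t1) * (b + \<rho> * C t1)"
      unfolding \<rho>(2) f1_def F1_eq by (simp add: power2_eq_square algebra_simps)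
    also have "\<dots> \<le> f1 t"
    proof -
      have "(\<rho> * (B t1 - C t1))\<^sup>2 \<le> d\<^sup>2" using d\<rho> \<rho> p1 by (intro power_mono) auto
      moreover have "a\<^sup>2 \<le> (\<rho> * A t1)\<^sup>2" using a\<rho> p by (intro power_mono) auto
      moreover have "2 * a * (b + c) \<le> 2 * (\<rho> * A t1) * (b + \<rho> * C t1)"
        using a\<rho> c\<rho> p by (intro mult_mono) auto
      ultimately show ?thesis unfolding F by linarith
    qed
    finally have 1: "f1 t1 / (B t1)\<^sup>2 * b\<^sup>2 \<le> f1 t" .
    have "(B t1 - C t1) / B t1 * b\<^sup>2 = \<rho> * (B t1 - C t1) * b"
      using p1 by (simp add: \<rho>_def power2_eq_square)
    also have "\<dots> \<le> d * b" using d\<rho> p by (intro mult_right_mono) auto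
    finally have 2: "(B t1 - C t1) / B t1 * b\<^sup>2 \<le> d * b" .
    have e1: "e * b\<^sup>2 \<le> f1 t1 / (B t1)\<^sup>2 * b\<^sup>2" and e2: "e * b\<^sup>2 \<le> (B t1 - C t1) / B t1 * b\<^sup>2"
      unfolding e_def by (intro mult_right_mono; simp)+
    have prods: "0 \<le> d * b" "0 \<le> d * c" "0 \<le> a * d" "0 \<le> a * b" "0 \<le> a * c" "0 \<le> b * c" "a * a \<le> a * d" "a * a \<le> a * b"
      "c * c \<le> b * c" "a * c \<le> b * c" "a * d \<le> b * b" "d * b \<le> b * b" "d * c \<le> b * b" "0 \<le> a * a" "0 \<le> c * c"
      using p ad by (auto intro!: mult_left_mono mult_right_mono mult_mono)
    show "e * (B t)\<^sup>2 \<le> f1 t" using 1 e1 unfolding b_def by linarith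
    have e3: "e * b\<^sup>2 \<le> d * b" using 2 e2 by linarith
    have dd: "d * (b + 3 * c) = d * b + 3 * (d * c)" "d * (3 * b + c) = 3 * (d * b) + d * c" "2 * a * d = 2 * (a * d)"
      by (simp_all add: algebra_simps)
    show "e * (B t)\<^sup>2 \<le> f3 t" unfolding F b_def[symmetric] dd power2_eq_square[of a] using e3 prods by linarith
    show "e * (B t)\<^sup>2 \<le> - f2 t" unfolding F b_def[symmetric] dd power2_eq_square[of a] using e3 prods by linarith
    show "- f2 t \<le> 7 * (B t)\<^sup>2"
      unfolding F b_def[symmetric] dd power2_eq_square[of a] power2_eq_square[of b] using prods by linarith
    have E: "f1 t - b\<^sup>2 = - 3 * (a * a) + c * c - 2 * (b * c) - 2 * (a * c) - 2 * (a * b)"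
      "f2 t + 3 * b\<^sup>2 = a * a + c * c + 2 * (b * c) + 2 * (a * c) - 2 * (a * b)"
      "f3 t - b\<^sup>2 = - 3 * (c * c) + a * a + 2 * (b * c) - 2 * (a * c) + 2 * (a * b)"
      "7 * b * (c + a) = 7 * (b * c) + 7 * (a * b)"
      unfolding f1_def f2_def f3_def F1_def F2_def F3_def a_def[symmetric] b_def[symmetric] c_def[symmetric]
      by (simp_all add: algebra_simps power2_eq_square)
    show "\<bar>f3 t - (B t)\<^sup>2\<bar> \<le> 7 * B t * (C t + A t)" "\<bar>f1 t - (B t)\<^sup>2\<bar> \<le> 7 * B t * (C t + A t)"
      "\<bar>f2 t + 3 * (B t)\<^sup>2\<bar> \<le> 7 * B t * (C t + A t)"
      unfolding a_def[symmetric] b_def[symmetric] c_def[symmetric] E using prods by linarith+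
  qed
  have "bdd_below J \<and> (\<exists>\<eta>1>0. \<exists>\<eta>2>0. \<exists>\<eta>3>0.
    B \<sim>[at_right (Inf J)] (\<lambda>t. \<eta>1 * (t - Inf J) powr (- 1 / 14)) \<and>
    C \<sim>[at_right (Inf J)] (\<lambda>t. \<eta>2 * (t - Inf J) powr (3 / 14)) \<and>
    A \<sim>[at_right (Inf J)] (\<lambda>t. \<eta>3 * (t - Inf J) powr (3 / 14)))"
  proof (rule dominance[OF t1(1) e, of 7 B C A f3 f1 f2])
    fix t assume t: "t \<in> J" "t \<le> t1"
    note s = sol[unfolded xcf_solution_on_def, rule_format, OF t(1)]
    have eq: "B t * C t * A t = A t * B t * C t" by simp
    show "0 < B t \<and> 0 < C t \<and> 0 < A t" using pos[OF t(1)] by simp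
    show "(B has_real_derivative - (2 * B t * f3 t * f1 t) / (B t * C t * A t)\<^sup>2) (at t)"
      "(C has_real_derivative - (2 * C t * f1 t * f2 t) / (B t * C t * A t)\<^sup>2) (at t)"
      "(A has_real_derivative - (2 * A t * f2 t * f3 t) / (B t * C t * A t)\<^sup>2) (at t)"
      unfolding eq using s by (auto simp: f1_def f2_def f3_def)
    show "e * (B t)\<^sup>2 \<le> f3 t" "e * (B t)\<^sup>2 \<le> f1 t" by (rule bounds[OF t])+
    show "e * (B t)\<^sup>2 \<le> - f2 t \<and> - f2 t \<le> 7 * (B t)\<^sup>2" using bounds[OF t] by simp
    show "\<bar>f3 t - (B t)\<^sup>2\<bar> \<le> 7 * B t * (C t + A t) \<and> \<bar>f1 t - (B t)\<^sup>2\<bar> \<le> 7 * B t * (C t + A t) \<and>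
        \<bar>f2 t + 3 * (B t)\<^sup>2\<bar> \<le> 7 * B t * (C t + A t)" using bounds[OF t] by simp
  next
    show "\<not> bdd_below J" if "0 < m" "m \<le> M"
      "\<And>t. t \<in> J \<Longrightarrow> t \<le> t1 \<Longrightarrow> B t \<in> {m..M} \<and> C t \<in> {m..M} \<and> A t \<in> {m..M}" for m M
      using that by (intro escape[OF t1(1), of m M]) auto
  qed simp
  then obtain \<eta>1 \<eta>2 \<eta>3 where "bdd_below J" "0 < \<eta>1" "0 < \<eta>2" "0 < \<eta>3"
    "B \<sim>[at_right (Inf J)] (\<lambda>t. \<eta>1 * (t - Inf J) powr (- 1 / 14))"
    "C \<sim>[at_right (Inf J)] (\<lambda>t. \<eta>2 * (t - Inf J) powr (3 / 14))"
    "A \<sim>[at_right (Inf J)] (\<lambda>t. \<eta>3 * (t - Inf J) powr (3 / 14))"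
    by (elim conjE exE)
  then show ?thesis
    by (intro conjI exI[of _ \<eta>3] exI[of _ \<eta>1] exI[of _ \<eta>2])
qed

text \<open>\<open>A\<close> and \<open>B\<close> decrease backward in time while \<open>C\<close>
  increases and stays below \<open>B\<close>, so \<open>B\<close> and \<open>C\<close> keep away
  from 0. If \<open>A\<close> did so too, the solution would stay in a box and
  \<open>ln (A * B)\<close> would fall linearly, giving a finite left end against
  \<open>escape\<close>. Once \<open>A\<close> tends to 0, \<open>F1 < 0\<close> squeezes
  \<open>B - C\<close> to 0.\<close>

lemma stays_asymptotics:
  assumes t1: "t1 \<in> J" and f1: "\<And>t. t \<in> J \<Longrightarrow> t \<le> t1 \<Longrightarrow> f1 t < 0"
    and f2: "\<And>t. t \<in> J \<Longrightarrow> t \<le> t1 \<Longrightarrow> f2 t < 0"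
  obtains \<eta> where "0 < \<eta>" "(A \<longlongrightarrow> 0) (backward J)" "(B \<longlongrightarrow> \<eta>) (backward J)" "(C \<longlongrightarrow> \<eta>) (backward J)"
proof -
  have A_mono: "A s \<le> A t" if "s \<in> J" "t \<in> J" "s \<le> t" "t \<le> t1" for s t
  proof (rule deriv_mono[OF that(1-3) dA])
    show "0 \<le> - (h r * A r * f2 r * f3 r)" if r: "r \<in> J" "r \<le> t" for r
      using pos[OF r(1)] f2[OF r(1)] r \<open>t \<le> t1\<close> f3_pos[OF r(1)] by (simp add: mult_nonneg_nonpos mult_nonpos_nonneg)
  qed
  have B_mono: "B s \<le> B t" if "s \<in> J" "t \<in> J" "s \<le> t" "t \<le> t1" for s t
  proof (rule deriv_mono[OF that(1-3) dB])
    show "0 \<le> - (h r * B r * f3 r * f1 r)" if r: "r \<in> J" "r \<le> t" for r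
      using pos[OF r(1)] f1[OF r(1)] r \<open>t \<le> t1\<close> f3_pos[OF r(1)] by (simp add: mult_nonneg_nonpos)
  qed
  have C_mono: "C t1 \<le> C s" if s: "s \<in> J" "s \<le> t1" for s
  proof -
    have "- C s \<le> - C t1"
    proof (rule deriv_mono[OF s(1) t1 s(2)])
      fix r assume r: "r \<in> J" "r \<le> t1"
      show "((\<lambda>t. - C t) has_real_derivative h r * C r * f1 r * f2 r) (at r)"
        using DERIV_minus[OF dC[OF r(1)]] by simp
      show "0 \<le> h r * C r * f1 r * f2 r"
        using pos[OF r(1)] f1[OF r] f2[OF r] by (simp add: mult_nonneg_nonpos mult_nonpos_nonpos mult_nonneg_nonneg zero_le_mult_iff)
    qed
    then show ?thesis by simp
  qed
  have c1: "0 < C t1" using pos[OF t1] by simp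
  have bc: "C t1 \<le> C t" "C t1 \<le> B t" "C t \<le> B t1" "B t \<le> B t1" if t: "t \<in> J" "t \<le> t1" for t
    using C_mono[OF t] CB[OF t(1)] B_mono[OF t(1) t1 t(2)] by auto
  obtain \<alpha> where \<alpha>: "0 \<le> \<alpha>" "(A \<longlongrightarrow> \<alpha>) (backward J)" "\<And>t. t \<in> J \<Longrightarrow> t \<le> t1 \<Longrightarrow> \<alpha> \<le> A t"
    by (rule mono_tendsto[OF t1 A_mono, where m = 0]) (use pos in \<open>auto intro: less_imp_le\<close>)
  obtain \<eta> where \<eta>: "C t1 \<le> \<eta>" "(B \<longlongrightarrow> \<eta>) (backward J)"
    by (rule mono_tendsto[OF t1 B_mono, where m = "C t1"]) (use bc in auto)
  have "\<alpha> = 0"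
  proof (rule ccontr)
    assume "\<alpha> \<noteq> 0"
    then have "0 < \<alpha>" using \<alpha> by simp
    define m where "m = min \<alpha> (C t1)"
    define M where "M = max (A t1) (B t1)"
    have m: "0 < m" using \<open>0 < \<alpha>\<close> c1 by (simp add: m_def)
    have box: "A t \<in> {m..M} \<and> B t \<in> {m..M} \<and> C t \<in> {m..M}" if t: "t \<in> J" "t \<le> t1" for t
      using \<alpha>(3)[OF t] A_mono[OF t(1) t1 t(2)] bc[OF t] by (auto simp: m_def M_def)
    have mM: "m \<le> M" using box[OF t1] by auto
    define c where "c = 4 * m\<^sup>2 / (M\<^sup>2 * M\<^sup>2)"
    have M: "0 < M" using m mM by simp
    have c: "0 < c" using m M by (simp add: c_def)
    \<comment> \<open>\<open>f1\<close> and \<open>f2\<close> may each come close to 0, but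
      \<open>f1 + f2 \<le> - 2 * A^2\<close>. This is why the logarithms of \<open>A\<close> and
      \<open>B\<close> are added.\<close>
    have decay: "ln (A t) + ln (B t) - c * t \<le> ln (A t1) + ln (B t1) - c * t1" if t: "t \<in> J" "t \<le> t1" for t
    proof (rule deriv_mono[OF t(1) t1 t(2)])
      fix r assume r: "r \<in> J" "r \<le> t1"
      note p = pos[OF r(1)]
      show "((\<lambda>t. ln (A t) + ln (B t) - c * t) has_real_derivative h r * f3 r * - (f1 r + f2 r) - c) (at r)"
        using p by (auto intro!: derivative_eq_intros dA[OF r(1)] dB[OF r(1)] simp: field_simps)
      have "f1 r + f2 r = - 2 * (A r)\<^sup>2 - 2 * (B r - C r) * (B r + C r) - 4 * A r * B r"
        by (simp add: f1_def f2_def F1_def F2_def power2_eq_square algebra_simps)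
      moreover have "0 \<le> 2 * (B r - C r) * (B r + C r)" "0 \<le> 4 * A r * B r" using p CB[OF r(1)] by auto
      ultimately have f12: "2 * (A r)\<^sup>2 \<le> - (f1 r + f2 r)" by linarith
      have "c \<le> 4 * (A r)\<^sup>2 / ((B r)\<^sup>2 * (C r)\<^sup>2)"
        unfolding c_def using box[OF r] m p by (intro frac_le mult_mono power_mono) auto
      also have "\<dots> = h r * (A r)\<^sup>2 * (2 * (A r)\<^sup>2)"
        using p by (simp add: h_def power2_eq_square field_simps)
      also have "\<dots> \<le> h r * f3 r * - (f1 r + f2 r)"
        using p f3_pos[OF r(1)] f12 by (intro mult_mono) auto
      finally show "0 \<le> h r * f3 r * - (f1 r + f2 r) - c" by simp
    qed
    have "\<not> bdd_below J" by (rule escape[OF t1 m mM box])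
    moreover have "bdd_below J"
    proof (rule bdd_belowI)
      fix t assume t: "t \<in> J"
      show "min t1 (t1 - (ln (A t1) + ln (B t1) - 2 * ln m) / c) \<le> t"
      proof (cases "t \<le> t1")
        case True
        have "ln m \<le> ln (A t)" "ln m \<le> ln (B t)" using box[OF t True] m by auto
        then have "c * (t1 - t) \<le> ln (A t1) + ln (B t1) - 2 * ln m"
          using decay[OF t True] unfolding right_diff_distrib by linarith
        then have "t1 - t \<le> (ln (A t1) + ln (B t1) - 2 * ln m) / c" using c by (simp add: field_simps)
        then show ?thesis by simp
      qed simp
    qed
    ultimately show False by simp
  qed
  with \<alpha> have A0: "(A \<longlongrightarrow> 0) (backward J)" by simp
  have upper: "((\<lambda>t. sqrt (3 * (A t)\<^sup>2 + 4 * A t * B t)) \<longlongrightarrow> sqrt (3 * 0\<^sup>2 + 4 * 0 * \<eta>)) (backward J)"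
    by (intro tendsto_intros A0 \<eta>)
  have "((\<lambda>t. B t - C t) \<longlongrightarrow> 0) (backward J)"
  proof (rule tendsto_sandwich[of "\<lambda>_. 0" _ _ "\<lambda>t. sqrt (3 * (A t)\<^sup>2 + 4 * A t * B t)"])
    show "\<forall>\<^sub>F t in backward J. B t - C t \<le> sqrt (3 * (A t)\<^sup>2 + 4 * A t * B t)"
    proof (rule eventually_backward_le[OF t1])
      fix t assume t: "t \<in> J" "t \<le> t1"
      have "(B t - C t)\<^sup>2 < 3 * (A t)\<^sup>2 + 2 * A t * (B t + C t)"
        using f1[OF t] unfolding f1_def F1_eq by simp
      also have "2 * A t * (B t + C t) \<le> 2 * A t * (2 * B t)"
        using pos[OF t(1)] CB[OF t(1)] by (intro mult_left_mono) auto
      finally show "B t - C t \<le> sqrt (3 * (A t)\<^sup>2 + 4 * A t * B t)"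
        by (intro real_le_rsqrt) simp
    qed
    show "\<forall>\<^sub>F t in backward J. 0 \<le> B t - C t"
      by (rule eventually_backward_le[OF t1]) (use CB in \<open>auto intro: less_imp_le\<close>)
  qed (use upper in auto)
  from tendsto_diff[OF \<eta>(2) this] have "(C \<longlongrightarrow> \<eta>) (backward J)" by simp
  then show thesis using that[of \<eta>] A0 \<eta> c1 by simp
qed

section \<open>Dynamics in the reduced coordinates\<close>

definition U :: "real \<Rightarrow> real" where "U t = A t / C t"
definition W :: "real \<Rightarrow> real" where "W t = (B t - C t) / C t"
text \<open>Positive change of time: up to this factor \<open>(U, W)\<close> follows the planar
  field with components \<open>u * (u + 1) * DD u w\<close> and \<open>NN u w\<close>, whose
  quotient is \<open>GG\<close>.\<close>

definition g :: "real \<Rightarrow> real" where "g t = 4 * h t * C t ^ 4"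

lemma UW_pos: "0 < U t" "0 < W t" "0 < g t" if "t \<in> J"
  using pos[OF that] CB[OF that] by (auto simp: U_def W_def g_def)

lemma f_UW:
  assumes "t \<in> J"
  shows "f1 t = - ((C t)\<^sup>2 * PP (U t) (W t))" "f2 t = - ((C t)\<^sup>2 * MM (U t) (W t))"
    and "f3 t = (C t)\<^sup>2 * ((U t)\<^sup>2 + W t * (W t + 4) + 2 * U t * W t)"
proof -
  have c: "C t \<noteq> 0" using pos[OF assms] by simp
  then have A: "A t = C t * U t" and d: "B t = C t * (1 + W t)" by (auto simp: U_def W_def field_simps)
  show "f1 t = - ((C t)\<^sup>2 * PP (U t) (W t))" "f2 t = - ((C t)\<^sup>2 * MM (U t) (W t))"
    "f3 t = (C t)\<^sup>2 * ((U t)\<^sup>2 + W t * (W t + 4) + 2 * U t * W t)"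
    unfolding f1_def f2_def f3_def F1_eq F2_eq F3_eq A d PP_def MM_def
    by (simp_all add: power2_eq_square algebra_simps)
qed

lemma dU: "(U has_real_derivative g t * (U t * (U t + 1) * DD (U t) (W t))) (at t)" if t: "t \<in> J"
proof -
  have c: "C t > 0" using pos[OF t] by simp
  have "(U has_real_derivative ((- (h t * A t * f2 t * f3 t)) * C t - A t * (- (h t * C t * f1 t * f2 t))) / (C t * C t)) (at t)"
    unfolding U_def using c by (intro DERIV_divide dA dC t) auto
  also have "((- (h t * A t * f2 t * f3 t)) * C t - A t * (- (h t * C t * f1 t * f2 t))) / (C t * C t)
      = h t * U t * - f2 t * (f3 t - f1 t)"
    using c by (simp add: U_def field_simps)
  also have "f3 t - f1 t = 4 * (C t)\<^sup>2 * ((U t + 1) * (U t + W t))"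
    unfolding f_UW[OF t] PP_def by (simp add: power2_eq_square algebra_simps)
  also have "h t * U t * - f2 t * (4 * (C t)\<^sup>2 * ((U t + 1) * (U t + W t))) = g t * (U t * (U t + 1) * DD (U t) (W t))"
    unfolding f_UW[OF t] DD_def g_def by (simp add: power2_eq_square power4_eq_xxxx)
  finally show ?thesis .
qed

lemma dW: "(W has_real_derivative g t * NN (U t) (W t)) (at t)" if t: "t \<in> J"
proof -
  have c: "C t > 0" using pos[OF t] by simp
  have "(W has_real_derivative ((- (h t * B t * f3 t * f1 t) - (- (h t * C t * f1 t * f2 t))) * C t
      - (B t - C t) * (- (h t * C t * f1 t * f2 t))) / (C t * C t)) (at t)"
    unfolding W_def using c by (intro DERIV_divide DERIV_diff dB dC t) auto
  also have "((- (h t * B t * f3 t * f1 t) - (- (h t * C t * f1 t * f2 t))) * C t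
      - (B t - C t) * (- (h t * C t * f1 t * f2 t))) / (C t * C t) = h t * (1 + W t) * - f1 t * (f3 t - f2 t)"
    using c by (simp add: W_def field_simps)
  also have "f3 t - f2 t = 4 * (C t)\<^sup>2 * (W t * (2 + U t + W t))"
    unfolding f_UW[OF t] MM_def by (simp add: power2_eq_square algebra_simps)
  also have "h t * (1 + W t) * - f1 t * (4 * (C t)\<^sup>2 * (W t * (2 + U t + W t))) = g t * NN (U t) (W t)"
    unfolding f_UW[OF t] NN_def g_def by (simp add: power2_eq_square power4_eq_xxxx)
  finally show ?thesis .
qed

definition z :: "real \<Rightarrow> real" where "z t = W t - separatrix (U t)"
definition k :: "real \<Rightarrow> real" where
  "k t = g t * KK (U t) (W t) (separatrix (U t)) / DD (U t) (separatrix (U t))"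

lemma DD_separatrix: "0 < DD (U t) (separatrix (U t))" if "t \<in> J"
  using UW_pos[OF that] separatrix_ge by (intro DD_pos) auto

text \<open>No sign condition on \<open>w - u\<close> or on the derivative of \<open>u\<close> is needed: the denominator of \<open>k\<close> is
  evaluated on the separatrix, where it is positive.\<close>

lemma dz: "(z has_real_derivative k t * z t) (at t)" if t: "t \<in> J"
proof -
  have nz: "U t \<noteq> 0" "U t + 1 \<noteq> 0" "DD (U t) (separatrix (U t)) \<noteq> 0"
    using UW_pos[OF t] DD_separatrix[OF t] by auto
  let ?s = "separatrix (U t)"
  have "(z has_real_derivative g t * NN (U t) (W t) - GG (U t) ?s * (g t * (U t * (U t + 1) * DD (U t) (W t)))) (at t)"
    unfolding z_def
    by (intro DERIV_diff dW t DERIV_chain2[OF separatrix_derivative dU] UW_pos)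
  also have "GG (U t) ?s * (g t * (U t * (U t + 1) * DD (U t) (W t)))
      = g t * (NN (U t) ?s * DD (U t) (W t) / DD (U t) ?s)"
    unfolding GG_def using nz by simp
  also have "g t * NN (U t) (W t) - g t * (NN (U t) ?s * DD (U t) (W t) / DD (U t) ?s)
      = g t * ((NN (U t) (W t) * DD (U t) ?s - NN (U t) ?s * DD (U t) (W t)) / DD (U t) ?s)"
    using nz by (simp add: field_simps)
  also have "\<dots> = k t * z t"
    unfolding KK_divided_difference k_def z_def by simp
  finally show ?thesis .
qed

lemma continuous_on_components: "continuous_on J A" "continuous_on J B" "continuous_on J C"
  using dA dB dC by (meson DERIV_continuous continuous_at_imp_continuous_on)+

lemma continuous_on_k: "continuous_on J k"
proof -
  have U: "continuous_on J U" and W: "continuous_on J W" and z: "continuous_on J z"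
    using dU dW dz by (meson DERIV_continuous continuous_at_imp_continuous_on)+
  have "continuous_on J (\<lambda>t. W t - z t)" by (intro continuous_intros U W z)
  then have s: "continuous_on J (\<lambda>t. separatrix (U t))" by (simp add: z_def)
  have nz: "A t * B t * C t \<noteq> 0" if "t \<in> J" for t using pos[OF that] by simp
  have nz2: "DD (U t) (separatrix (U t)) \<noteq> 0" if "t \<in> J" for t using DD_separatrix[OF that] by simp
  have "continuous_on J g"
    unfolding g_def h_def using nz by (intro continuous_intros continuous_on_components) auto
  moreover have "continuous_on J (\<lambda>t. KK (U t) (W t) (separatrix (U t)))"
    unfolding KK_def by (intro continuous_intros U W s)
  moreover have "continuous_on J (\<lambda>t. DD (U t) (separatrix (U t)))"
    unfolding DD_def MM_def by (intro continuous_intros U s)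
  ultimately show ?thesis
    unfolding k_def using nz2 by (intro continuous_intros) auto
qed

lemma z_exp:
  assumes "s \<in> J" "t \<in> J" "s \<le> t"
  shows "z t = z s * exp (integral {s..t} k)"
proof -
  have sub: "{s..t} \<subseteq> J" using ivl[OF assms(1,2)] by auto
  show ?thesis
    using sub by (intro linear_ode_solution[OF assms(3) continuous_on_subset[OF continuous_on_k sub]]
        has_field_derivative_at_within[OF dz]) auto
qed

lemma z_sign: "sgn (z s) = sgn (z t)" if "s \<in> J" "t \<in> J"
proof -
  have "sgn (z t) = sgn (z s)" if "s \<in> J" "t \<in> J" "s \<le> t" for s t
    using z_exp[OF that] by (simp add: sgn_mult)
  then show ?thesis using that by (metis linear)
qed

lemma z_contract:
  assumes t1: "t1 \<in> J" and WU: "\<And>t. t \<in> J \<Longrightarrow> t \<le> t1 \<Longrightarrow> U t \<le> W t" and s: "s \<in> J" "s \<le> t1"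
  shows "\<bar>z t1\<bar> \<le> \<bar>z s\<bar>"
proof -
  have sub: "{s..t1} \<subseteq> J" using ivl[OF s(1) t1] by auto
  have "k t \<le> 0" if "t \<in> {s..t1}" for t
  proof -
    have t: "t \<in> J" "t \<le> t1" using that sub by auto
    have "KK (U t) (W t) (separatrix (U t)) < 0"
      using UW_pos[OF t(1)] WU[OF t] separatrix_ge by (intro KK_neg) auto
    then show ?thesis
      unfolding k_def using DD_separatrix[OF t(1)] UW_pos[OF t(1)]
      by (intro divide_nonpos_pos mult_nonneg_nonpos) auto
  qed
  moreover have "k integrable_on {s..t1}"
    by (intro integrable_continuous_interval continuous_on_subset[OF continuous_on_k sub])
  ultimately have "integral {s..t1} k \<le> integral {s..t1} (\<lambda>_. 0)"
    by (intro integral_le) auto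
  then show ?thesis using z_exp[OF s(1) t1 s(2)] by (simp add: abs_mult mult_left_le)
qed

lemma U_tendsto_0:
  assumes "(A \<longlongrightarrow> 0) (backward J)" "(B \<longlongrightarrow> \<eta>) (backward J)" "(C \<longlongrightarrow> \<eta>) (backward J)" "0 < \<eta>"
  shows "(U \<longlongrightarrow> 0) (backward J)" "(W \<longlongrightarrow> 0) (backward J)" "filterlim U (at_right 0) (backward J)"
proof -
  have "(U \<longlongrightarrow> 0 / \<eta>) (backward J)" unfolding U_def using assms by (intro tendsto_intros) auto
  then show U: "(U \<longlongrightarrow> 0) (backward J)" by simp
  have "(W \<longlongrightarrow> (\<eta> - \<eta>) / \<eta>) (backward J)" unfolding W_def using assms by (intro tendsto_intros) auto
  then show "(W \<longlongrightarrow> 0) (backward J)" by simp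
  obtain t where "t \<in> J" using nonempty by blast
  then have "\<forall>\<^sub>F t in backward J. 0 < U t"
    by (rule eventually_backward_le) (rule UW_pos)
  with U show "filterlim U (at_right 0) (backward J)"
    by (auto simp: filterlim_at elim: eventually_mono)
qed

text \<open>Above the separatrix \<open>W \<ge> U\<close> holds automatically, so \<open>DD\<close>
  is positive and \<open>f2 < 0\<close>; only \<open>f1\<close> can change sign.\<close>

lemma above_separatrix:
  assumes t0: "t0 \<in> J" and "0 < z t0"
  shows "\<exists>t\<in>J. 0 \<le> f1 t"
proof (rule ccontr)
  assume "\<not> ?thesis"
  then have f1: "f1 t < 0" if "t \<in> J" for t using that by force
  have z: "0 < z t" if "t \<in> J" for t using z_sign[OF that t0] assms by (simp add: sgn_1_pos)
  have WU: "U t \<le> W t" if "t \<in> J" for t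
    using z[OF that] separatrix_ge[OF UW_pos(1)[OF that]] by (simp add: z_def)
  have f2: "f2 t < 0" if t: "t \<in> J" for t
  proof -
    have "0 < DD (U t) (W t)" using UW_pos[OF t] WU[OF t] by (intro DD_pos) auto
    then have "0 < MM (U t) (W t)" using UW_pos[OF t] by (simp add: DD_def zero_less_mult_iff)
    then show ?thesis using f_UW(2)[OF t] pos[OF t] by simp
  qed
  obtain \<eta> where \<eta>: "0 < \<eta>" "(A \<longlongrightarrow> 0) (backward J)" "(B \<longlongrightarrow> \<eta>) (backward J)" "(C \<longlongrightarrow> \<eta>) (backward J)"
    using stays_asymptotics[OF t0] f1 f2 by metis
  have "\<forall>\<^sub>F t in backward J. z t0 \<le> W t"
  proof (rule eventually_backward_le[OF t0])
    fix t assume t: "t \<in> J" "t \<le> t0"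
    have "z t0 \<le> z t" using z_contract[OF t0 WU t] z[OF t0] z[OF t(1)] by simp
    also have "\<dots> \<le> W t" using separatrix_ge[OF UW_pos(1)[OF t(1)]] UW_pos(1)[OF t(1)] by (simp add: z_def)
    finally show "z t0 \<le> W t" .
  qed
  from tendsto_lowerbound[OF U_tendsto_0(2)[OF \<eta>(2,3,4,1)] this] assms show False by simp
qed

text \<open>By \<open>KK_low\<close>, \<open>NN u w \<ge> (1 + u)^2 * DD u w\<close> for
  \<open>w \<le> u\<close>: the slope is at least its diagonal value \<open>1 + 1 / u\<close>, with
  primitive \<open>u + ln u\<close>. So \<open>w - u - ln u\<close> stays bounded above backward in
  time, which is impossible when \<open>u\<close> and \<open>w\<close> stay positive and
  \<open>u\<close> tends to 0.\<close>

lemma below_diagonal: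
  assumes t1: "t1 \<in> J" "W t1 < U t1" and f2: "\<And>t. t \<in> J \<Longrightarrow> f2 t < 0"
    and U0: "filterlim U (at_right 0) (backward J)"
  shows False
proof -
  have DD: "0 < DD (U t) (W t)" if "t \<in> J" for t
  proof -
    have "0 < MM (U t) (W t)" using f2[OF that] f_UW(2)[OF that] pos[OF that] by (simp add: zero_less_mult_iff)
    then show ?thesis using UW_pos[OF that] by (simp add: DD_def)
  qed
  have diag: "NN u u = 8 * u\<^sup>2 * (1 + u) ^ 3" "DD u u = 8 * u\<^sup>2 * (1 + u)" for u
    by (simp_all add: NN_def DD_def PP_def MM_def algebra_simps eval_nat_numeral)
  \<comment> \<open>The diagonal is crossed only upwards in forward time, so a solution below it was
    below it at all earlier times.\<close>
  have WU: "W t \<le> U t" if t: "t \<in> J" "t \<le> t1" for t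
  proof (cases "t = t1")
    case False
    have "0 < U t - W t"
    proof (rule backward_barrier[OF t1(1) t(1)])
      show "((\<lambda>t. U t - W t) has_real_derivative
          g s * (U s * (U s + 1) * DD (U s) (W s)) - g s * NN (U s) (W s)) (at s)" if "s \<in> J" for s
        by (intro DERIV_diff dU dW that)
      show "g s * (U s * (U s + 1) * DD (U s) (W s)) - g s * NN (U s) (W s) < 0"
        if s: "s \<in> J" "U s - W s = 0" for s
      proof -
        have eq: "W s = U s" using s by simp
        have "g s * (U s * (U s + 1) * DD (U s) (W s)) - g s * NN (U s) (W s)
            = - (g s * (8 * (U s)\<^sup>2 * (1 + U s)\<^sup>2))"
          unfolding eq diag by (simp add: algebra_simps eval_nat_numeral)
        also have "\<dots> < 0" using UW_pos[OF s(1)] by simp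
        finally show ?thesis .
      qed
    qed (use t t1 False in auto)
    then show ?thesis by simp
  qed (use t1 in simp)
  have mono: "W t - U t - ln (U t) \<le> W t1 - U t1 - ln (U t1)" if t: "t \<in> J" "t \<le> t1" for t
  proof (rule deriv_mono[OF t(1) t1(1) t(2)])
    fix s assume s: "s \<in> J" "s \<le> t1"
    define u w where "u = U s" and "w = W s"
    have uw: "0 < u" "0 < w" "w \<le> u" "0 < g s" using UW_pos[OF s(1)] WU[OF s] by (auto simp: u_def w_def)
    show "((\<lambda>t. W t - U t - ln (U t)) has_real_derivative g s * (NN u w - (1 + u)\<^sup>2 * DD u w)) (at s)"
      using uw unfolding u_def w_def
      by (auto intro!: derivative_eq_intros dU[OF s(1)] dW[OF s(1)] simp: field_simps power2_eq_square)
    have "0 \<le> (w - u) * KK u w u" using KK_low[OF uw(2,3)] uw by (intro mult_nonpos_nonpos) auto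
    also have "\<dots> = NN u w * DD u u - NN u u * DD u w" by (rule KK_divided_difference[symmetric])
    also have "\<dots> = (8 * u\<^sup>2 * (1 + u)) * (NN u w - (1 + u)\<^sup>2 * DD u w)"
      unfolding diag by (simp add: algebra_simps eval_nat_numeral)
    finally have "0 \<le> (8 * u\<^sup>2 * (1 + u)) * (NN u w - (1 + u)\<^sup>2 * DD u w)" .
    moreover have "0 < 8 * u\<^sup>2 * (1 + u)" using uw by simp
    ultimately have "0 \<le> NN u w - (1 + u)\<^sup>2 * DD u w"
      using zero_le_mult_iff[of "8 * u\<^sup>2 * (1 + u)" "NN u w - (1 + u)\<^sup>2 * DD u w"] by linarith
    then show "0 \<le> g s * (NN u w - (1 + u)\<^sup>2 * DD u w)" using uw by simp
  qed
  define c where "c = W t1 - U t1 - ln (U t1)"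
  have U_lim: "(U \<longlongrightarrow> 0) (backward J)" using U0 by (simp add: filterlim_at)
  then have "\<forall>\<^sub>F t in backward J. U t < 1"
    using order_tendstoD(2)[OF U_lim, of 1] by simp
  moreover have "\<forall>\<^sub>F t in backward J. W t - U t - ln (U t) \<le> c \<and> 0 < W t \<and> 0 < U t"
    unfolding c_def by (rule eventually_backward_le[OF t1(1)]) (use mono UW_pos in auto)
  ultimately have ev: "\<forall>\<^sub>F t in backward J. exp (- c - 1) \<le> U t"
  proof eventually_elim
    case (elim t)
    then have "- c - 1 \<le> ln (U t)" by linarith
    then show ?case using elim by (simp add: ln_ge_iff)
  qed
  from tendsto_lowerbound[OF U_lim ev] have "exp (- c - 1) \<le> 0" by simp
  then show False by simp
qed

text \<open>As a function of \<open>w\<close>, \<open>PP u w\<close> is a concave parabola with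
  vertex at \<open>w = u\<close>. It is positive up to \<open>w = 2 * u\<close> and decreasing
  beyond, so there it inherits positivity from the separatrix above.\<close>

lemma below_separatrix_f1_neg:
  assumes t: "t \<in> J" and "z t \<le> 0"
  shows "f1 t < 0"
proof -
  define u w s where "u = U t" and "w = W t" and "s = separatrix u"
  have uw: "0 < u" "0 < w" "w \<le> s" using UW_pos[OF t] assms by (auto simp: u_def w_def s_def z_def)
  have "0 < PP u s" unfolding s_def by (rule separatrix_PP_pos[OF uw(1)])
  have "0 < PP u w"
  proof (cases "w \<le> 2 * u")
    case True
    then have "w\<^sup>2 \<le> 2 * u * w" using uw by (simp add: power2_eq_square mult_right_mono)
    moreover have "0 < u\<^sup>2" using uw by simp
    ultimately show ?thesis unfolding PP_def using uw by linarith
  next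
    case False
    then have "0 \<le> (s - w) * (s + w - 2 * u)" using uw by (intro mult_nonneg_nonneg) auto
    also have "\<dots> = PP u w - PP u s" by (simp add: PP_def power2_eq_square algebra_simps)
    finally show ?thesis using \<open>0 < PP u s\<close> by simp
  qed
  then show ?thesis using f_UW(1)[OF t] pos[OF t] by (simp add: u_def w_def)
qed

lemma below_separatrix:
  assumes t0: "t0 \<in> J" and "z t0 < 0"
  shows "\<exists>t\<in>J. 0 \<le> f2 t"
proof (rule ccontr)
  assume "\<not> ?thesis"
  then have f2: "f2 t < 0" if "t \<in> J" for t using that by force
  have z: "z t < 0" if "t \<in> J" for t using z_sign[OF that t0] assms by (simp add: sgn_1_neg)
  have f1: "f1 t < 0" if "t \<in> J" for t
    using below_separatrix_f1_neg[OF that] z[OF that] by simp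
  obtain \<eta> where \<eta>: "0 < \<eta>" "(A \<longlongrightarrow> 0) (backward J)" "(B \<longlongrightarrow> \<eta>) (backward J)" "(C \<longlongrightarrow> \<eta>) (backward J)"
    using stays_asymptotics[OF t0] f1 f2 by metis
  note U0 = U_tendsto_0[OF \<eta>(2,3,4,1)]
  have WU: "U t \<le> W t" if "t \<in> J" for t
    using below_diagonal[OF that _ f2 U0(3)] by force
  have "\<forall>\<^sub>F t in backward J. - z t0 \<le> separatrix (U t)"
  proof (rule eventually_backward_le[OF t0])
    fix t assume t: "t \<in> J" "t \<le> t0"
    have "- z t0 \<le> - z t" using z_contract[OF t0 WU t] z[OF t0] z[OF t(1)] by simp
    also have "\<dots> \<le> separatrix (U t)" using UW_pos(2)[OF t(1)] by (simp add: z_def)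
    finally show "- z t0 \<le> separatrix (U t)" .
  qed
  moreover have "((\<lambda>t. separatrix (U t)) \<longlongrightarrow> 0) (backward J)"
    by (rule filterlim_compose[OF separatrix_tendsto_0 U0(3)])
  ultimately have "- z t0 \<le> 0" using tendsto_lowerbound backward_nontrivial by blast
  then show False using assms by simp
qed

lemma on_separatrix_asymptotics:
  assumes t0: "t0 \<in> J" and "z t0 = 0"
  shows "bdd_below J \<and> (\<exists>\<eta>>0.
    A \<sim>[at_right (Inf J)] (\<lambda>t. 64 * inverse \<eta> * (t - Inf J)) \<and>
    B \<sim>[at_right (Inf J)] (\<lambda>t. \<eta> + 4 * sqrt (2 * (t - Inf J))) \<and>
    C \<sim>[at_right (Inf J)] (\<lambda>t. \<eta> - 4 * sqrt (2 * (t - Inf J))))"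
proof -
  have z: "z t = 0" if "t \<in> J" for t using z_sign[OF that t0] assms by (simp add: sgn_0_0)
  have Ws: "W t = separatrix (U t)" if "t \<in> J" for t using z[OF that] by (simp add: z_def)
  have WU: "U t \<le> W t" if "t \<in> J" for t using Ws[OF that] separatrix_ge[OF UW_pos(1)[OF that]] by simp
  have f1: "f1 t < 0" if "t \<in> J" for t
    using below_separatrix_f1_neg[OF that] z[OF that] by simp
  have f2: "f2 t < 0" if t: "t \<in> J" for t
  proof -
    have "0 < DD (U t) (W t)" using UW_pos[OF t] WU[OF t] by (intro DD_pos) auto
    then have "0 < MM (U t) (W t)" using UW_pos[OF t] by (simp add: DD_def zero_less_mult_iff)
    then show ?thesis using f_UW(2)[OF t] pos[OF t] by simp
  qed
  obtain \<eta> where \<eta>: "0 < \<eta>" "(A \<longlongrightarrow> 0) (backward J)" "(B \<longlongrightarrow> \<eta>) (backward J)" "(C \<longlongrightarrow> \<eta>) (backward J)"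
    using stays_asymptotics[OF t0] f1 f2 by metis
  note U0 = U_tendsto_0[OF \<eta>(2,3,4,1)]
  have ratio: "((\<lambda>t. (W t)\<^sup>2 / U t) \<longlongrightarrow> 2) (backward J)"
  proof -
    have "\<forall>\<^sub>F t in backward J. (separatrix (U t))\<^sup>2 / U t = (W t)\<^sup>2 / U t"
      by (rule eventually_backward_le[OF t0]) (simp add: Ws)
    from Lim_transform_eventually[OF filterlim_compose[OF separatrix_square_ratio U0(3)] this] show ?thesis .
  qed
  have UUW: "((\<lambda>t. (U t)\<^sup>2 / W t) \<longlongrightarrow> 0) (backward J)"
  proof (rule tendsto_sandwich[of "\<lambda>_. 0" _ _ U])
    show "\<forall>\<^sub>F t in backward J. 0 \<le> (U t)\<^sup>2 / W t"
      by (rule eventually_backward_le[OF t0]) (simp add: UW_pos(2) less_imp_le)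
    show "\<forall>\<^sub>F t in backward J. (U t)\<^sup>2 / W t \<le> U t"
    proof (rule eventually_backward_le[OF t0])
      fix t assume t: "t \<in> J" "t \<le> t0"
      show "(U t)\<^sup>2 / W t \<le> U t"
        using UW_pos[OF t(1)] WU[OF t(1)] by (simp add: field_simps power2_eq_square)
    qed
  qed (use U0 in auto)
  define A' where "A' t = - (h t * A t * f2 t * f3 t)" for t
  \<comment> \<open>The form isolates the two indeterminate ratios, \<open>U^2 / W\<close> with
    limit 0 and \<open>W^2 / U\<close> with limit 2. The factors then have limits
    \<open>2 / \<eta>\<close>, 4, 4 and 2, which produces the constant 64.\<close>
  define r where "r t = 2 * (C t / (B t)\<^sup>2) * (3 * W t + 4 + 2 * U t - (U t)\<^sup>2 / W t)
    * ((U t)\<^sup>2 / W t + W t + 4 + 2 * U t) * ((W t)\<^sup>2 / U t)" for t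
  have "(r \<longlongrightarrow> 2 * (\<eta> / \<eta>\<^sup>2) * (3 * 0 + 4 + 2 * 0 - 0) * (0 + 0 + 4 + 2 * 0) * 2) (backward J)"
    unfolding r_def using \<eta> by (intro tendsto_intros U0 UUW ratio) auto
  moreover have "2 * (\<eta> / \<eta>\<^sup>2) * (3 * 0 + 4 + 2 * 0 - 0) * (0 + 0 + 4 + 2 * 0) * 2 = 64 / \<eta>"
    using \<eta> by (simp add: power2_eq_square)
  ultimately have "(r \<longlongrightarrow> 64 / \<eta>) (backward J)" by simp
  moreover have "\<forall>\<^sub>F t in backward J. r t = A' t"
  proof (rule eventually_backward_le[OF t0])
    fix t assume t: "t \<in> J" "t \<le> t0"
    note p = pos[OF t(1)] and uw = UW_pos[OF t(1)]
    have M: "3 * W t + 4 + 2 * U t - (U t)\<^sup>2 / W t = MM (U t) (W t) / W t"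
      using uw by (simp add: MM_def power2_eq_square field_simps)
    have R: "(U t)\<^sup>2 / W t + W t + 4 + 2 * U t = ((U t)\<^sup>2 + W t * (W t + 4) + 2 * U t * W t) / W t"
      using uw by (simp add: power2_eq_square field_simps)
    have A: "A t = C t * U t" using p by (simp add: U_def)
    define m R where "m = MM (U t) (W t)" and "R = (U t)\<^sup>2 + W t * (W t + 4) + 2 * U t * W t"
    show "r t = A' t"
      unfolding r_def A'_def M R f_UW[OF t(1)] h_def m_def[symmetric] R_def[symmetric] A
      using p uw by (simp add: power2_eq_square field_simps)
  qed
  ultimately have A': "(A' \<longlongrightarrow> 64 / \<eta>) (backward J)" by (rule Lim_transform_eventually)
  have dA': "(A has_real_derivative A' t) (at t)" if "t \<in> J" for t
    unfolding A'_def by (rule dA[OF that])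
  have bdd: "bdd_below J"
  proof -
    \<comment> \<open>Half of the limit of \<open>A'\<close>: from some time backward
      \<open>A\<close> falls at least at this rate, and its positivity bounds \<open>J\<close>
      below.\<close>
    define c where "c = 32 / \<eta>"
    have c: "0 < c" "c < 64 / \<eta>" using \<eta> by (auto simp: c_def divide_strict_right_mono)
    obtain t2 where t2: "t2 \<in> J" "\<And>t. t \<in> J \<Longrightarrow> t < t2 \<Longrightarrow> c < A' t"
      using order_tendstoD(1)[OF A' c(2)] unfolding eventually_backward by blast
    obtain t3 where t3: "t3 \<in> J" "t3 < t2" using below[OF t2(1)] by blast
    have "A t - c * t \<le> A t3 - c * t3" if t: "t \<in> J" "t \<le> t3" for t
    proof (rule deriv_mono[OF t(1) t3(1) t(2)])
      show "((\<lambda>t. A t - c * t) has_real_derivative A' s - c) (at s)" if "s \<in> J" for s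
        by (auto intro!: derivative_eq_intros dA'[OF that])
      show "0 \<le> A' s - c" if "s \<in> J" "s \<le> t3" for s using t2(2)[of s] that t3 by simp
    qed
    then have *: "c * (t3 - t) \<le> A t3" if t: "t \<in> J" "t \<le> t3" for t
      using that pos[OF t(1)] by (force simp: right_diff_distrib)
    show ?thesis
    proof (rule bdd_belowI)
      fix t assume t: "t \<in> J"
      show "min t3 (t3 - A t3 / c) \<le> t"
      proof (cases "t \<le> t3")
        case True
        have "t3 - t \<le> A t3 / c" using *[OF t True] c by (simp add: field_simps)
        then show ?thesis by simp
      qed simp
    qed
  qed
  define a where "a = Inf J"
  have ba: "backward J = at_right a" unfolding a_def by (rule backward_eq_at_right[OF bdd])
  have "\<forall>\<^sub>F t in backward J. (A has_real_derivative A' t) (at t)"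
    by (rule eventually_backward_le[OF t0]) (rule dA')
  then have lim: "((\<lambda>t. A t / (t - a)) \<longlongrightarrow> 64 / \<eta>) (at_right a)"
    using \<eta>(2) A' unfolding ba by (intro tendsto_quotient_at_right)
  have "A \<sim>[at_right a] (\<lambda>t. 64 * inverse \<eta> * (t - a))"
  proof (rule asymp_equivI')
    have "((\<lambda>t. A t / (t - a) / (64 / \<eta>)) \<longlongrightarrow> (64 / \<eta>) / (64 / \<eta>)) (at_right a)"
      using \<eta> by (intro tendsto_intros lim) auto
    then show "((\<lambda>t. A t / (64 * inverse \<eta> * (t - a))) \<longlongrightarrow> 1) (at_right a)"
      using \<eta> by (simp add: field_simps)
  qed
  \<comment> \<open>The square root vanishes at \<open>a\<close>, so both sides have the same
    nonzero limit \<open>\<eta>\<close>.\<close>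
  moreover have "Z \<sim>[at_right a] (\<lambda>t. \<eta> + c * sqrt (2 * (t - a)))" if Z: "(Z \<longlongrightarrow> \<eta>) (at_right a)" for Z c
  proof (rule asymp_equivI')
    have "((\<lambda>t. Z t / (\<eta> + c * sqrt (2 * (t - a)))) \<longlongrightarrow> \<eta> / (\<eta> + c * sqrt (2 * (a - a)))) (at_right a)"
      using \<eta> by (intro tendsto_intros Z) auto
    then show "((\<lambda>t. Z t / (\<eta> + c * sqrt (2 * (t - a)))) \<longlongrightarrow> 1) (at_right a)" using \<eta> by simp
  qed
  from this[of B 4] this[of C "-4"] have "B \<sim>[at_right a] (\<lambda>t. \<eta> + 4 * sqrt (2 * (t - a)))"
    "C \<sim>[at_right a] (\<lambda>t. \<eta> - 4 * sqrt (2 * (t - a)))"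
    using \<eta> unfolding ba by simp_all
  ultimately show ?thesis using bdd \<eta>(1) unfolding a_def by blast
qed

end

section \<open>From maximal solutions to the backward dynamics\<close>

lemma xcf_order_preserved:
  assumes sol: "xcf_solution_on J A B C"
    and ivl: "\<And>s t r. s \<in> J \<Longrightarrow> t \<in> J \<Longrightarrow> s \<le> r \<Longrightarrow> r \<le> t \<Longrightarrow> r \<in> J"
    and t0: "t0 \<in> J" "C t0 < B t0" and t: "t \<in> J"
  shows "C t < B t"
proof -
  define k where "k t = - (2 / (A t * B t * C t)\<^sup>2) * F1 (A t) (B t) (C t) *
    (F3 (A t) (B t) (C t) + 4 * C t * (A t + B t + C t))" for t
  have pos: "0 < A t" "0 < B t" "0 < C t" if "t \<in> J" for t
    using sol that by (auto simp: xcf_solution_on_def)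
  have der: "((\<lambda>t. B t - C t) has_real_derivative k t * (B t - C t)) (at t)" if "t \<in> J" for t
  proof -
    define x where "x = 2 / (A t * B t * C t)\<^sup>2"
    define a b c where "a = A t" and "b = B t" and "c = C t"
    have "((\<lambda>t. B t - C t) has_real_derivative - (x * b * F3 a b c * F1 a b c) - - (x * c * F1 a b c * F2 a b c)) (at t)"
      using sol that unfolding xcf_solution_on_def x_def a_def b_def c_def
      by (intro DERIV_diff) (auto simp: mult_ac)
    also have "- (x * b * F3 a b c * F1 a b c) - - (x * c * F1 a b c * F2 a b c)
        = - x * F1 a b c * (b * F3 a b c - c * F2 a b c)"
      by (simp add: algebra_simps)
    \<comment> \<open>Divisibility by \<open>b - c\<close> makes \<open>B - C\<close> a solution of
      a homogeneous linear equation, so its sign is preserved.\<close>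
    also have "b * F3 a b c - c * F2 a b c = (F3 a b c + 4 * c * (a + b + c)) * (b - c)"
      by (simp add: F3_eq F2_eq algebra_simps power2_eq_square)
    finally show ?thesis by (simp add: k_def x_def a_def b_def c_def mult.assoc)
  qed
  have cont: "continuous_on J A" "continuous_on J B" "continuous_on J C"
    using sol unfolding xcf_solution_on_def by (meson DERIV_continuous continuous_at_imp_continuous_on)+
  have "A t * B t * C t \<noteq> 0" if "t \<in> J" for t using pos[OF that] by simp
  then have k: "continuous_on J k"
    unfolding k_def F1_def F3_def by (intro continuous_intros cont) auto
  have step: "sgn (B t - C t) = sgn (B s - C s)" if "s \<in> J" "t \<in> J" "s \<le> t" for s t
  proof -
    have sub: "{s..t} \<subseteq> J" using ivl[OF that(1,2)] by auto
    have "B t - C t = (B s - C s) * exp (integral {s..t} k)"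
      using sub by (intro linear_ode_solution[OF that(3) continuous_on_subset[OF k sub]]
          has_field_derivative_at_within[OF der]) auto
    then show ?thesis by (simp add: sgn_mult)
  qed
  have "sgn (B t - C t) = sgn (B t0 - C t0)" using step t0(1) t by (metis linear)
  then show ?thesis using t0(2) by (simp add: sgn_1_pos)
qed

lemma xcf_maximal_backward:
  assumes max: "xcf_maximal_solution Tb Tf A B C" and BC: "C 0 < B 0"
  shows "xcf_backward (einterval (- Tb) Tf) A B C"
proof -
  let ?J = "einterval (- Tb) Tf"
  have T: "0 < Tb" "0 < Tf" and sol: "xcf_solution_on ?J A B C"
    using max by (auto simp: xcf_maximal_solution_def)
  have "- Tb < 0" using T by (simp add: ereal_uminus_less_reorder)
  then have J0: "0 \<in> ?J" using T by (simp add: einterval_def zero_ereal_def)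
  have ivl: "r \<in> ?J" if "s \<in> ?J" "t \<in> ?J" "s \<le> r" "r \<le> t" for s t r
    using that by (auto simp: einterval_def intro: less_le_trans[of _ "ereal s"] le_less_trans[of _ "ereal t"])
  show ?thesis
  proof unfold_locales
    show "?J \<noteq> {}" using J0 by blast
    show "r \<in> ?J" if "s \<in> ?J" "t \<in> ?J" "s \<le> r" "r \<le> t" for s t r by (rule ivl[OF that])
    show "\<exists>s\<in>?J. s < t" if t: "t \<in> ?J" for t
    proof -
      have "- Tb < ereal t" using t by (simp add: einterval_def)
      then obtain s where "- Tb < ereal s" "ereal s < ereal t" using ereal_dense2 by blast
      then show ?thesis using t by (intro bexI[of _ s]) (auto simp: einterval_def intro: less_trans[of _ "ereal t"])
    qed
    show "xcf_solution_on ?J A B C" by (rule sol)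
    show "C t < B t" if "t \<in> ?J" for t
      by (rule xcf_order_preserved[OF sol ivl J0 BC that])
    fix t1 m M assume asm: "t1 \<in> ?J" "0 < m" "m \<le> M"
      "\<And>t. t \<in> ?J \<Longrightarrow> t \<le> t1 \<Longrightarrow> A t \<in> {m..M} \<and> B t \<in> {m..M} \<and> C t \<in> {m..M}"
    show "\<not> bdd_below ?J"
    proof
      assume bdd: "bdd_below ?J"
      show False
      proof (cases Tb)
        case (real T)
        show False
          by (rule xcf_maximal_escape[OF max[unfolded real] asm(1)[unfolded real] asm(2,3)])
            (use asm(4) real in \<open>auto simp: mem_cbox3\<close>)
      next
        case PInf
        obtain l where l: "\<And>t. t \<in> ?J \<Longrightarrow> l \<le> t" using bdd by (auto simp: bdd_below_def)
        have "min l 0 - 1 \<in> ?J" using T PInf by (auto simp: einterval_def intro: less_trans[of _ 0])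
        from l[OF this] show False by simp
      qed (use T in auto)
    qed
  qed
qed

lemma einterval_bdd_below:
  assumes "0 < Tb" "0 < Tf" "bdd_below (einterval (- Tb) Tf)"
  obtains T where "Tb = ereal T" "Inf (einterval (- Tb) Tf) = - T"
proof (cases Tb)
  case (real T)
  let ?J = "einterval (- Tb) Tf"
  have T: "0 < T" using assms real by simp
  have lower: "- T \<le> t" if "t \<in> ?J" for t using that real by (simp add: einterval_def)
  have mem: "t \<in> ?J" if "- T < t" "t \<le> 0" for t
    using that assms real by (auto simp: einterval_def intro: le_less_trans[of _ 0])
  have "Inf ?J = - T"
  proof (rule cInf_eq_non_empty)
    show "?J \<noteq> {}" using mem[of 0] T by auto
    fix y assume y: "\<And>x. x \<in> ?J \<Longrightarrow> y \<le> x"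
    show "y \<le> - T"
    proof (rule ccontr)
      assume "\<not> y \<le> - T"
      then have "y \<le> min 0 ((y - T) / 2)" using T by (intro y mem) auto
      then show False using \<open>\<not> y \<le> - T\<close> by simp
    qed
  qed (use lower in auto)
  then show thesis using that real by blast
next
  case PInf
  obtain l where l: "\<And>t. t \<in> einterval (- Tb) Tf \<Longrightarrow> l \<le> t" using assms(3) by (auto simp: bdd_below_def)
  have "min l 0 - 1 \<in> einterval (- Tb) Tf"
    using assms PInf by (auto simp: einterval_def intro: less_trans[of _ 0])
  from l[OF this] show thesis by simp
qed (use assms in auto)

section \<open>The separating hypersurface\<close>

text \<open>The cone \<open>w = separatrix u\<close> solved for \<open>b\<close>, so that the
  hypersurface becomes a graph over \<open>(a, c)\<close>.\<close>

definition sep_height :: "real \<Rightarrow> real \<Rightarrow> real" where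
  "sep_height a c = c + c * separatrix (a / c)"

definition sep_surface :: "(real \<times> real \<times> real) set" where
  "sep_surface = {(a, b, c). 0 < a \<and> 0 < c \<and> b = sep_height a c}"

definition below_surface :: "(real \<times> real \<times> real) set" where
  "below_surface = {(a, b, c). 0 < a \<and> 0 < c \<and> c < b \<and> b < sep_height a c}"

definition above_surface :: "(real \<times> real \<times> real) set" where
  "above_surface = {(a, b, c). 0 < a \<and> 0 < c \<and> sep_height a c < b}"

lemma sep_height_gt:
  assumes "0 < a" "0 < c"
  shows "c < sep_height a c"
proof -
  have "0 < a / c" using assms by simp
  also have "\<dots> \<le> separatrix (a / c)" using assms by (intro separatrix_ge) simp
  finally show ?thesis using assms by (simp add: sep_height_def)
qed

lemma Q_partition:
  "Q = below_surface \<union> sep_surface \<union> above_surface"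
  "below_surface \<inter> above_surface = {}" "sep_surface \<inter> below_surface = {}" "sep_surface \<inter> above_surface = {}"
  using sep_height_gt
  by (fastforce simp: Q_def below_surface_def sep_surface_def above_surface_def)+

lemma
  assumes max: "xcf_maximal_solution Tb Tf A B C"
  shows case1_below: "(A 0, B 0, C 0) \<in> below_surface \<Longrightarrow> case1 Tb A B C"
    and case2_above: "(A 0, B 0, C 0) \<in> above_surface \<Longrightarrow> case2 Tb A B C"
    and exceptional_on: "(A 0, B 0, C 0) \<in> sep_surface \<Longrightarrow> case_exceptional Tb A B C"
proof -
  let ?J = "einterval (- Tb) Tf"
  have T: "0 < Tb" "0 < Tf" using max by (auto simp: xcf_maximal_solution_def)
  have "- Tb < 0" using T by (simp add: ereal_uminus_less_reorder)
  then have J0: "0 \<in> ?J" using T by (simp add: einterval_def zero_ereal_def)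
  show "case1 Tb A B C" if q: "(A 0, B 0, C 0) \<in> below_surface"
  proof -
    have "C 0 < B 0" "0 < C 0" "B 0 < sep_height (A 0) (C 0)" using q by (auto simp: below_surface_def)
    then interpret xcf_backward ?J A B C by (intro xcf_maximal_backward max)
    have "z 0 < 0" using \<open>0 < C 0\<close> \<open>B 0 < sep_height (A 0) (C 0)\<close>
      by (simp add: z_def W_def U_def sep_height_def field_simps)
    from below_separatrix[OF J0 this] obtain t where "t \<in> ?J" "0 \<le> f2 t" by blast
    note as = case1_asymptotics[OF this]
    obtain T where "Tb = ereal T" "Inf ?J = - T" using einterval_bdd_below[OF T] as by blast
    then show ?thesis using as unfolding case1_def by simp
  qed
  show "case2 Tb A B C" if q: "(A 0, B 0, C 0) \<in> above_surface"
  proof -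
    have *: "0 < A 0" "0 < C 0" "sep_height (A 0) (C 0) < B 0" using q by (auto simp: above_surface_def)
    then have "C 0 < B 0" using sep_height_gt[of "A 0" "C 0"] by simp
    then interpret xcf_backward ?J A B C by (intro xcf_maximal_backward max)
    have "0 < z 0" using * by (simp add: z_def W_def U_def sep_height_def field_simps)
    from above_separatrix[OF J0 this] obtain t where "t \<in> ?J" "0 \<le> f1 t" by blast
    note as = case2_asymptotics[OF this]
    obtain T where "Tb = ereal T" "Inf ?J = - T" using einterval_bdd_below[OF T] as by blast
    then show ?thesis using as unfolding case2_def by simp
  qed
  show "case_exceptional Tb A B C" if q: "(A 0, B 0, C 0) \<in> sep_surface"
  proof -
    have *: "0 < A 0" "0 < C 0" "sep_height (A 0) (C 0) = B 0" using q by (auto simp: sep_surface_def)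
    then have "C 0 < B 0" using sep_height_gt[of "A 0" "C 0"] by simp
    then interpret xcf_backward ?J A B C by (intro xcf_maximal_backward max)
    have "z 0 = 0" using * by (simp add: z_def W_def U_def sep_height_def field_simps)
    note as = on_separatrix_asymptotics[OF J0 this]
    obtain T where "Tb = ereal T" "Inf ?J = - T" using einterval_bdd_below[OF T] as by blast
    then show ?thesis using as unfolding case_exceptional_def by simp
  qed
qed

section \<open>Mutual exclusion of the asymptotic regimes\<close>

lemma shifted_powr_limits:
  fixes T \<eta> :: real
  assumes "0 < \<eta>"
  shows "((\<lambda>t. \<eta> * (t + T) powr (3 / 14)) \<longlongrightarrow> 0) (at_right (- T))"
    and "filterlim (\<lambda>t. \<eta> * (t + T) powr (- 1 / 14)) at_top (at_right (- T))"
proof -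
  have "((\<lambda>t. t + T) \<longlongrightarrow> - T + T) (at_right (- T))" by (intro tendsto_intros)
  then have shift: "((\<lambda>t. t + T) \<longlongrightarrow> 0) (at_right (- T))" by simp
  have pos: "\<forall>\<^sub>F t in at_right (- T). 0 < t + T"
    using eventually_at_right_less[of "- T"] by eventually_elim simp
  then have nonneg: "\<forall>\<^sub>F t in at_right (- T). 0 \<le> t + T" by eventually_elim simp
  show "((\<lambda>t. \<eta> * (t + T) powr (3 / 14)) \<longlongrightarrow> 0) (at_right (- T))"
    using tendsto_mult[OF tendsto_const tendsto_powr'[OF shift tendsto_const, of "3 / 14"], of \<eta>] nonneg
    by simp
  have "((\<lambda>t. inverse \<eta> * (t + T) powr (1 / 14)) \<longlongrightarrow> 0) (at_right (- T))"
    using tendsto_mult[OF tendsto_const tendsto_powr'[OF shift tendsto_const, of "1 / 14"], of "inverse \<eta>"] nonneg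
    by simp
  moreover have "\<forall>\<^sub>F t in at_right (- T). 0 < inverse \<eta> * (t + T) powr (1 / 14)"
    using pos by eventually_elim (use assms in simp)
  ultimately have "filterlim (\<lambda>t. inverse (inverse \<eta> * (t + T) powr (1 / 14))) at_top (at_right (- T))"
    by (rule filterlim_inverse_at_top)
  then show "filterlim (\<lambda>t. \<eta> * (t + T) powr (- 1 / 14)) at_top (at_right (- T))"
    by (simp add: powr_minus)
qed

lemma case1_A_at_top:
  assumes "case1 Tb A B C"
  obtains T where "Tb = ereal T" "filterlim A at_top (at_right (- T))"
proof -
  obtain T \<eta>1 where T: "Tb = ereal T" and \<eta>: "0 < \<eta>1"
    "A \<sim>[at_right (- T)] (\<lambda>t. \<eta>1 * (t + T) powr (- 1 / 14))"
    using assms unfolding case1_def by (elim exE conjE)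
  have "filterlim A at_top (at_right (- T))"
    by (rule asymp_equiv_at_top_transfer[OF asymp_equiv_symI[OF \<eta>(2)] shifted_powr_limits(2)[OF \<eta>(1)]])
  with T show thesis by (rule that)
qed

lemma case2_limits:
  assumes "case2 Tb A B C"
  obtains T where "Tb = ereal T" "(A \<longlongrightarrow> 0) (at_right (- T))" "filterlim B at_top (at_right (- T))"
proof -
  obtain T \<eta>1 \<eta>2 where T: "Tb = ereal T" and \<eta>: "0 < \<eta>1" "0 < \<eta>2"
    "A \<sim>[at_right (- T)] (\<lambda>t. \<eta>1 * (t + T) powr (3 / 14))"
    "B \<sim>[at_right (- T)] (\<lambda>t. \<eta>2 * (t + T) powr (- 1 / 14))"
    using assms unfolding case2_def by (elim exE conjE)
  have "filterlim B at_top (at_right (- T))"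
    by (rule asymp_equiv_at_top_transfer[OF asymp_equiv_symI[OF \<eta>(4)] shifted_powr_limits(2)[OF \<eta>(2)]])
  moreover have "(A \<longlongrightarrow> 0) (at_right (- T))"
    by (rule asymp_equiv_tendsto_transfer[OF asymp_equiv_symI[OF \<eta>(3)] shifted_powr_limits(1)[OF \<eta>(1)]])
  ultimately show thesis using T that by blast
qed

lemma case_exceptional_limits:
  assumes "case_exceptional Tb A B C"
  obtains T \<eta> where "Tb = ereal T" "(A \<longlongrightarrow> 0) (at_right (- T))" "(B \<longlongrightarrow> \<eta>) (at_right (- T))"
proof -
  obtain T \<eta> where T: "Tb = ereal T" and \<eta>: "0 < \<eta>"
    "A \<sim>[at_right (- T)] (\<lambda>t. 64 * inverse \<eta> * (t + T))"
    "B \<sim>[at_right (- T)] (\<lambda>t. \<eta> + 4 * sqrt (2 * (t + T)))"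
    using assms unfolding case_exceptional_def by (elim exE conjE)
  have "((\<lambda>t. 64 * inverse \<eta> * (t + T)) \<longlongrightarrow> 64 * inverse \<eta> * (- T + T)) (at_right (- T))"
    "((\<lambda>t. \<eta> + 4 * sqrt (2 * (t + T))) \<longlongrightarrow> \<eta> + 4 * sqrt (2 * (- T + T))) (at_right (- T))"
    by (intro tendsto_intros)+
  then have lims: "((\<lambda>t. 64 * inverse \<eta> * (t + T)) \<longlongrightarrow> 0) (at_right (- T))"
    "((\<lambda>t. \<eta> + 4 * sqrt (2 * (t + T))) \<longlongrightarrow> \<eta>) (at_right (- T))" by simp_all
  have "(A \<longlongrightarrow> 0) (at_right (- T))" "(B \<longlongrightarrow> \<eta>) (at_right (- T))"
    by (rule asymp_equiv_tendsto_transfer[OF asymp_equiv_symI[OF \<eta>(2)] lims(1)],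
        rule asymp_equiv_tendsto_transfer[OF asymp_equiv_symI[OF \<eta>(3)] lims(2)])
  with T show thesis by (rule that)
qed

lemma at_top_not_tendsto:
  fixes f :: "real \<Rightarrow> real"
  assumes "filterlim f at_top F" "(f \<longlongrightarrow> c) F" "F \<noteq> bot"
  shows False
  using not_tendsto_and_filterlim_at_infinity[OF assms(3,2)] filterlim_at_top_imp_at_infinity[OF assms(1)] by simp

text \<open>The regimes are told apart by which coefficient diverges at the common left end. This
  turns the one-way implications for the parts of \<open>Q\<close> into an exact description of
  \<open>Q1\<close> and \<open>Q2\<close>.\<close>

lemma cases_exclusive:
  "\<not> (case1 Tb A B C \<and> case2 Tb A B C)"
  "\<not> (case1 Tb A B C \<and> case_exceptional Tb A B C)"
  "\<not> (case2 Tb A B C \<and> case_exceptional Tb A B C)"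
proof -
  have nt: "at_right (- T :: real) \<noteq> bot" for T by simp
  show "\<not> (case1 Tb A B C \<and> case2 Tb A B C)"
  proof
    assume asm: "case1 Tb A B C \<and> case2 Tb A B C"
    obtain T where T: "Tb = ereal T" "filterlim A at_top (at_right (- T))"
      using asm by (elim conjE case1_A_at_top)
    obtain T' where T': "Tb = ereal T'" "(A \<longlongrightarrow> 0) (at_right (- T'))"
      using asm by (elim conjE case2_limits)
    have "T' = T" using T(1) T'(1) by simp
    then show False using at_top_not_tendsto[OF T(2) _ nt] T'(2) by simp
  qed
  show "\<not> (case1 Tb A B C \<and> case_exceptional Tb A B C)"
  proof
    assume asm: "case1 Tb A B C \<and> case_exceptional Tb A B C"
    obtain T where T: "Tb = ereal T" "filterlim A at_top (at_right (- T))"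
      using asm by (elim conjE case1_A_at_top)
    obtain T' where T': "Tb = ereal T'" "(A \<longlongrightarrow> 0) (at_right (- T'))"
      using asm by (elim conjE case_exceptional_limits)
    have "T' = T" using T(1) T'(1) by simp
    then show False using at_top_not_tendsto[OF T(2) _ nt] T'(2) by simp
  qed
  show "\<not> (case2 Tb A B C \<and> case_exceptional Tb A B C)"
  proof
    assume asm: "case2 Tb A B C \<and> case_exceptional Tb A B C"
    obtain T where T: "Tb = ereal T" "filterlim B at_top (at_right (- T))"
      using asm by (elim conjE case2_limits)
    obtain T' \<eta> where T': "Tb = ereal T'" "(B \<longlongrightarrow> \<eta>) (at_right (- T'))"
      using asm by (elim conjE case_exceptional_limits)
    have "T' = T" using T(1) T'(1) by simp
    then show False using at_top_not_tendsto[OF T(2) _ nt] T'(2) by simp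
  qed
qed

lemma maximal_solution_through:
  assumes "q \<in> Q"
  obtains Tb Tf A B C where "xcf_maximal_solution Tb Tf A B C" "(A 0, B 0, C 0) = q"
proof -
  obtain a b c where q: "q = (a, b, c)" by (metis prod_cases3)
  then have "0 < a" "0 < b" "0 < c" using assms by (auto simp: Q_def)
  from xcf_maximal_solution_exists[OF this] show thesis using that q by metis
qed

text \<open>\<open>Q1\<close> asks for some maximal solution with the given behaviour, so one
  inclusion rests on \<open>xcf_maximal_solution_exists\<close>; the other excludes the remaining
  parts of \<open>Q\<close> by \<open>cases_exclusive\<close>.\<close>

lemma Q1_eq: "Q1 = below_surface"
proof (intro equalityI subsetI)
  fix q assume "q \<in> Q1"
  then obtain Tb Tf A B C where q: "q \<in> Q" "xcf_maximal_solution Tb Tf A B C" "(A 0, B 0, C 0) = q" "case1 Tb A B C"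
    unfolding Q1_def by auto
  show "q \<in> below_surface"
  proof (rule ccontr)
    assume "q \<notin> below_surface"
    then consider "q \<in> sep_surface" | "q \<in> above_surface" using q(1) Q_partition(1) by blast
    then show False
      using case2_above[OF q(2)] exceptional_on[OF q(2)] q(3,4) cases_exclusive[of Tb A B C] by cases auto
  qed
next
  fix q assume q: "q \<in> below_surface"
  then have "q \<in> Q" using Q_partition by blast
  then obtain Tb Tf A B C where s: "xcf_maximal_solution Tb Tf A B C" "(A 0, B 0, C 0) = q"
    by (rule maximal_solution_through)
  with case1_below[OF s(1)] q \<open>q \<in> Q\<close> show "q \<in> Q1" unfolding Q1_def by blast
qed

lemma Q2_eq: "Q2 = above_surface"
proof (intro equalityI subsetI)
  fix q assume "q \<in> Q2"
  then obtain Tb Tf A B C where q: "q \<in> Q" "xcf_maximal_solution Tb Tf A B C" "(A 0, B 0, C 0) = q" "case2 Tb A B C"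
    unfolding Q2_def by auto
  show "q \<in> above_surface"
  proof (rule ccontr)
    assume "q \<notin> above_surface"
    then consider "q \<in> sep_surface" | "q \<in> below_surface" using q(1) Q_partition(1) by blast
    then show False
      using case1_below[OF q(2)] exceptional_on[OF q(2)] q(3,4) cases_exclusive[of Tb A B C] by cases auto
  qed
next
  fix q assume q: "q \<in> above_surface"
  then have "q \<in> Q" using Q_partition by blast
  then obtain Tb Tf A B C where s: "xcf_maximal_solution Tb Tf A B C" "(A 0, B 0, C 0) = q"
    by (rule maximal_solution_through)
  with case2_above[OF s(1)] q \<open>q \<in> Q\<close> show "q \<in> Q2" unfolding Q2_def by blast
qed

section \<open>Smoothness of the separating hypersurface\<close>

definition wedge :: "(real \<times> real \<times> real) set" where
  "wedge = {p. 0 < fst p \<and> 0 < snd (snd p)}"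

lemma open_wedge: "open wedge"
  unfolding wedge_def by (intro open_Collect_conj open_Collect_less continuous_intros)

lemma Ck_on_cong:
  assumes "open U" "\<And>x. x \<in> U \<Longrightarrow> f x = g x" "Ck_on n U g"
  shows "Ck_on n U f"
  using assms(2,3)
proof (induction n arbitrary: f g)
  case 0
  then show ?case by (simp cong: continuous_on_cong)
next
  case (Suc n)
  have der: "(f has_derivative frechet_derivative g (at x)) (at x)" if "x \<in> U" for x
  proof -
    have "(g has_derivative frechet_derivative g (at x)) (at x)"
      using Suc.prems(2) that by (auto simp: frechet_derivative_works)
    then show ?thesis
      by (rule has_derivative_transform_within_open[OF _ \<open>open U\<close> that]) (simp add: Suc.prems(1))
  qed
  have eq: "frechet_derivative f (at x) = frechet_derivative g (at x)" if "x \<in> U" for x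
    using frechet_derivative_at[OF der[OF that]] by (rule sym)
  have "Ck_on n U (\<lambda>x. frechet_derivative f (at x) v)" for v
    by (rule Suc.IH[of _ "\<lambda>x. frechet_derivative g (at x) v"]) (use eq Suc.prems(2) in simp_all)
  then show ?case using der by (auto simp: differentiable_def)
qed

text \<open>This class is closed under directional derivatives because the separatrix solves a first-order
  equation with rational right-hand side.\<close>

inductive sep_fun :: "(real \<times> real \<times> real \<Rightarrow> real) \<Rightarrow> bool" where
  const: "sep_fun (\<lambda>_. x)"
| fst: "sep_fun (\<lambda>p. fst p)"
| snd_fst: "sep_fun (\<lambda>p. fst (snd p))"
| snd_snd: "sep_fun (\<lambda>p. snd (snd p))"
| sep: "sep_fun (\<lambda>p. separatrix (fst p * inverse (snd (snd p))))"
| add: "sep_fun f \<Longrightarrow> sep_fun g \<Longrightarrow> sep_fun (\<lambda>p. f p + g p)"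
| mult: "sep_fun f \<Longrightarrow> sep_fun g \<Longrightarrow> sep_fun (\<lambda>p. f p * g p)"
| inv: "sep_fun f \<Longrightarrow> (\<And>p. p \<in> wedge \<Longrightarrow> f p \<noteq> 0) \<Longrightarrow> sep_fun (\<lambda>p. inverse (f p))"

lemma sep_fun_diff: "sep_fun f \<Longrightarrow> sep_fun g \<Longrightarrow> sep_fun (\<lambda>p. f p - g p)"
  using sep_fun.add[OF _ sep_fun.mult[OF sep_fun.const, of g "-1"], of f] by simp

lemmas sep_fun_intros = sep_fun.const sep_fun.fst sep_fun.snd_fst sep_fun.snd_snd sep_fun.sep
  sep_fun.add sep_fun.mult sep_fun_diff

lemma sep_fun_derivative:
  assumes "sep_fun f"
  shows "\<exists>D. (\<forall>v. sep_fun (D v)) \<and> (\<forall>p\<in>wedge. (f has_derivative (\<lambda>v. D v p)) (at p))"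
  using assms
proof induction
  case (const x)
  show ?case by (intro exI[of _ "\<lambda>v p. 0"]) (auto intro: sep_fun.const)
next
  case fst
  show ?case by (intro exI[of _ "\<lambda>v p. fst v"]) (auto intro: sep_fun.const intro!: derivative_eq_intros)
next
  case snd_fst
  show ?case by (intro exI[of _ "\<lambda>v p. fst (snd v)"]) (auto intro: sep_fun.const intro!: derivative_eq_intros)
next
  case snd_snd
  show ?case by (intro exI[of _ "\<lambda>v p. snd (snd v)"]) (auto intro: sep_fun.const intro!: derivative_eq_intros)
next
  case (add f g)
  then obtain D E where D: "\<And>v. sep_fun (D v)" "\<And>p. p \<in> wedge \<Longrightarrow> (f has_derivative (\<lambda>v. D v p)) (at p)"
    and E: "\<And>v. sep_fun (E v)" "\<And>p. p \<in> wedge \<Longrightarrow> (g has_derivative (\<lambda>v. E v p)) (at p)" by blast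
  show ?case
    by (intro exI[of _ "\<lambda>v p. D v p + E v p"] conjI allI ballI sep_fun.add has_derivative_add D E)
next
  case (mult f g)
  then obtain D E where D: "\<And>v. sep_fun (D v)" "\<And>p. p \<in> wedge \<Longrightarrow> (f has_derivative (\<lambda>v. D v p)) (at p)"
    and E: "\<And>v. sep_fun (E v)" "\<And>p. p \<in> wedge \<Longrightarrow> (g has_derivative (\<lambda>v. E v p)) (at p)" by blast
  show ?case
    by (intro exI[of _ "\<lambda>v p. f p * E v p + D v p * g p"] conjI allI ballI sep_fun.add sep_fun.mult
        has_derivative_mult D E mult.hyps)
next
  case (inv f)
  then obtain D where D: "\<And>v. sep_fun (D v)" "\<And>p. p \<in> wedge \<Longrightarrow> (f has_derivative (\<lambda>v. D v p)) (at p)"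
    by blast
  have inv_f: "sep_fun (\<lambda>p. inverse (f p))" by (rule sep_fun.inv) (use inv.hyps in auto)
  show ?case
  proof (intro exI[of _ "\<lambda>v p. (- 1) * (inverse (f p) * D v p * inverse (f p))"] conjI allI ballI)
    show "sep_fun (\<lambda>p. (- 1) * (inverse (f p) * D v p * inverse (f p)))" for v
      by (intro sep_fun.mult sep_fun.const inv_f D)
    show "((\<lambda>p. inverse (f p)) has_derivative (\<lambda>v. (- 1) * (inverse (f p) * D v p * inverse (f p)))) (at p)"
      if "p \<in> wedge" for p
      using Deriv.has_derivative_inverse[OF inv.hyps(2)[OF that] D(2)[OF that]] by simp
  qed
next
  case sep
  define u where "u p = fst p * inverse (snd (snd p))" for p :: "real \<times> real \<times> real"
  have inv_c: "sep_fun (\<lambda>p. inverse (snd (snd p)))"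
    by (intro sep_fun.inv sep_fun.snd_snd) (simp add: wedge_def)
  have u: "sep_fun u" unfolding u_def by (intro sep_fun_intros inv_c)
  have s: "sep_fun (\<lambda>p. separatrix (u p))" unfolding u_def by (rule sep_fun.sep)
  have upos: "0 < u p" if "p \<in> wedge" for p using that by (simp add: u_def wedge_def)
  have D: "sep_fun (\<lambda>p. DD (u p) (separatrix (u p)))" "sep_fun (\<lambda>p. NN (u p) (separatrix (u p)))"
    unfolding DD_def MM_def NN_def PP_def power2_eq_square by (intro sep_fun_intros u s)+
  have "sep_fun (\<lambda>p. inverse (u p * (u p + 1) * DD (u p) (separatrix (u p))))"
  proof (rule sep_fun.inv)
    show "sep_fun (\<lambda>p. u p * (u p + 1) * DD (u p) (separatrix (u p)))" by (intro sep_fun_intros u D)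
    show "u p * (u p + 1) * DD (u p) (separatrix (u p)) \<noteq> 0" if "p \<in> wedge" for p
      using upos[OF that] DD_pos[of "u p" "separatrix (u p)"] separatrix_ge by force
  qed
  then have G: "sep_fun (\<lambda>p. GG (u p) (separatrix (u p)))"
    unfolding GG_def divide_inverse by (intro sep_fun.mult D)
  \<comment> \<open>Chain rule: the derivative of \<open>a / c\<close> in direction
    \<open>v\<close>, times the right-hand side of the scalar equation on the separatrix.\<close>
  define E where "E v p = (fst v - u p * snd (snd v)) * inverse (snd (snd p)) * GG (u p) (separatrix (u p))"
    for v p :: "real \<times> real \<times> real"
  have "sep_fun (E v)" for v unfolding E_def by (intro sep_fun_intros u inv_c G)
  moreover have "((\<lambda>p. separatrix (u p)) has_derivative (\<lambda>v. E v p)) (at p)" if p: "p \<in> wedge" for p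
  proof -
    have "(u has_derivative (\<lambda>v. (fst v - u p * snd (snd v)) * inverse (snd (snd p)))) (at p)"
      unfolding u_def using p
      by (auto intro!: derivative_eq_intros simp: wedge_def field_simps)
    from DERIV_compose_FDERIV[OF separatrix_derivative[OF upos[OF p]] this]
    show ?thesis by (simp add: E_def)
  qed
  ultimately show ?case unfolding u_def by (intro exI[of _ E]) auto
qed

text \<open>The induction runs over triples because each directional derivative of such a map is
  again a triple of members of the class.\<close>

lemma Ck_on_sep_fun:
  assumes "sep_fun f" "sep_fun g" "sep_fun h"
  shows "Ck_on n wedge (\<lambda>p. (f p, g p, h p))"
  using assms
proof (induction n arbitrary: f g h)
  case 0
  have "continuous_on wedge f" if "sep_fun f" for f
    using sep_fun_derivative[OF that] by (meson continuous_at_imp_continuous_on has_derivative_continuous)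
  then show ?case using 0 by (auto intro!: continuous_intros)
next
  case (Suc n)
  obtain D1 D2 D3 where D: "\<And>v. sep_fun (D1 v)" "\<And>v. sep_fun (D2 v)" "\<And>v. sep_fun (D3 v)"
    "\<And>p. p \<in> wedge \<Longrightarrow> (f has_derivative (\<lambda>v. D1 v p)) (at p)"
    "\<And>p. p \<in> wedge \<Longrightarrow> (g has_derivative (\<lambda>v. D2 v p)) (at p)"
    "\<And>p. p \<in> wedge \<Longrightarrow> (h has_derivative (\<lambda>v. D3 v p)) (at p)"
    using Suc.prems[THEN sep_fun_derivative] by metis
  have der: "((\<lambda>p. (f p, g p, h p)) has_derivative (\<lambda>v. (D1 v p, D2 v p, D3 v p))) (at p)"
    if "p \<in> wedge" for p
    by (intro has_derivative_Pair D that)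
  have "Ck_on n wedge (\<lambda>p. frechet_derivative (\<lambda>p. (f p, g p, h p)) (at p) v)" for v
    using frechet_derivative_at[OF der, symmetric]
    by (intro Ck_on_cong[OF open_wedge _ Suc.IH[OF D(1)[of v] D(2)[of v] D(3)[of v]]]) simp
  moreover have "(\<lambda>p. (f p, g p, h p)) differentiable (at p)" if "p \<in> wedge" for p
    using der[OF that] unfolding differentiable_def by blast
  ultimately show ?case by simp
qed

lemma sep_fun_height: "sep_fun (\<lambda>p. sep_height (fst p) (snd (snd p)))"
  unfolding sep_height_def divide_inverse by (intro sep_fun_intros)

lemma continuous_on_height: "continuous_on wedge (\<lambda>p. sep_height (fst p) (snd (snd p)))"
  using sep_fun_derivative[OF sep_fun_height]
  by (meson continuous_at_imp_continuous_on has_derivative_continuous)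

text \<open>One global chart suffices: the shear that subtracts the height from the middle
  coordinate. The height depends on \<open>a\<close> and \<open>c\<close> alone, so the shear maps
  \<open>wedge\<close> onto itself and its inverse adds the height back.\<close>

lemma sep_surface_smooth: "smooth_embedded_hypersurface sep_surface"
proof -
  define H where "H p = sep_height (fst p) (snd (snd p))" for p :: "real \<times> real \<times> real"
  define \<phi> where "\<phi> p = (fst p, fst (snd p) - H p, snd (snd p))" for p :: "real \<times> real \<times> real"
  define \<psi> where "\<psi> p = (fst p, fst (snd p) + H p, snd (snd p))" for p :: "real \<times> real \<times> real"
  define e :: "real \<times> real \<times> real" where "e = (0, 1, 0)"
  have H: "sep_fun H" unfolding H_def by (rule sep_fun_height)
  have smooth: "smooth_on wedge \<phi>" "smooth_on wedge \<psi>"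
    unfolding smooth_on_def \<phi>_def \<psi>_def by (intro allI Ck_on_sep_fun sep_fun_intros H)+
  have "continuous_on wedge \<phi>" "continuous_on wedge \<psi>"
    using smooth unfolding smooth_on_def by (metis Ck_on.simps(1))+
  moreover have inv: "\<psi> (\<phi> p) = p" "\<phi> (\<psi> p) = p" for p by (simp_all add: \<phi>_def \<psi>_def H_def)
  moreover have wedge: "\<phi> p \<in> wedge \<longleftrightarrow> p \<in> wedge" "\<psi> p \<in> wedge \<longleftrightarrow> p \<in> wedge" for p
    by (simp_all add: \<phi>_def \<psi>_def wedge_def)
  ultimately have homeo: "homeomorphism wedge wedge \<phi> \<psi>"
    by (intro homeomorphismI) auto
  have flat: "\<phi> p \<bullet> e = 0 \<longleftrightarrow> p \<in> sep_surface" if "p \<in> wedge" for p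
    using that by (cases p) (auto simp: \<phi>_def e_def H_def sep_surface_def wedge_def inner_prod_def)
  have image: "\<phi> ` (wedge \<inter> sep_surface) = {y \<in> wedge. y \<bullet> e = 0}"
  proof (intro equalityI subsetI)
    fix y assume "y \<in> {y \<in> wedge. y \<bullet> e = 0}"
    then have "y = \<phi> (\<psi> y)" "\<psi> y \<in> wedge \<inter> sep_surface"
      using inv wedge flat[of "\<psi> y"] by auto
    then show "y \<in> \<phi> ` (wedge \<inter> sep_surface)" by (rule image_eqI)
  qed (use wedge flat in auto)
  have "e \<in> Basis" by (simp add: e_def Basis_prod_def zero_prod_def)
  moreover have "p \<in> wedge" if "p \<in> sep_surface" for p
    using that by (auto simp: sep_surface_def wedge_def)
  ultimately show ?thesis
    unfolding smooth_embedded_hypersurface_def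
    using open_wedge homeo smooth image by blast
qed

section \<open>Topology of the two sides\<close>

lemma open_surface_sides: "open below_surface" "open above_surface"
proof -
  define g where "g p = fst (snd p) - sep_height (fst p) (snd (snd p))" for p :: "real \<times> real \<times> real"
  have g: "continuous_on wedge g"
    unfolding g_def by (intro continuous_intros continuous_on_height)
  have "above_surface = wedge \<inter> g -` {0<..}" by (auto simp: above_surface_def wedge_def g_def)
  then show "open above_surface" using continuous_open_preimage[OF g open_wedge, of "{0<..}"] by simp
  have eq: "below_surface = (wedge \<inter> g -` {..<0}) \<inter> {p. snd (snd p) < fst (snd p)}"
    by (auto simp: below_surface_def wedge_def g_def)
  have o2: "open {p :: real \<times> real \<times> real. snd (snd p) < fst (snd p)}"
    by (intro open_Collect_less continuous_intros)
  have o1: "open (wedge \<inter> g -` {..<0})" using continuous_open_preimage[OF g open_wedge, of "{..<0}"] by simp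
  show "open below_surface" unfolding eq by (rule open_Int[OF o1 o2])
qed

text \<open>Each side is a continuous image of a convex product: points above are parametrised by
  their vertical distance from the surface, points below by the ratio of \<open>b - c\<close> to
  \<open>sep_height a c - c\<close>.\<close>

lemma connected_surface_sides: "connected below_surface" "connected above_surface"
proof -
  have conv: "connected ({0<..} \<times> I \<times> {0<..} :: (real \<times> real \<times> real) set)" if "convex I" for I :: "real set"
    using that by (intro convex_connected convex_Times) auto
  have ht: "continuous_on ({0<..} \<times> I \<times> {0<..}) (\<lambda>p. sep_height (fst p) (snd (snd p)))" for I :: "real set"
    by (rule continuous_on_subset[OF continuous_on_height]) (auto simp: wedge_def)
  have above: "above_surface = (\<lambda>p. (fst p, sep_height (fst p) (snd (snd p)) + fst (snd p), snd (snd p))) ` ({0<..} \<times> {0<..} \<times> {0<..})"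
  proof (intro equalityI subsetI)
    fix q assume "q \<in> above_surface"
    then obtain a b c where q: "q = (a, b, c)" "0 < a" "0 < c" "sep_height a c < b"
      by (auto simp: above_surface_def)
    then show "q \<in> (\<lambda>p. (fst p, sep_height (fst p) (snd (snd p)) + fst (snd p), snd (snd p))) ` ({0<..} \<times> {0<..} \<times> {0<..})"
      by (intro image_eqI[of _ _ "(a, b - sep_height a c, c)"]) auto
  qed (auto simp: above_surface_def)
  show "connected above_surface"
    unfolding above by (intro connected_continuous_image conv continuous_intros ht) auto
  have below: "below_surface = (\<lambda>p. (fst p, snd (snd p) + fst (snd p) * (sep_height (fst p) (snd (snd p)) - snd (snd p)), snd (snd p)))
      ` ({0<..} \<times> {0<..<1} \<times> {0<..})"
  proof (intro equalityI subsetI)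
    fix q assume "q \<in> below_surface"
    then obtain a b c where q: "q = (a, b, c)" "0 < a" "0 < c" "c < b" "b < sep_height a c"
      by (auto simp: below_surface_def)
    then show "q \<in> (\<lambda>p. (fst p, snd (snd p) + fst (snd p) * (sep_height (fst p) (snd (snd p)) - snd (snd p)), snd (snd p)))
      ` ({0<..} \<times> {0<..<1} \<times> {0<..})"
      by (intro image_eqI[of _ _ "(a, (b - c) / (sep_height a c - c), c)"]) auto
  next
    fix q assume "q \<in> (\<lambda>p. (fst p, snd (snd p) + fst (snd p) * (sep_height (fst p) (snd (snd p)) - snd (snd p)), snd (snd p)))
      ` ({0<..} \<times> {0<..<1} \<times> {0<..})"
    then obtain p where p: "p \<in> {0<..} \<times> {0<..<1} \<times> {0<..}"
      "q = (fst p, snd (snd p) + fst (snd p) * (sep_height (fst p) (snd (snd p)) - snd (snd p)), snd (snd p))"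
      by (elim imageE)
    define a l c where "a = fst p" and "l = fst (snd p)" and "c = snd (snd p)"
    have q: "q = (a, c + l * (sep_height a c - c), c)" "0 < a" "0 < l" "l < 1" "0 < c"
      using p by (auto simp: a_def l_def c_def)
    define d where "d = sep_height a c - c"
    have "0 < d" using sep_height_gt q by (simp add: d_def)
    then have "0 < l * d" "l * d < d" using q by auto
    then show "q \<in> below_surface" using q by (simp add: below_surface_def d_def)
  qed
  show "connected below_surface"
    unfolding below by (intro connected_continuous_image conv continuous_intros ht) auto
qed

lemma surface_sides_nonempty: "below_surface \<noteq> {}" "above_surface \<noteq> {}"
proof -
  have "1 < sep_height 1 1" by (rule sep_height_gt) auto
  then have "(1, (1 + sep_height 1 1) / 2, 1) \<in> below_surface" "(1, sep_height 1 1 + 1, 1) \<in> above_surface"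
    by (auto simp: below_surface_def above_surface_def)
  then show "below_surface \<noteq> {}" "above_surface \<noteq> {}" by blast+
qed

text \<open>A component meeting both pieces would be split by the two open sets, so each connected
  piece is a whole component.\<close>

lemma components_Un_open_disjoint:
  fixes X Y :: "'a::topological_space set"
  assumes "open X" "open Y" "connected X" "connected Y" "X \<inter> Y = {}" "X \<noteq> {}" "Y \<noteq> {}"
  shows "components (X \<union> Y) = {X, Y}"
proof -
  have comp: "connected_component_set (X \<union> Y) x = X"
    if "open X" "open Y" "connected X" "X \<inter> Y = {}" "x \<in> X" for X Y :: "'a set" and x
  proof
    show "X \<subseteq> connected_component_set (X \<union> Y) x"
      by (rule connected_component_maximal) (use that in auto)
    let ?C = "connected_component_set (X \<union> Y) x"
    have sub: "?C \<subseteq> X \<union> Y" by (rule connected_component_subset)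
    moreover have "x \<in> ?C" using that by (simp add: connected_component_refl)
    ultimately have "Y \<inter> ?C = {}"
      using connectedD[OF connected_connected_component[of "X \<union> Y" x] that(1,2)] that by blast
    then show "?C \<subseteq> X" using sub by blast
  qed
  have "connected_component_set (X \<union> Y) x = (if x \<in> X then X else Y)" if "x \<in> X \<union> Y" for x
    using comp[of X Y x] comp[of Y X x] that assms by (auto simp: Un_commute)
  then have "components (X \<union> Y) = (\<lambda>x. if x \<in> X then X else Y) ` (X \<union> Y)"
    unfolding components_def by (intro image_cong) auto
  also have "\<dots> = {X, Y}" using assms by (auto simp: image_iff)
  finally show ?thesis .
qed

text \<open>Raising \<open>b\<close> moves a point of the surface off the graph while staying in
  \<open>Q\<close>.\<close>

lemma Q_subset_closure: "Q \<subseteq> closure (Q - sep_surface)"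
proof
  fix q assume q: "q \<in> Q"
  show "q \<in> closure (Q - sep_surface)"
  proof (cases "q \<in> sep_surface")
    case True
    then obtain a b c where abc: "q = (a, b, c)" "0 < a" "0 < c" "b = sep_height a c"
      by (auto simp: sep_surface_def)
    define x where "x n = (a, b + inverse (real (Suc n)), c)" for n
    have "x n \<in> Q - sep_surface" for n
      using sep_height_gt[OF abc(2,3)] abc by (auto simp: x_def Q_def sep_surface_def intro: less_trans)
    moreover have "x \<longlonglongrightarrow> (a, b + 0, c)"
      unfolding x_def by (intro tendsto_intros LIMSEQ_inverse_real_of_nat)
    ultimately have "(a, b + 0, c) \<in> closure (Q - sep_surface)" 
      unfolding closure_sequential by (intro exI[of _ x] conjI allI)
    then show ?thesis using abc by simp
  next
    case False
    with q have "q \<in> Q - sep_surface" by simp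
    then show ?thesis by (rule subsetD[OF closure_subset])
  qed
qed

theorem theorem3p3:
  shows "(\<exists>Q0. Q0 \<subseteq> Q \<and> open Q0 \<and> Q \<subseteq> closure Q0 \<and>
            (\<forall>Tb Tf A B C.
               xcf_maximal_solution Tb Tf A B C \<and> (A 0, B 0, C 0) \<in> Q0
               \<longrightarrow> case1 Tb A B C \<or> case2 Tb A B C)) \<and>
         (\<exists>S0. S0 \<subseteq> Q \<and> smooth_embedded_hypersurface S0 \<and>
            components (Q - S0) = {Q1, Q2} \<and> Q1 \<noteq> Q2 \<and>
            (\<forall>Tb Tf A B C.
               xcf_maximal_solution Tb Tf A B C \<and> (A 0, B 0, C 0) \<in> S0
               \<longrightarrow> case_exceptional Tb A B C))"
proof -
  have diff: "Q - sep_surface = below_surface \<union> above_surface" using Q_partition by blast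
  have sub: "sep_surface \<subseteq> Q" "Q - sep_surface \<subseteq> Q" using Q_partition by blast+
  have comp: "components (Q - sep_surface) = {Q1, Q2}"
    unfolding diff Q1_eq Q2_eq
    by (intro components_Un_open_disjoint open_surface_sides connected_surface_sides Q_partition
        surface_sides_nonempty)
  have neq: "Q1 \<noteq> Q2"
    unfolding Q1_eq Q2_eq using Q_partition(2) surface_sides_nonempty by blast
  have op: "open (Q - sep_surface)" unfolding diff by (intro open_Un open_surface_sides)
  show ?thesis
  \<comment> \<open>The same surface serves both parts: its complement in \<open>Q\<close> is the
    open dense set, and it is itself the exceptional set.\<close>
  proof (rule conjI, rule exI[of _ "Q - sep_surface"], intro conjI allI impI)
    show "case1 Tb A B C \<or> case2 Tb A B C"
      if "xcf_maximal_solution Tb Tf A B C \<and> (A 0, B 0, C 0) \<in> Q - sep_surface" for Tb Tf A B C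
      using case1_below[of Tb Tf A B C] case2_above[of Tb Tf A B C] that unfolding diff by blast
  next
    show "\<exists>S0\<subseteq>Q. smooth_embedded_hypersurface S0 \<and> components (Q - S0) = {Q1, Q2} \<and> Q1 \<noteq> Q2 \<and>
        (\<forall>Tb Tf A B C. xcf_maximal_solution Tb Tf A B C \<and> (A 0, B 0, C 0) \<in> S0 \<longrightarrow> case_exceptional Tb A B C)"
      by (rule exI[of _ sep_surface], intro conjI allI impI)
        (elim conjE exceptional_on | rule sub sep_surface_smooth comp neq)+
  qed (rule sub op Q_subset_closure)+
qed

end
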